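(* Let $\{w_t\}_{t\ge0}$ be sampled from a joint distribution $\mathcal{W}$ (not necessarily i.i.d. or zero-mean) for which there is $m>0$ with $\mathbb{E}[w_t^\top w_{t'}]\le m$ for all $t,t'$. For $k\ge1$ predictions, the optimal control policy (corresponding to $\mathsf{STO}_k$) is given by $$u_t = -(R + B^\top P B)^{-1} B^\top \Bigg(P A x_t + \sum_{i=0}^{k-1} (F^\top)^i P w_{t+i} + \sum_{i=k}^\infty (F^\top)^i P \mu_{t+i|t+k-1}\Bigg),$$ where $\mu_{t'|t} = \mathbb{E}[w_{t'} \mid w_0, \dots, w_t]$. Under this policy, the marginal benefit of obtaining an extra prediction decays exponentially fast in the existing number $k$ of predictions: for $k\ge1$, $$\mathsf{STO}_k - \mathsf{STO}_{k+1} = O(\|F^k\|^2) = O(\lambda^{2k}).$$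
   Context: System and cost: $x_{t+1} = A x_t + B u_t + w_t$ with $x_t\in\mathbb{R}^n$, $u_t\in\mathbb{R}^d$, given $x_0$, and for horizon $T\ge1$ the cost is $J = \sum_{t=0}^{T-1} (x_t^\top Q x_t + u_t^\top R u_t) + x_T^\top Q_f x_T$. Standing assumptions: $Q,Q_f\succeq 0$, $R\succ 0$ (symmetric); $(A,B)$ is stabilizable, i.e. there is $K_0$ with $\rho(A-BK_0)<1$ ($\rho$ = spectral radius); $(A,Q)$ is detectable, i.e. $(A^\top,Q)$ is stabilizable. $P$ is the (unique positive semidefinite) solution of $P = Q + A^\top P A - A^\top P B(R + B^\top P B)^{-1} B^\top PA$; $K=(R+B^\top PB)^{-1}B^\top PA$; $F=A-BK$, which satisfies $\rho(F)<1$; $\lambda=\frac{1+\rho(F)}2<1$. $\|\cdot\|$ is the spectral norm. Predictions: the joint distribution $\mathcal{W}$ is known to the controller; with $k$ (exact) predictions, the controller chooses $u_t$ as an arbitrary function of $x_0,w_0,\dots,w_{t+k-1}$. With $W_t=W_t(w_0,\dots,w_{t-1})$ the conditional distribution of $w_t$ given $w_0,\dots,w_{t-1}$, $$\mathit{STO}^T_k = \mathbb{E}_{w_0\sim W_0,\dots,w_{k-1}\sim W_{k-1}} \Big( \min_{u_0} \Big( \mathbb{E}_{w_k\sim W_k} \Big( \cdots \min_{u_{T-k-1}} \Big( \mathbb{E}_{w_{T-1}\sim W_{T-1}} \Big( \min_{u_{T-k}, \dots, u_{T-1}} J \Big) \Big) \Big) \Big) \Big),$$ and $\mathsf{STO}_k=\lim_{T\to\infty}\frac1T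 \mathit{STO}^T_k$ (limits understood to exist). A policy with $k$ predictions is optimal (corresponding to $\mathsf{STO}_k$) if its long-run average expected cost $\lim_{T\to\infty}\frac1T\mathbb{E}[J]$ equals $\mathsf{STO}_k$. Notation: $f(k)=O(g(k))$ means there is $C>0$ (independent of $k$) with $|f(k)|\le C\,g(k)$ for all $k\ge1$. *)

theory Defs
  imports "HOL-Probability.Probability"
begin

section \<open>Matrices\<close>

text \<open>The type \<^typ>\<open>real^'n^'n\<close> inherits the componentwise product from the type class
  \<^class>\<open>times\<close>, so \<open>A ^ k\<close> would be a componentwise power.\<close>

primrec matrix_power :: "real^'n^'n \<Rightarrow> nat \<Rightarrow> real^'n^'n" where
  "matrix_power A 0 = mat 1"
| "matrix_power A (Suc k) = A ** matrix_power A k"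

definition complex_spectrum :: "real^'n^'n \<Rightarrow> complex set" where
  "complex_spectrum A =
    {z. \<exists>v :: complex^'n. v \<noteq> 0 \<and> (\<chi> i j. complex_of_real (A $ i $ j)) *v v = z *s v}"

definition spec_radius :: "real^'n^'n \<Rightarrow> real" where
  "spec_radius A = Max (cmod ` complex_spectrum A)"

definition spectral_norm :: "real^'n^'m \<Rightarrow> real" where
  "spectral_norm A = onorm (\<lambda>x. A *v x)"

definition pos_semidef :: "real^'n^'n \<Rightarrow> bool" where
  "pos_semidef A \<longleftrightarrow> transpose A = A \<and> (\<forall>x. 0 \<le> x \<bullet> (A *v x))"

definition pos_definite :: "real^'n^'n \<Rightarrow> bool" where
  "pos_definite A \<longleftrightarrow> transpose A = A \<and> (\<forall>x. x \<noteq> 0 \<longrightarrow> 0 < x \<bullet> (A *v x))"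

definition stabilizable :: "real^'n^'n \<Rightarrow> real^'d^'n \<Rightarrow> bool" where
  "stabilizable A B \<longleftrightarrow> (\<exists>K0 :: real^'n^'d. spec_radius (A - B ** K0) < 1)"

definition detectable :: "real^'n^'n \<Rightarrow> real^'n^'n \<Rightarrow> bool" where
  "detectable A Q \<longleftrightarrow> stabilizable (transpose A) Q"

definition riccati_solution ::
    "real^'n^'n \<Rightarrow> real^'d^'n \<Rightarrow> real^'n^'n \<Rightarrow> real^'d^'d \<Rightarrow> real^'n^'n \<Rightarrow> bool" where
  "riccati_solution A B Q R P \<longleftrightarrow>
     P = Q + transpose A ** P ** A
           - transpose A ** P ** B ** matrix_inv (R + transpose B ** P ** B)
               ** transpose B ** P ** A"

definition lqr_gain :: "real^'n^'n \<Rightarrow> real^'d^'n \<Rightarrow> real^'d^'d \<Rightarrow> real^'n^'n \<Rightarrow> real^'n^'d" where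
  "lqr_gain A B R P = matrix_inv (R + transpose B ** P ** B) ** transpose B ** P ** A"


section \<open>Trajectories and cost\<close>

primrec state :: "real^'n^'n \<Rightarrow> real^'d^'n \<Rightarrow> real^'n \<Rightarrow> (nat \<Rightarrow> real^'d) \<Rightarrow> (nat \<Rightarrow> real^'n)
    \<Rightarrow> nat \<Rightarrow> real^'n" where
  "state A B x0 u w 0 = x0"
| "state A B x0 u w (Suc t) = A *v state A B x0 u w t + B *v u t + w t"

definition lqr_cost :: "real^'n^'n \<Rightarrow> real^'d^'n \<Rightarrow> real^'n^'n \<Rightarrow> real^'d^'d \<Rightarrow> real^'n^'n \<Rightarrow> real^'n
    \<Rightarrow> nat \<Rightarrow> (nat \<Rightarrow> real^'d) \<Rightarrow> (nat \<Rightarrow> real^'n) \<Rightarrow> real" where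
  "lqr_cost A B Q R Qf x0 T u w =
     (\<Sum>t<T. state A B x0 u w t \<bullet> (Q *v state A B x0 u w t) + u t \<bullet> (R *v u t))
     + state A B x0 u w T \<bullet> (Qf *v state A B x0 u w T)"


section \<open>Disturbances\<close>

text \<open>A tuple \<open>(w\<^sub>0, \<dots>, w\<^sub>s\<^sub>-\<^sub>1)\<close> of disturbances is an element of the product space below;
  it is extended by \<open>w\<^sub>s = y\<close> through the function update \<open>h(s := y)\<close>.\<close>

abbreviation hist_space :: "nat \<Rightarrow> (nat \<Rightarrow> real^'n) measure" where
  "hist_space s \<equiv> PiM {..<s} (\<lambda>_. borel)"

definition hist :: "(nat \<Rightarrow> 'a \<Rightarrow> real^'n) \<Rightarrow> nat \<Rightarrow> 'a \<Rightarrow> (nat \<Rightarrow> real^'n)" where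
  "hist w s \<omega> = (\<lambda>i\<in>{..<s}. w i \<omega>)"

text \<open>\<open>past_algebra M w s\<close> is the \<open>\<sigma>\<close>-algebra generated by the first \<open>s\<close> disturbances
  \<open>w\<^sub>0, \<dots>, w\<^sub>s\<^sub>-\<^sub>1\<close>.\<close>

definition past_algebra :: "'a measure \<Rightarrow> (nat \<Rightarrow> 'a \<Rightarrow> real^'n) \<Rightarrow> nat \<Rightarrow> 'a measure" where
  "past_algebra M w s = vimage_algebra (space M) (hist w s) (hist_space s)"

text \<open>\<open>W t h\<close> is a (regular) conditional distribution of \<open>w\<^sub>t\<close> given
  \<open>(w\<^sub>0, \<dots>, w\<^sub>t\<^sub>-\<^sub>1) = h\<close>.\<close>

definition conditional_distributions ::
    "'a measure \<Rightarrow> (nat \<Rightarrow> 'a \<Rightarrow> real^'n) \<Rightarrow> (nat \<Rightarrow> (nat \<Rightarrow> real^'n) \<Rightarrow> (real^'n) measure) \<Rightarrow> bool" where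
  "conditional_distributions M w W \<longleftrightarrow>
     (\<forall>t. W t \<in> measurable (hist_space t) (prob_algebra borel) \<and>
        (\<forall>X\<in>sets (hist_space t). \<forall>Y\<in>sets borel.
           emeasure M {\<omega>\<in>space M. hist w t \<omega> \<in> X \<and> w t \<omega> \<in> Y}
             = (\<integral>\<^sup>+\<omega>. indicator X (hist w t \<omega>) * emeasure (W t (hist w t \<omega>)) Y \<partial>M)))"

text \<open>\<open>cond_mean M w t' t\<close> is \<open>\<mu>\<^sub>t\<^sub>'\<^sub>|\<^sub>t = E[w\<^sub>t\<^sub>' | w\<^sub>0, \<dots>, w\<^sub>t]\<close>, taken componentwise since the
  library's conditional expectation is real-valued.\<close>

definition cond_mean :: "'a measure \<Rightarrow> (nat \<Rightarrow> 'a \<Rightarrow> real^'n) \<Rightarrow> nat \<Rightarrow> nat \<Rightarrow> 'a \<Rightarrow> real^'n" where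
  "cond_mean M w t' t \<omega> =
     (\<chi> j. real_cond_exp M (past_algebra M w (Suc t)) (\<lambda>\<omega>'. w t' \<omega>' $ j) \<omega>)"


section \<open>Optimal cost with predictions\<close>

text \<open>Costs are nonnegative, so expectations and minima of costs are taken in \<^typ>\<open>ennreal\<close>,
  where both always exist.

  \<open>draws W n s g h\<close> is \<open>E\<^bsub>w(s) \<sim> W(s)\<^esub> \<dots> E\<^bsub>w(s+n-1) \<sim> W(s+n-1)\<^esub> g(w(0), \<dots>, w(s+n-1))\<close>,
  where \<open>h = (w(0), \<dots>, w(s-1))\<close>.\<close>

primrec draws :: "(nat \<Rightarrow> (nat \<Rightarrow> real^'n) \<Rightarrow> (real^'n) measure) \<Rightarrow> nat \<Rightarrow> nat
    \<Rightarrow> ((nat \<Rightarrow> real^'n) \<Rightarrow> ennreal) \<Rightarrow> (nat \<Rightarrow> real^'n) \<Rightarrow> ennreal" where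
  "draws W 0 s g h = g h"
| "draws W (Suc n) s g h = (\<integral>\<^sup>+y. draws W n (Suc s) g (h(s := y)) \<partial>W s h)"

text \<open>\<open>min_exp W k J n t u h\<close> is
  \<open>min\<^bsub>u(t)\<^esub> E\<^bsub>w(t+k) \<sim> W(t+k)\<^esub> \<dots> min\<^bsub>u(t+n-1)\<^esub> E\<^bsub>w(t+n+k-1) \<sim> W(t+n+k-1)\<^esub> min\<^bsub>u(t+n), u(t+n+1), \<dots>\<^esub> J\<close>,
  with \<open>u(0), \<dots>, u(t-1)\<close> already chosen (the other entries of \<open>u\<close> are irrelevant) and
  \<open>h = (w(0), \<dots>, w(t+k-1))\<close> already revealed. The final minimum is over all continuations of
  the chosen controls; \<open>J\<close> depends only on the controls before the horizon.\<close>

primrec min_exp :: "(nat \<Rightarrow> (nat \<Rightarrow> real^'n) \<Rightarrow> (real^'n) measure) \<Rightarrow> nat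
    \<Rightarrow> ((nat \<Rightarrow> real^'d) \<Rightarrow> (nat \<Rightarrow> real^'n) \<Rightarrow> real)
    \<Rightarrow> nat \<Rightarrow> nat \<Rightarrow> (nat \<Rightarrow> real^'d) \<Rightarrow> (nat \<Rightarrow> real^'n) \<Rightarrow> ennreal" where
  "min_exp W k J 0 t u h = (INF u'\<in>{u'. \<forall>i<t. u' i = u i}. ennreal (J u' h))"
| "min_exp W k J (Suc n) t u h =
     (INF v. \<integral>\<^sup>+y. min_exp W k J n (Suc t) (u(t := v)) (h(t + k := y)) \<partial>W (t + k) h)"

text \<open>For \<open>T \<le> k\<close>, where all disturbances are known at the start, \<open>T - k = 0\<close> and only the
  final minimum over all controls remains.\<close>

definition STO_horizon :: "real^'n^'n \<Rightarrow> real^'d^'n \<Rightarrow> real^'n^'n \<Rightarrow> real^'d^'d \<Rightarrow> real^'n^'n \<Rightarrow> real^'n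
    \<Rightarrow> (nat \<Rightarrow> (nat \<Rightarrow> real^'n) \<Rightarrow> (real^'n) measure) \<Rightarrow> nat \<Rightarrow> nat \<Rightarrow> ennreal" where
  "STO_horizon A B Q R Qf x0 W k T =
     draws W k 0 (min_exp W k (lqr_cost A B Q R Qf x0 T) (T - k) 0 (\<lambda>_. 0)) (\<lambda>_. undefined)"

definition STO :: "real^'n^'n \<Rightarrow> real^'d^'n \<Rightarrow> real^'n^'n \<Rightarrow> real^'d^'d \<Rightarrow> real^'n^'n \<Rightarrow> real^'n
    \<Rightarrow> (nat \<Rightarrow> (nat \<Rightarrow> real^'n) \<Rightarrow> (real^'n) measure) \<Rightarrow> nat \<Rightarrow> ennreal" where
  "STO A B Q R Qf x0 W k = lim (\<lambda>T. STO_horizon A B Q R Qf x0 W k T / of_nat T)"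


section \<open>Policies\<close>

text \<open>A feedback law \<open>\<phi>\<close> selects \<open>u\<^sub>t = \<phi> t x\<^sub>t \<omega>\<close>; \<open>feedback_control\<close> is the resulting control
  process along the closed-loop trajectory.\<close>

primrec feedback_state :: "real^'n^'n \<Rightarrow> real^'d^'n \<Rightarrow> real^'n \<Rightarrow> (nat \<Rightarrow> 'a \<Rightarrow> real^'n)
    \<Rightarrow> (nat \<Rightarrow> real^'n \<Rightarrow> 'a \<Rightarrow> real^'d) \<Rightarrow> nat \<Rightarrow> 'a \<Rightarrow> real^'n" where
  "feedback_state A B x0 w \<phi> 0 \<omega> = x0"
| "feedback_state A B x0 w \<phi> (Suc t) \<omega> =
     A *v feedback_state A B x0 w \<phi> t \<omega> + B *v \<phi> t (feedback_state A B x0 w \<phi> t \<omega>) \<omega> + w t \<omega>"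

definition feedback_control :: "real^'n^'n \<Rightarrow> real^'d^'n \<Rightarrow> real^'n \<Rightarrow> (nat \<Rightarrow> 'a \<Rightarrow> real^'n)
    \<Rightarrow> (nat \<Rightarrow> real^'n \<Rightarrow> 'a \<Rightarrow> real^'d) \<Rightarrow> nat \<Rightarrow> 'a \<Rightarrow> real^'d" where
  "feedback_control A B x0 w \<phi> t \<omega> = \<phi> t (feedback_state A B x0 w \<phi> t \<omega>) \<omega>"

text \<open>With \<open>k\<close> predictions, \<open>u\<^sub>t\<close> is a (measurable) function of \<open>w\<^sub>0, \<dots>, w\<^sub>t\<^sub>+\<^sub>k\<^sub>-\<^sub>1\<close>; the initial
  state is deterministic.\<close>

definition predictive_policy ::
    "'a measure \<Rightarrow> (nat \<Rightarrow> 'a \<Rightarrow> real^'n) \<Rightarrow> nat \<Rightarrow> (nat \<Rightarrow> 'a \<Rightarrow> real^'d) \<Rightarrow> bool" where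
  "predictive_policy M w k u \<longleftrightarrow> (\<forall>t. u t \<in> borel_measurable (past_algebra M w (t + k)))"

definition optimal_policy :: "real^'n^'n \<Rightarrow> real^'d^'n \<Rightarrow> real^'n^'n \<Rightarrow> real^'d^'d \<Rightarrow> real^'n^'n \<Rightarrow> real^'n
    \<Rightarrow> 'a measure \<Rightarrow> (nat \<Rightarrow> 'a \<Rightarrow> real^'n) \<Rightarrow> (nat \<Rightarrow> (nat \<Rightarrow> real^'n) \<Rightarrow> (real^'n) measure)
    \<Rightarrow> nat \<Rightarrow> (nat \<Rightarrow> 'a \<Rightarrow> real^'d) \<Rightarrow> bool" where
  "optimal_policy A B Q R Qf x0 M w W k u \<longleftrightarrow>
     predictive_policy M w k u \<and>
     (\<lambda>T. (\<integral>\<^sup>+\<omega>. ennreal (lqr_cost A B Q R Qf x0 T (\<lambda>t. u t \<omega>) (\<lambda>t. w t \<omega>)) \<partial>M) / of_nat T)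
       \<longlonglongrightarrow> STO A B Q R Qf x0 W k"


section \<open>Asymptotics\<close>

text \<open>Unlike the library's \<open>f \<in> O(g)\<close>, which bounds \<open>f\<close> only eventually, the bound holds for
  every \<open>k \<ge> 1\<close>; this matters where \<open>g\<close> vanishes.\<close>

definition is_bigO :: "(nat \<Rightarrow> real) \<Rightarrow> (nat \<Rightarrow> real) \<Rightarrow> bool" where
  "is_bigO f g \<longleftrightarrow> (\<exists>C>0. \<forall>k\<ge>1. \<bar>f k\<bar> \<le> C * g k)"

end

(* Completing the square along the adjoint sequence q_t = P w_t + F^T q_(t+1), q_T = 0, turns the cost over a
   horizon T with terminal cost P into a function of w alone plus the sum of z_t^T S z_t, where S = R + B^T P B
   and z_t = u_t + K x_t + S^-1 B^T q_t.  With k predictions the conditional mean of q_t given w_0, ..., w_(t+k-1)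
   can be cancelled by u_t, which is what the policy does; the rest c_t of S^-1 B^T q_t has conditional mean zero.

   Upper bound: the policy keeps states and controls bounded in mean square, because the powers of F decay.

   Lower bound: z^T S z >= c^T S c + 2 (z - c)^T S c, and the cross term disappears in the nested
   expectations, since z_t - c_t depends only on what is known at time t.  The minima need no measurable selection.
   To replace the true terminal cost by P, the identity is averaged over the last N steps: by detectability the
   states x_t have total squared norm at most of the order of the cost, so the average of x_t^T P x_t
   over the window is a 1/N-fraction of the total cost.  Letting T and then N tend to infinity shows that the policy
   attains STO_k.

   The cost of the policy exceeds a quantity independent of k by the mean of z_t^T S z_t, and for t + k <= T
   the vector z_t has F^T to the power k as a factor, which gives the bound on STO_k - STO_(k+1). *)

theory Submission
  imports Defs "HOL-Computational_Algebra.Fundamental_Theorem_Algebra"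
begin

text \<open>Three obstacles shape the proof. The spectral radius must control actual powers of a
  matrix: an annihilating polynomial, split over the complex numbers, takes the place of the Jordan
  form, and the gap between the spectral radius of \<open>F\<close> and \<open>rate\<close> absorbs
  polynomial factors. The square root \<open>decay\<close> of \<open>rate\<close> splits the decay
  in two: one half makes series of square-integrable vectors converge, the other measures how little
  the end of the horizon matters \<open>N\<close> steps before it.

  The minima run over all controls, so the functions inside the nested expectations come without
  measurability. The nonnegative integral is monotone for arbitrary functions; hence only
  inequalities are propagated, from below with a signed integrable minorant, from above with the
  policy as a pointwise function of the history. Conditional means therefore occur in two forms, as
  conditional expectations and as integrals against \<open>future\<close>, equal almost surely.

  The policy looks at an infinite future, while the nested minima stop at \<open>T\<close>. The two
  differ by a tail that is geometrically small away from the end, and the last \<open>N\<close>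
  steps cost an amount linear in \<open>N\<close>, which vanishes after division by
  \<open>T\<close>.\<close>

section \<open>Powers and spectral radius of a real matrix\<close>

text \<open>Applied to the powers of a matrix, this yields an annihilating polynomial.
  \<open>dependent\<close> speaks of sets, so a family with a repeated value has to be treated
  apart.\<close>

lemma exists_vanishing_combination:
  fixes f :: "nat \<Rightarrow> 'a::euclidean_space"
  shows "\<exists>c. (\<exists>i\<le>DIM('a). c i \<noteq> 0) \<and> (\<Sum>i\<le>DIM('a). c i *\<^sub>R f i) = 0"
proof (cases "inj_on f {..DIM('a)}")
  case True
  have "dependent (f ` {..DIM('a)})"
    using True by (intro dependent_biggerset) (auto simp: card_image)
  then obtain u v where "v \<in> f ` {..DIM('a)}" "u v \<noteq> 0" "(\<Sum>v\<in>f ` {..DIM('a)}. u v *\<^sub>R v) = 0"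
    using dependent_finite[of "f ` {..DIM('a)}"] by auto
  then show ?thesis
    using True by (intro exI[of _ "u \<circ> f"]) (auto simp: sum.reindex)
next
  case False
  then obtain i j where ij: "i \<le> DIM('a)" "j \<le> DIM('a)" "i \<noteq> j" "f i = f j"
    by (auto simp: inj_on_def)
  \<comment> \<open>Two equal members cancel with coefficients 1 and -1, even if the set of values
    is independent.\<close>
  define c :: "nat \<Rightarrow> real" where "c k = (if k = i then 1 else if k = j then -1 else 0)" for k
  have "(\<Sum>k\<le>DIM('a). c k *\<^sub>R f k)
      = (\<Sum>k\<le>DIM('a). (if k = i then f i else 0) - (if k = j then f j else 0))"
    using ij by (intro sum.cong) (auto simp: c_def)
  also have "\<dots> = 0"
    using ij by (simp add: sum_subtractf)
  finally show ?thesis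
    using ij by (intro exI[of _ c]) (auto simp: c_def)
qed

lemma norm_vector_scalar_mult: "norm (z *s v) = cmod z * norm (v :: complex^'n)"
proof -
  have "L2_set (\<lambda>i. cmod z * norm (v $ i)) UNIV = cmod z * L2_set (\<lambda>i. norm (v $ i)) UNIV"
    by (rule L2_set_right_distrib[symmetric]) simp
  then show ?thesis by (simp add: norm_vec_def norm_mult)
qed

text \<open>This is \<open>p(M) v\<close>. Iterating the map on a vector makes a factor
  \<open>X - z\<close> easy to move outside or onto the vector.\<close>

definition poly_action :: "complex^'n^'n \<Rightarrow> complex poly \<Rightarrow> complex^'n \<Rightarrow> complex^'n" where
  "poly_action M p v = (\<Sum>i\<le>degree p. coeff p i *s (((*v) M ^^ i) v))"

lemma poly_action_eq:
  assumes "degree p \<le> n"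
  shows "poly_action M p v = (\<Sum>i\<le>n. coeff p i *s (((*v) M ^^ i) v))"
  unfolding poly_action_def
  by (rule sum.mono_neutral_left) (use assms in \<open>auto simp: coeff_eq_0\<close>)

lemma funpow_matrix_add:
  fixes M :: "complex^'n^'n"
  shows "((*v) M ^^ i) (u + v) = ((*v) M ^^ i) u + ((*v) M ^^ i) (v :: complex^'n)"
  by (induction i) (auto simp: matrix_vector_right_distrib)

lemma funpow_matrix_scale:
  fixes M :: "complex^'n^'n"
  shows "((*v) M ^^ i) (z *s v) = z *s ((*v) M ^^ i) (v :: complex^'n)"
  by (induction i) (auto simp: vector_scalar_commute)

lemma matrix_vector_sum: "finite I \<Longrightarrow> M *v (\<Sum>i\<in>I. f i) = (\<Sum>i\<in>I. M *v (f i :: 'b::field^'n))"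
  by (induction I rule: finite_induct) (auto simp: matrix_vector_right_distrib)

lemma poly_action_linear:
  "poly_action M p (u + v) = poly_action M p u + poly_action M p v"
  "poly_action M p (z *s v) = z *s poly_action M p v"
  by (auto simp: poly_action_def funpow_matrix_add funpow_matrix_scale vector_add_ldistrib sum.distrib
      vec.scale_sum_right vector_smult_assoc mult.commute)

text \<open>Polynomials in \<open>M\<close> commute, so the factor \<open>M - z\<close> may act last
  or first. Acting last, it shows that \<open>q(M) v\<close> is an eigenvector; acting first, it
  lets an induction replace \<open>v\<close> by \<open>(M - z) v\<close>.\<close>

lemma poly_action_root_factor:
  fixes M :: "complex^'n^'n"
  shows "poly_action M ([:- z, 1:] * q) v = M *v poly_action M q v - z *s poly_action M q v"
    and "poly_action M ([:- z, 1:] * q) v = poly_action M q (M *v v - z *s v)"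
proof -
  define n where "n = degree q"
  have deg: "degree ([:- z, 1:] * q) \<le> Suc n"
    using degree_mult_le[of "[:- z, 1:]" q] by (simp add: n_def)
  have c: "coeff ([:- z, 1:] * q) i = (if i = 0 then 0 else coeff q (i - 1)) - z * coeff q i" for i
    by (simp add: coeff_pCons split: nat.splits)
  have "poly_action M ([:- z, 1:] * q) v
      = (\<Sum>i\<le>Suc n. (if i = 0 then 0 else coeff q (i - 1)) *s (((*v) M ^^ i) v))
        - (\<Sum>i\<le>Suc n. (z * coeff q i) *s (((*v) M ^^ i) v))"
    unfolding poly_action_eq[OF deg] c by (simp add: vec.scale_left_diff_distrib sum_subtractf del: sum.atMost_Suc)
  also have "(\<Sum>i\<le>Suc n. (z * coeff q i) *s (((*v) M ^^ i) v)) = z *s poly_action M q v"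
    by (subst poly_action_eq[of q "Suc n"])
      (auto simp: n_def vec.scale_sum_right vector_smult_assoc simp del: sum.atMost_Suc)
  also have "(\<Sum>i\<le>Suc n. (if i = 0 then 0 else coeff q (i - 1)) *s (((*v) M ^^ i) v))
      = (\<Sum>i\<le>n. coeff q i *s (((*v) M ^^ Suc i) v))"
    by (subst sum.atMost_Suc_shift) simp
  finally have *: "poly_action M ([:- z, 1:] * q) v
      = (\<Sum>i\<le>n. coeff q i *s (((*v) M ^^ Suc i) v)) - z *s poly_action M q v" .
  have "(\<Sum>i\<le>n. coeff q i *s (((*v) M ^^ Suc i) v)) = M *v poly_action M q v"
    by (simp add: poly_action_def n_def matrix_vector_sum vector_scalar_commute)
  with * show "poly_action M ([:- z, 1:] * q) v = M *v poly_action M q v - z *s poly_action M q v"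
    by simp
  have "(\<Sum>i\<le>n. coeff q i *s (((*v) M ^^ Suc i) v)) = poly_action M q (M *v v)"
    by (simp add: poly_action_def n_def funpow_swap1)
  moreover have "M *v v - z *s v = M *v v + (- z) *s v"
    by (simp add: vec.scale_minus_left)
  ultimately show "poly_action M ([:- z, 1:] * q) v = poly_action M q (M *v v - z *s v)"
    unfolding * by (simp only: poly_action_linear) (simp add: vec.scale_minus_left)
qed

text \<open>Splitting off the linear factors of an annihilating polynomial one by one: a factor \<open>X - z\<close>
  with \<open>z\<close> no eigenvalue can be cancelled.\<close>

lemma annihilated_induct [consumes 2, case_names zero factor]:
  fixes M :: "complex^'n^'n"
  assumes "p \<noteq> 0" and "poly_action M p v = 0"
    and zero: "P 0"
    and factor: "\<And>z e v. e \<noteq> 0 \<Longrightarrow> M *v e = z *s e \<Longrightarrow> P (M *v v - z *s v) \<Longrightarrow> P v"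
  shows "P v"
  using assms(1,2)
proof (induction "degree p" arbitrary: p v)
  case 0
  then obtain a where "p = [:a:]" by (metis degree_eq_zeroE)
  with 0 have "v = 0" by (auto simp: poly_action_def)
  then show ?case by (simp add: zero)
next
  case (Suc n)
  then obtain z where "poly p z = 0"
    using fundamental_theorem_of_algebra[of p] constant_degree[of p] by auto
  then obtain q where p: "p = [:- z, 1:] * q" by (auto simp: poly_eq_0_iff_dvd dvd_def)
  with Suc.prems have "q \<noteq> 0" by auto
  then have deg: "n = degree q" using Suc.hyps(2) unfolding p by (subst (asm) degree_mult_eq) auto
  have eq: "M *v poly_action M q v - z *s poly_action M q v = 0"
    "poly_action M q (M *v v - z *s v) = 0"
    using Suc.prems(2) unfolding p using poly_action_root_factor[of M z q v] by simp_all
  \<comment> \<open>If \<open>q\<close> already annihilates \<open>v\<close>, its smaller degree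
    suffices; otherwise \<open>q(M) v\<close> is an eigenvector for \<open>z\<close>, and
    \<open>q\<close> annihilates \<open>(M - z) v\<close>.\<close>
  show ?case
  proof (cases "poly_action M q v = 0")
    case True
    then show ?thesis using Suc.hyps(1)[OF deg \<open>q \<noteq> 0\<close>] by blast
  next
    case False
    then show ?thesis
      using factor[of "poly_action M q v" z v] eq Suc.hyps(1)[OF deg \<open>q \<noteq> 0\<close>] by auto
  qed
qed

text \<open>If no root of \<open>p\<close> were an eigenvalue, all linear factors could be cancelled
  and \<open>v\<close> itself would vanish; hence the disjunction with \<open>v = 0\<close> in the
  induction.\<close>

lemma eigenvalue_exists_if_annihilated:
  fixes M :: "complex^'n^'n"
  assumes "p \<noteq> 0" and "poly_action M p v = 0" and "v \<noteq> 0"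
  shows "\<exists>z e. e \<noteq> 0 \<and> M *v e = z *s e"
proof -
  have "v = 0 \<or> (\<exists>z e. e \<noteq> 0 \<and> M *v e = z *s e)"
    using assms(1,2) by (induction rule: annihilated_induct) auto
  with assms(3) show ?thesis by simp
qed

text \<open>Each linear factor contributes a scalar recursion with ratio at most
  \<open>\<rho>\<close> and an input of order \<open>r ^ k\<close>. Since \<open>\<rho> < r\<close>,
  its solution is again of order \<open>r ^ k\<close>, so the polynomial factors of a Jordan block
  never show up.\<close>

lemma funpow_bound_if_annihilated:
  fixes M :: "complex^'n^'n"
  assumes "p \<noteq> 0" and "poly_action M p v = 0"
    and eig: "\<And>z e. e \<noteq> 0 \<Longrightarrow> M *v e = z *s e \<Longrightarrow> cmod z \<le> \<rho>" and "\<rho> < r" and "0 < r"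
  shows "\<exists>C\<ge>0. \<forall>k. norm (((*v) M ^^ k) v) \<le> C * r ^ k"
  using assms(1,2)
proof (induction rule: annihilated_induct)
  case zero
  have "((*v) M ^^ k) 0 = 0" for k by (induction k) auto
  then show ?case by (intro exI[of _ 0]) simp
next
  case (factor z e v)
  then obtain C where C: "C \<ge> 0" "\<And>k. norm (((*v) M ^^ k) (M *v v - z *s v)) \<le> C * r ^ k" by auto
  have z: "cmod z \<le> \<rho>" using eig factor by auto
  \<comment> \<open>The second entry gives \<open>\<rho> * D + C \<le> D * r\<close>, the induction
    step; the first covers \<open>k = 0\<close>.\<close>
  define D where "D = max (norm v) (C / (r - \<rho>))"
  have "D * (r - \<rho>) \<ge> C" using \<open>\<rho> < r\<close> by (simp add: D_def pos_divide_le_eq[symmetric])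
  then have D: "\<rho> * D + C \<le> D * r" "D \<ge> 0" by (auto simp: algebra_simps D_def le_max_iff_disj)
  have "norm (((*v) M ^^ k) v) \<le> D * r ^ k" for k
  proof (induction k)
    case 0
    then show ?case by (simp add: D_def)
  next
    case (Suc k)
    have "((*v) M ^^ Suc k) v = ((*v) M ^^ k) (z *s v + (M *v v - z *s v))"
      by (simp add: funpow_swap1)
    also have "\<dots> = z *s ((*v) M ^^ k) v + ((*v) M ^^ k) (M *v v - z *s v)"
      by (simp only: funpow_matrix_add funpow_matrix_scale)
    finally have "norm (((*v) M ^^ Suc k) v) \<le> cmod z * norm (((*v) M ^^ k) v) + C * r ^ k"
      using C(2)[of k] norm_triangle_ineq[of "z *s ((*v) M ^^ k) v"] by (simp add: norm_vector_scalar_mult) (smt (verit))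
    also have "\<dots> \<le> \<rho> * (D * r ^ k) + C * r ^ k"
      using z Suc by (intro add_mono mult_mono order_refl) (auto intro: order_trans[OF norm_ge_zero])
    also have "\<dots> = (\<rho> * D + C) * r ^ k" by (simp add: algebra_simps)
    also have "\<dots> \<le> (D * r) * r ^ k" using D \<open>0 < r\<close> by (intro mult_right_mono) auto
    finally show ?case by (simp add: algebra_simps)
  qed
  then show ?case using D by auto
qed

section \<open>Transfer to real matrices: spectrum, decay of powers and its converse\<close>

definition complex_matrix :: "real^'n^'n \<Rightarrow> complex^'n^'n" where
  "complex_matrix A = (\<chi> i j. complex_of_real (A $ i $ j))"

definition complex_vector :: "real^'n \<Rightarrow> complex^'n" where
  "complex_vector x = (\<chi> i. complex_of_real (x $ i))"

lemma complex_matrix_vector: "complex_matrix A *v complex_vector x = complex_vector (A *v x)"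
  by (simp add: complex_matrix_def complex_vector_def matrix_vector_mult_def vec_eq_iff)

lemma complex_matrix_Re: "Re ((complex_matrix A *v v) $ i) = (A *v (\<chi> j. Re (v $ j))) $ i"
  and complex_matrix_Im: "Im ((complex_matrix A *v v) $ i) = (A *v (\<chi> j. Im (v $ j))) $ i"
  by (simp_all add: complex_matrix_def matrix_vector_mult_def)

lemma norm_complex_vector: "norm (complex_vector x) = norm x"
  by (simp add: complex_vector_def norm_vec_def)

text \<open>Lets an estimate for real vectors be applied to the real and imaginary parts of a
  complex eigenvector.\<close>

lemma norm_complex_Re_Im:
  "(norm (v :: complex^'n))\<^sup>2 = (norm (\<chi> j. Re (v $ j)))\<^sup>2 + (norm (\<chi> j. Im (v $ j)))\<^sup>2"
  by (simp add: norm_vec_def L2_set_def sum_nonneg cmod_power2 sum.distrib)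

lemma funpow_complex_matrix:
  fixes A :: "real^'n^'n"
  shows "((*v) (complex_matrix A) ^^ k) v = complex_matrix (matrix_power A k) *v v"
proof (induction k)
  case 0
  have "complex_matrix (mat 1) = (mat 1 :: complex^'n^'n)"
    by (simp add: complex_matrix_def mat_def vec_eq_iff)
  then show ?case by simp
next
  case (Suc k)
  have "complex_matrix (A ** B) = complex_matrix A ** complex_matrix B" for A B :: "real^'n^'n"
    by (simp add: complex_matrix_def matrix_matrix_mult_def vec_eq_iff)
  with Suc show ?case by (simp add: matrix_vector_mul_assoc)
qed

text \<open>The space of real matrices has finite dimension \<open>N\<close>, so the first
  \<open>N + 1\<close> powers of \<open>A\<close> are dependent, and a dependence is a
  polynomial.\<close>

lemma annihilating_polynomial:
  fixes A :: "real^'n^'n"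
  obtains p where "p \<noteq> 0" "\<And>v. poly_action (complex_matrix A) p v = 0"
proof -
  define N where "N = DIM(real^'n^'n)"
  obtain c j where c: "j \<le> N" "c j \<noteq> 0" "(\<Sum>i\<le>N. c i *\<^sub>R matrix_power A i) = 0"
    using exists_vanishing_combination[of "matrix_power A"] unfolding N_def by auto
  define p where "p = (\<Sum>i\<le>N. monom (complex_of_real (c i)) i)"
  have coeff: "coeff p i = (if i \<le> N then complex_of_real (c i) else 0)" for i
    by (simp add: p_def coeff_sum)
  then have "p \<noteq> 0" using c by (metis coeff_0 of_real_eq_0_iff)
  moreover have "poly_action (complex_matrix A) p v = 0" for v
  proof -
    have "degree p \<le> N" by (rule degree_le) (simp add: coeff)
    then have "poly_action (complex_matrix A) p v
        = (\<Sum>i\<le>N. complex_of_real (c i) *s (complex_matrix (matrix_power A i) *v v))"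
      by (simp add: poly_action_eq coeff funpow_complex_matrix)
    also have "\<dots> = complex_matrix (\<Sum>i\<le>N. c i *\<^sub>R matrix_power A i) *v v"
      by (simp add: vec_eq_iff complex_matrix_def matrix_vector_mult_def sum_component sum_distrib_left
          sum_distrib_right mult.assoc sum.swap[of _ UNIV])
    also have "\<dots> = 0" by (simp add: c(3) complex_matrix_def matrix_vector_mult_def vec_eq_iff)
    finally show ?thesis .
  qed
  ultimately show ?thesis using that by blast
qed

lemma complex_spectrum_iff: "z \<in> complex_spectrum A \<longleftrightarrow> (\<exists>v. v \<noteq> 0 \<and> complex_matrix A *v v = z *s v)"
  by (simp add: complex_spectrum_def complex_matrix_def)

lemma funpow_eigenvector:
  fixes M :: "complex^'n^'n"
  assumes "M *v v = z *s v" shows "((*v) M ^^ k) v = z ^ k *s v"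
  using assms by (induction k) (auto simp: vector_scalar_commute vector_smult_assoc mult.commute)

text \<open>Every eigenvalue is a root of an annihilating polynomial. Together with nonemptiness
  this is what gives \<open>Max\<close> in \<open>spec_radius\<close> its meaning.\<close>

lemma finite_complex_spectrum: "finite (complex_spectrum A)"
proof -
  obtain p where p: "p \<noteq> 0" "\<And>v. poly_action (complex_matrix A) p v = 0"
    using annihilating_polynomial[of A] by blast
  have "complex_spectrum A \<subseteq> {z. poly p z = 0}"
  proof
    fix z assume "z \<in> complex_spectrum A"
    then obtain v where v: "v \<noteq> 0" "complex_matrix A *v v = z *s v" by (auto simp: complex_spectrum_iff)
    have "poly_action (complex_matrix A) p v = poly p z *s v"
      by (simp add: poly_action_def funpow_eigenvector[OF v(2)] vector_smult_assoc poly_altdef vec.scale_sum_left)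
    with p v show "z \<in> {z. poly p z = 0}" by simp
  qed
  then show ?thesis using poly_roots_finite[OF p(1)] finite_subset by blast
qed

lemma complex_spectrum_nonempty: "complex_spectrum A \<noteq> {}"
proof -
  obtain p where p: "p \<noteq> 0" "\<And>v. poly_action (complex_matrix A) p v = 0"
    using annihilating_polynomial[of A] by blast
  \<comment> \<open>The polynomial annihilates every vector, so any nonzero one will do; whatever
    the index \<open>undefined\<close> is, this is a unit vector.\<close>
  have "complex_vector (axis undefined 1) \<noteq> 0"
    using norm_complex_vector[of "axis undefined (1::real)"] by (metis norm_axis_1 norm_zero zero_neq_one)
  from eigenvalue_exists_if_annihilated[OF p(1) p(2) this] show ?thesis
    using complex_spectrum_iff by blast
qed

lemma cmod_le_spec_radius: "z \<in> complex_spectrum A \<Longrightarrow> cmod z \<le> spec_radius A"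
  unfolding spec_radius_def using finite_complex_spectrum by (intro Max_ge) auto

lemma spec_radius_attained: "\<exists>z\<in>complex_spectrum A. spec_radius A = cmod z"
proof -
  have "spec_radius A \<in> cmod ` complex_spectrum A"
    unfolding spec_radius_def using finite_complex_spectrum complex_spectrum_nonempty by (intro Max_in) auto
  then show ?thesis by blast
qed

lemma spec_radius_nonneg: "0 \<le> spec_radius A"
  using spec_radius_attained[of A] by auto

text \<open>One half of Gelfand's formula, with a strict margin. The bound for single vectors is
  applied to the unit vectors only, and the finitely many constants are added, which makes the final
  one independent of \<open>x\<close>.\<close>

lemma matrix_power_bound:
  fixes A :: "real^'n^'n"
  assumes "spec_radius A < r"
  shows "\<exists>C>0. \<forall>k x. norm (matrix_power A k *v x) \<le> C * r ^ k * norm x"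
proof -
  have "r > 0" using assms spec_radius_nonneg[of A] by simp
  obtain p where p: "p \<noteq> 0" "\<And>v. poly_action (complex_matrix A) p v = 0"
    using annihilating_polynomial[of A] by blast
  have "\<exists>C\<ge>0. \<forall>k. norm (matrix_power A k *v axis j 1) \<le> C * r ^ k" for j
  proof -
    have "\<exists>C\<ge>0. \<forall>k. norm (((*v) (complex_matrix A) ^^ k) (complex_vector (axis j 1))) \<le> C * r ^ k"
      using p(1) p(2) cmod_le_spec_radius complex_spectrum_iff[of _ A] assms \<open>r > 0\<close>
      by (intro funpow_bound_if_annihilated) blast+
    then show ?thesis by (simp add: funpow_complex_matrix complex_matrix_vector norm_complex_vector)
  qed
  then obtain c where c: "\<And>j. c j \<ge> 0" "\<And>j k. norm (matrix_power A k *v axis j 1) \<le> c j * r ^ k"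
    by metis
  have "norm (matrix_power A k *v x) \<le> (1 + sum c UNIV) * r ^ k * norm x" for k x
  proof -
    have "matrix_power A k *v x = matrix_power A k *v (\<Sum>j\<in>UNIV. x $ j *s axis j 1)"
      by (simp add: basis_expansion)
    also have "\<dots> = (\<Sum>j\<in>UNIV. x $ j *\<^sub>R (matrix_power A k *v axis j 1))"
      by (simp add: matrix_vector_sum matrix_vector_mult_scaleR scalar_mult_eq_scaleR)
    also have "norm \<dots> \<le> (\<Sum>j\<in>UNIV. norm x * (c j * r ^ k))"
      by (rule sum_norm_le) (use c component_le_norm_cart in \<open>auto intro!: mult_mono\<close>)
    also have "\<dots> = sum c UNIV * r ^ k * norm x" by (simp add: sum_distrib_left sum_distrib_right mult.commute)
    also have "\<dots> \<le> (1 + sum c UNIV) * r ^ k * norm x"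
      using \<open>r > 0\<close> by (intro mult_right_mono) auto
    finally show ?thesis .
  qed
  moreover have "1 + sum c UNIV > 0" using c by (simp add: add_pos_nonneg sum_nonneg)
  ultimately show ?thesis by blast
qed

text \<open>An eigenvector with \<open>cmod z \<ge> 1\<close> never shrinks, so its squared norms
  sum to at least \<open>T\<close> times a positive number, against a bound independent of
  \<open>T\<close>. The hypothesis concerns real vectors, hence the split into real and imaginary
  parts.\<close>

lemma spec_radius_less_one:
  fixes A :: "real^'n^'n"
  assumes "\<And>T x. (\<Sum>t<T. (norm (matrix_power A t *v x))\<^sup>2) \<le> C * (norm x)\<^sup>2"
  shows "spec_radius A < 1"
proof (rule ccontr)
  assume "\<not> spec_radius A < 1"
  then obtain z where "z \<in> complex_spectrum A" and z: "cmod z \<ge> 1"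
    using spec_radius_attained[of A] by auto
  then obtain v where v: "v \<noteq> 0" "complex_matrix A *v v = z *s v" by (auto simp: complex_spectrum_iff)
  define a where "a = (\<chi> j. Re (v $ j))"
  define b where "b = (\<chi> j. Im (v $ j))"
  have eq: "(norm (z ^ t *s v))\<^sup>2 = (norm (matrix_power A t *v a))\<^sup>2 + (norm (matrix_power A t *v b))\<^sup>2" for t
    unfolding funpow_eigenvector[OF v(2), symmetric] funpow_complex_matrix norm_complex_Re_Im
    by (simp add: complex_matrix_Re complex_matrix_Im a_def b_def)
  have "real T * (norm v)\<^sup>2 \<le> C * (norm v)\<^sup>2" for T
  proof -
    have "real T * (norm v)\<^sup>2 = (\<Sum>t<T. (norm v)\<^sup>2)" by simp
    also have "\<dots> \<le> (\<Sum>t<T. (norm (z ^ t *s v))\<^sup>2)"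
      using z by (intro sum_mono power_mono) (auto simp: norm_vector_scalar_mult norm_power
          intro!: mult_le_cancel_right1[THEN iffD2] one_le_power)
    also have "\<dots> \<le> C * (norm a)\<^sup>2 + C * (norm b)\<^sup>2"
      unfolding eq sum.distrib by (intro add_mono assms)
    also have "\<dots> = C * (norm v)\<^sup>2"
      unfolding norm_complex_Re_Im[of v] a_def b_def by (simp add: algebra_simps)
    finally show ?thesis .
  qed
  then have "real T \<le> C" for T using v(1) by (simp add: mult_le_cancel_right)
  then show False using reals_Archimedean2[of C] by (meson not_less)
qed

section \<open>Quadratic forms, stable recursions and detectability\<close>

declare transpose_matrix_vector [simp del]

lemma transpose_add: "transpose (A + B) = transpose A + transpose (B :: real^'n^'m)"
  by (simp add: transpose_def vec_eq_iff)

lemma matrix_vector_mult_minus_right: "A *v (- x) = - (A *v (x :: real^'n))"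
  by (simp add: matrix_vector_mult_def vec_eq_iff sum_negf)

lemma matrix_vector_inner: "(A *v x) \<bullet> y = x \<bullet> (transpose A *v (y :: real^'m))"
  by (metis dot_lmul_matrix inner_commute vector_transpose_matrix)

lemma norm_matrix_vector: "norm (A *v x) \<le> spectral_norm A * norm x"
  unfolding spectral_norm_def by (intro onorm matrix_vector_mul_bounded_linear)

lemma spectral_norm_nonneg: "0 \<le> spectral_norm A"
  unfolding spectral_norm_def by (intro onorm_pos_le matrix_vector_mul_bounded_linear)

lemma spectral_norm_bound:
  assumes "\<And>x. norm (A *v x) \<le> b * norm x"
  shows "spectral_norm A \<le> b"
  unfolding spectral_norm_def by (intro onorm_le assms)

text \<open>From \<open>|A^T x|^2 = x . A A^T x\<close> and Cauchy-Schwarz, after division by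
  \<open>|A^T x|\<close>.\<close>

lemma norm_transpose_vector: "norm (transpose A *v x) \<le> spectral_norm A * norm x"
proof (cases "transpose A *v x = 0")
  case False
  have "norm (transpose A *v x) * norm (transpose A *v x) = (transpose A *v x) \<bullet> (transpose A *v x)"
    by (simp only: power2_norm_eq_inner[symmetric] power2_eq_square)
  also have "\<dots> = x \<bullet> (A *v (transpose A *v x))"
    by (simp only: matrix_vector_inner[of "transpose A"] transpose_transpose)
  also have "\<dots> \<le> norm x * norm (A *v (transpose A *v x))" by (rule norm_cauchy_schwarz)
  also have "\<dots> \<le> norm x * (spectral_norm A * norm (transpose A *v x))"
    by (intro mult_left_mono norm_matrix_vector) auto
  finally show ?thesis using False by (simp add: mult_ac)
qed (simp add: spectral_norm_nonneg)

lemma spectral_norm_transpose: "spectral_norm (transpose A) = spectral_norm A"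
  by (intro antisym spectral_norm_bound norm_transpose_vector)
     (use norm_transpose_vector[of "transpose A"] in simp)

lemma matrix_power_commute: "A ** matrix_power A k = matrix_power A k ** A"
proof (induction k)
  case (Suc k)
  then show ?case by (metis matrix_power.simps(2) matrix_mul_assoc)
qed simp

lemma matrix_power_transpose: "matrix_power (transpose A) k = transpose (matrix_power A k)"
  by (induction k) (auto simp: matrix_transpose_mul matrix_power_commute transpose_mat)

lemma matrix_power_add: "matrix_power A (j + k) = matrix_power A j ** matrix_power A k"
  by (induction j) (auto simp: matrix_mul_assoc)

text \<open>Bounds the output \<open>Q *v x\<close> by the cost it incurs rather than by the norm of
  \<open>x\<close>; this is how detectability can be exploited through the stage cost. The
  inequality is nonnegativity of the form at one suitable point.\<close>

lemma pos_semidef_image_bound: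
  assumes "pos_semidef Q"
  shows "(norm (Q *v x))\<^sup>2 \<le> (spectral_norm Q + 1) * (x \<bullet> (Q *v x))"
proof -
  define c where "c = spectral_norm Q + 1"
  have c: "c > 0" using spectral_norm_nonneg[of Q] by (simp add: c_def)
  have sym: "transpose Q = Q" using assms by (simp add: pos_semidef_def)
  define y where "y = Q *v x"
  have xy: "x \<bullet> (Q *v y) = y \<bullet> y" unfolding y_def by (metis matrix_vector_inner sym)
  have "y \<bullet> (Q *v y) \<le> norm y * norm (Q *v y)" by (rule norm_cauchy_schwarz)
  also have "\<dots> \<le> norm y * (c * norm y)"
    using norm_matrix_vector[of Q y] by (intro mult_left_mono) (auto simp: c_def algebra_simps intro: order_trans)
  finally have *: "y \<bullet> (Q *v y) \<le> c * (y \<bullet> y)"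
    by (simp add: power2_norm_eq_inner[symmetric] power2_eq_square mult_ac)
  \<comment> \<open>The minimizer in \<open>k\<close> of \<open>x \<bullet> y - 2 * k * (y \<bullet>
    y) + k * k * (c * (y \<bullet> y))\<close>. The summand 1 in \<open>c\<close> permits the
    division also for \<open>Q = 0\<close>.\<close>
  define k where "k = 1 / c"
  have "0 \<le> (x - k *\<^sub>R y) \<bullet> (Q *v (x - k *\<^sub>R y))"
    using assms by (simp add: pos_semidef_def)
  also have "\<dots> = x \<bullet> y - 2 * k * (y \<bullet> y) + k * k * (y \<bullet> (Q *v y))"
    by (simp add: matrix_vector_mult_diff_distrib matrix_vector_mult_scaleR inner_diff y_def[symmetric] xy
        inner_commute algebra_simps)
  also have "\<dots> \<le> x \<bullet> y - 2 * k * (y \<bullet> y) + k * k * (c * (y \<bullet> y))"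
    using c * by (intro add_left_mono mult_left_mono) auto
  also have "\<dots> = x \<bullet> y - (y \<bullet> y) / c" using c by (simp add: k_def field_simps)
  finally have "y \<bullet> y \<le> c * (x \<bullet> y)" using c by (simp add: field_simps)
  then show ?thesis by (simp add: c_def y_def power2_norm_eq_inner)
qed

lemma pos_definite_imp_pos_semidef: "pos_definite R \<Longrightarrow> pos_semidef R"
  unfolding pos_definite_def pos_semidef_def by (metis inner_zero_left less_eq_real_def order_refl)

lemma pos_definite_invertible: "pos_definite R \<Longrightarrow> invertible R"
  unfolding invertible_left_inverse matrix_left_invertible_ker pos_definite_def
  by (metis inner_zero_right less_irrefl)

lemma
  assumes "invertible R"
  shows matrix_inv_right: "R ** matrix_inv R = mat 1" and matrix_inv_left: "matrix_inv R ** R = mat 1"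
  using someI_ex[of "\<lambda>A'. R ** A' = mat 1 \<and> A' ** R = mat 1"] assms
  unfolding matrix_inv_def invertible_def by auto

text \<open>Writing \<open>u\<close> as \<open>matrix_inv R *v (R *v u)\<close> reduces coercivity
  to \<open>pos_semidef_image_bound\<close>.\<close>

lemma pos_definite_coercive:
  assumes "pos_definite R"
  shows "\<exists>c>0. \<forall>u. (norm u)\<^sup>2 \<le> c * (u \<bullet> (R *v u))"
proof -
  define a where "a = spectral_norm (matrix_inv R)"
  have inv: "matrix_inv R ** R = mat 1"
    using pos_definite_invertible[OF assms] by (rule matrix_inv_left)
  define c where "c = (a\<^sup>2 + 1) * (spectral_norm R + 1)"
  have "(norm u)\<^sup>2 \<le> c * (u \<bullet> (R *v u))" for u
  proof -
    have "norm u = norm (matrix_inv R *v (R *v u))" by (simp add: matrix_vector_mul_assoc inv)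
    also have "\<dots> \<le> a * norm (R *v u)" unfolding a_def by (rule norm_matrix_vector)
    finally have "(norm u)\<^sup>2 \<le> (a * norm (R *v u))\<^sup>2" by (intro power_mono) auto
    also have "\<dots> \<le> (a\<^sup>2 + 1) * (norm (R *v u))\<^sup>2" by (simp add: power_mult_distrib algebra_simps)
    also have "\<dots> \<le> (a\<^sup>2 + 1) * ((spectral_norm R + 1) * (u \<bullet> (R *v u)))"
      by (intro mult_left_mono pos_semidef_image_bound pos_definite_imp_pos_semidef assms) auto
    finally show ?thesis by (simp add: c_def mult_ac)
  qed
  moreover have "c > 0"
    unfolding c_def using spectral_norm_nonneg[of R] by (intro mult_pos_pos) (auto intro: add_nonneg_pos)
  ultimately show ?thesis by blast
qed

text \<open>Convexity of the square with weights \<open>r\<close> and \<open>1 - r\<close> at the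
  points \<open>a\<close> and \<open>b / (1 - r)\<close>. It keeps the factor \<open>r\<close> below
  1, so that squares again satisfy a contracting recursion.\<close>

lemma convex_square_bound:
  assumes "0 < r" "r < (1::real)"
  shows "(r * a + b)\<^sup>2 \<le> r * a\<^sup>2 + b\<^sup>2 / (1 - r)"
proof -
  have "r * a\<^sup>2 + b\<^sup>2 / (1 - r) - (r * a + b)\<^sup>2 = r / (1 - r) * ((1 - r) * a - b)\<^sup>2"
    using assms by (simp add: field_simps power2_eq_square)
  moreover have "\<dots> \<ge> 0" using assms by auto
  ultimately show ?thesis by linarith
qed

text \<open>In closed form \<open>C * (r^t * a + (\<Sum>s<t. r^(t-1-s) * e s))\<close>; the
  recursion is what yields a one-step inequality for squares.\<close>

primrec majorant :: "real \<Rightarrow> real \<Rightarrow> real \<Rightarrow> (nat \<Rightarrow> real) \<Rightarrow> nat \<Rightarrow> real" where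
  "majorant C r a e 0 = C * a"
| "majorant C r a e (Suc t) = r * majorant C r a e t + C * e t"

text \<open>The invariant \<open>norm (M\<^sup>k x\<^sub>t) \<le> r\<^sup>k y\<^sub>t\<close> replaces an adapted norm in which \<open>M\<close> is a contraction.\<close>

lemma norm_le_majorant:
  assumes M: "\<And>k x. norm (matrix_power M k *v x) \<le> C * r ^ k * norm x"
    and x: "\<And>t. x (Suc t) = M *v x t + d t" and "norm (x 0) \<le> a" and "0 \<le> C" and "0 \<le> r"
  shows "norm (x t) \<le> majorant C r a (\<lambda>t. norm (d t)) t"
proof -
  have "norm (matrix_power M k *v x t) \<le> r ^ k * majorant C r a (\<lambda>t. norm (d t)) t" for k
  proof (induction t arbitrary: k)
    case 0
    have "C * r ^ k * norm (x 0) \<le> C * r ^ k * a" using assms by (intro mult_left_mono) auto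
    with M[of k "x 0"] show ?case by (simp add: mult_ac)
  next
    case (Suc t)
    have "matrix_power M k *v x (Suc t) = matrix_power M (Suc k) *v x t + matrix_power M k *v d t"
      by (simp add: x matrix_vector_right_distrib matrix_vector_mul_assoc matrix_power_commute)
    then have "norm (matrix_power M k *v x (Suc t))
        \<le> norm (matrix_power M (Suc k) *v x t) + norm (matrix_power M k *v d t)"
      by (metis norm_triangle_ineq)
    also have "\<dots> \<le> r ^ Suc k * majorant C r a (\<lambda>t. norm (d t)) t + C * r ^ k * norm (d t)"
      by (intro add_mono Suc M)
    finally show ?case by (simp add: algebra_simps)
  qed
  from this[of 0] show ?thesis by simp
qed

lemma majorant_square_step:
  assumes "0 < r" "r < 1"
  shows "(majorant C r a e (Suc t))\<^sup>2 \<le> r * (majorant C r a e t)\<^sup>2 + C\<^sup>2 / (1 - r) * (e t)\<^sup>2"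
  using convex_square_bound[OF assms, of "majorant C r a e t" "C * e t"] by (simp add: power_mult_distrib)

lemma majorant_square_sum:
  assumes r: "0 < r" "r < 1"
  shows "(1 - r) * (\<Sum>t\<le>T. (majorant C r a e t)\<^sup>2) \<le> C\<^sup>2 * a\<^sup>2 + C\<^sup>2 / (1 - r) * (\<Sum>t<T. (e t)\<^sup>2)"
proof -
  \<comment> \<open>The extra term with factor \<open>r\<close> makes the induction close: it
    supplies what the one-step inequality takes from the preceding index.\<close>
  have "(1 - r) * (\<Sum>t\<le>T. (majorant C r a e t)\<^sup>2) + r * (majorant C r a e T)\<^sup>2
      \<le> C\<^sup>2 * a\<^sup>2 + C\<^sup>2 / (1 - r) * (\<Sum>t<T. (e t)\<^sup>2)"
  proof (induction T)
    case 0
    then show ?case by (simp add: algebra_simps power_mult_distrib)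
  next
    case (Suc T)
    have eq: "(1 - r) * (\<Sum>t\<le>Suc T. (majorant C r a e t)\<^sup>2) + r * (majorant C r a e (Suc T))\<^sup>2
      = (1 - r) * (\<Sum>t\<le>T. (majorant C r a e t)\<^sup>2) + (majorant C r a e (Suc T))\<^sup>2"
      by (simp add: algebra_simps)
    have "C\<^sup>2 / (1 - r) * (\<Sum>t<Suc T. (e t)\<^sup>2) = C\<^sup>2 / (1 - r) * (\<Sum>t<T. (e t)\<^sup>2) + C\<^sup>2 / (1 - r) * (e T)\<^sup>2"
      by (simp add: algebra_simps)
    then show ?case
      unfolding eq using Suc majorant_square_step[OF r, of C a e T] by linarith
  qed
  moreover have "r * (majorant C r a e T)\<^sup>2 \<ge> 0" using r by simp
  ultimately show ?thesis by linarith
qed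

lemma power2_norm_add_le: "(norm (a + b))\<^sup>2 \<le> 2 * (norm a)\<^sup>2 + 2 * (norm (b :: 'a::real_inner))\<^sup>2"
proof -
  have "(norm (a + b))\<^sup>2 + (norm (a - b))\<^sup>2 = 2 * (norm a)\<^sup>2 + 2 * (norm b)\<^sup>2"
    by (simp add: power2_norm_eq_inner inner_add inner_diff inner_commute)
  then show ?thesis by (smt (verit) zero_le_power2)
qed

lemma power2_norm_matrix: "(norm (A *v x))\<^sup>2 \<le> (spectral_norm A)\<^sup>2 * (norm x)\<^sup>2"
  unfolding power_mult_distrib[symmetric] by (intro power_mono norm_matrix_vector) auto

text \<open>Output injection: \<open>A = (A - L ** Q) + L ** Q\<close> with a stable first summand,
  so the state is driven by \<open>L Q x + B u + w\<close>, and the first two terms of this input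
  are bounded by the stage cost. Whatever \<open>u\<close> does, large states must be paid
  for.\<close>

lemma detectability_bound:
  assumes Q: "pos_semidef Q" and R: "pos_definite R" and det: "detectable A Q"
  shows "\<exists>C>0. \<forall>x0 u w T. (\<Sum>t\<le>T. (norm (state A B x0 u w t))\<^sup>2)
    \<le> C * ((norm x0)\<^sup>2 + (\<Sum>t<T. state A B x0 u w t \<bullet> (Q *v state A B x0 u w t) + u t \<bullet> (R *v u t))
            + (\<Sum>t<T. (norm (w t))\<^sup>2))"
proof -
  obtain K0 :: "real^'a^'a" where K0: "spec_radius (transpose A - Q ** K0) < 1"
    using det by (auto simp: detectable_def stabilizable_def)
  obtain r where r: "spec_radius (transpose A - Q ** K0) < r" "r < 1" using dense[OF K0] by auto
  then have r0: "0 < r" using spec_radius_nonneg[of "transpose A - Q ** K0"] by linarith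
  obtain C where C: "C > 0" "\<And>k x. norm (matrix_power (transpose A - Q ** K0) k *v x) \<le> C * r ^ k * norm x"
    using matrix_power_bound[OF r(1)] by auto
  \<comment> \<open>Detectability is stabilizability of the transposed pair. By symmetry of
    \<open>Q\<close> the stable matrix is the transpose of \<open>A - L ** Q\<close>, and norms of
    powers do not change under transposition.\<close>
  define L where "L = transpose K0"
  define M where "M = A - L ** Q"
  have M: "transpose A - Q ** K0 = transpose M"
    using Q by (simp add: M_def L_def transpose_def matrix_matrix_mult_def vec_eq_iff pos_semidef_def mult.commute)
  have MC: "norm (matrix_power M k *v x) \<le> C * r ^ k * norm x" for k x
  proof -
    have "spectral_norm (matrix_power M k) \<le> C * r ^ k"
      by (subst spectral_norm_transpose[symmetric], rule spectral_norm_bound)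
        (use C(2) in \<open>simp add: M matrix_power_transpose\<close>)
    then show ?thesis by (intro order_trans[OF norm_matrix_vector] mult_right_mono) auto
  qed
  obtain cR where cR: "cR > 0" "\<And>u. (norm u)\<^sup>2 \<le> cR * (u \<bullet> (R *v u))"
    using pos_definite_coercive[OF R] by auto
  \<comment> \<open>Splitting the square of a sum of three vectors twice gives the factors 2, 4 and
    4; \<open>c\<close> dominates all three coefficients.\<close>
  define c1 where "c1 = 2 * (spectral_norm L)\<^sup>2 * (spectral_norm Q + 1)"
  define c2 where "c2 = 4 * (spectral_norm B)\<^sup>2 * cR"
  define c where "c = c1 + c2 + 4"
  have c12: "0 \<le> c1" "0 \<le> c2" using cR spectral_norm_nonneg[of Q] by (auto simp: c1_def c2_def)
  have d_bound: "(norm (L *v (Q *v x) + (B *v v + y)))\<^sup>2 \<le> c * (x \<bullet> (Q *v x) + v \<bullet> (R *v v) + (norm y)\<^sup>2)"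
    for x v y
  proof -
    have q0: "0 \<le> x \<bullet> (Q *v x)" using Q by (simp add: pos_semidef_def)
    have v0: "0 \<le> v \<bullet> (R *v v)" using pos_definite_imp_pos_semidef[OF R] by (simp add: pos_semidef_def)
    have "(norm (L *v (Q *v x) + (B *v v + y)))\<^sup>2
        \<le> 2 * (norm (L *v (Q *v x)))\<^sup>2 + 2 * (norm (B *v v + y))\<^sup>2" by (rule power2_norm_add_le)
    also have "\<dots> \<le> 2 * (norm (L *v (Q *v x)))\<^sup>2 + 2 * (2 * (norm (B *v v))\<^sup>2 + 2 * (norm y)\<^sup>2)"
      by (intro add_left_mono mult_left_mono power2_norm_add_le) auto
    also have "(norm (L *v (Q *v x)))\<^sup>2 \<le> (spectral_norm L)\<^sup>2 * ((spectral_norm Q + 1) * (x \<bullet> (Q *v x)))"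
      by (intro order_trans[OF power2_norm_matrix] mult_left_mono pos_semidef_image_bound[OF Q]) auto
    also have "(norm (B *v v))\<^sup>2 \<le> (spectral_norm B)\<^sup>2 * (cR * (v \<bullet> (R *v v)))"
      by (intro order_trans[OF power2_norm_matrix] mult_left_mono cR) auto
    finally have "(norm (L *v (Q *v x) + (B *v v + y)))\<^sup>2 \<le> c1 * (x \<bullet> (Q *v x)) + c2 * (v \<bullet> (R *v v)) + 4 * (norm y)\<^sup>2"
      by (simp add: c1_def c2_def mult_ac)
    also have "\<dots> \<le> c * (x \<bullet> (Q *v x)) + c * (v \<bullet> (R *v v)) + c * (norm y)\<^sup>2"
      using q0 v0 c12 by (intro add_mono mult_right_mono) (auto simp: c_def)
    finally show ?thesis by (simp add: algebra_simps)
  qed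
  define D where "D = (C\<^sup>2 + C\<^sup>2 / (1 - r) * c) / (1 - r)"
  have D: "D > 0" unfolding D_def using C r c12
    by (intro divide_pos_pos add_pos_nonneg) (auto simp: c_def)
  have "(\<Sum>t\<le>T. (norm (state A B x0 u w t))\<^sup>2)
    \<le> D * ((norm x0)\<^sup>2 + (\<Sum>t<T. state A B x0 u w t \<bullet> (Q *v state A B x0 u w t) + u t \<bullet> (R *v u t))
            + (\<Sum>t<T. (norm (w t))\<^sup>2))" for x0 u w T
  proof -
    define x where "x = state A B x0 u w"
    define d where "d t = L *v (Q *v x t) + (B *v u t + w t)" for t
    define E where "E = (\<Sum>t<T. x t \<bullet> (Q *v x t) + u t \<bullet> (R *v u t)) + (\<Sum>t<T. (norm (w t))\<^sup>2)"
    have "x (Suc t) = M *v x t + d t" for t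
      by (simp add: x_def M_def d_def matrix_vector_mult_diff_rdistrib matrix_vector_mul_assoc)
    then have "norm (x t) \<le> majorant C r (norm x0) (\<lambda>t. norm (d t)) t" for t
      by (rule norm_le_majorant[OF MC]) (use C r0 in \<open>auto simp: x_def\<close>)
    then have "(1 - r) * (\<Sum>t\<le>T. (norm (x t))\<^sup>2) \<le> (1 - r) * (\<Sum>t\<le>T. (majorant C r (norm x0) (\<lambda>t. norm (d t)) t)\<^sup>2)"
      using r by (intro mult_left_mono sum_mono power_mono) auto
    also have "\<dots> \<le> C\<^sup>2 * (norm x0)\<^sup>2 + C\<^sup>2 / (1 - r) * (\<Sum>t<T. (norm (d t))\<^sup>2)"
      by (rule majorant_square_sum[OF r0 r(2)])
    also have "(\<Sum>t<T. (norm (d t))\<^sup>2) \<le> (\<Sum>t<T. c * (x t \<bullet> (Q *v x t) + u t \<bullet> (R *v u t) + (norm (w t))\<^sup>2))"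
      unfolding d_def by (intro sum_mono d_bound)
    also have "\<dots> = c * E" by (simp add: E_def sum_distrib_left sum.distrib algebra_simps)
    finally have *: "(1 - r) * (\<Sum>t\<le>T. (norm (x t))\<^sup>2) \<le> C\<^sup>2 * (norm x0)\<^sup>2 + C\<^sup>2 / (1 - r) * (c * E)"
      using r by (auto simp: divide_right_mono mult_left_mono)
    have E0: "0 \<le> E" unfolding E_def using Q pos_definite_imp_pos_semidef[OF R]
      by (intro add_nonneg_nonneg sum_nonneg) (auto simp: pos_semidef_def)
    have "C\<^sup>2 * (norm x0)\<^sup>2 + C\<^sup>2 / (1 - r) * (c * E)
        \<le> (C\<^sup>2 + C\<^sup>2 / (1 - r) * c) * (norm x0)\<^sup>2 + (C\<^sup>2 + C\<^sup>2 / (1 - r) * c) * E"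
    proof (intro add_mono)
      have "0 \<le> C\<^sup>2 / (1 - r) * c" using r c12 by (auto simp: c_def)
      then show "C\<^sup>2 * (norm x0)\<^sup>2 \<le> (C\<^sup>2 + C\<^sup>2 / (1 - r) * c) * (norm x0)\<^sup>2"
        by (intro mult_right_mono) auto
      have "C\<^sup>2 / (1 - r) * (c * E) = (C\<^sup>2 / (1 - r) * c) * E" by simp
      also have "\<dots> \<le> (C\<^sup>2 + C\<^sup>2 / (1 - r) * c) * E" using E0 by (intro mult_right_mono) auto
      finally show "C\<^sup>2 / (1 - r) * (c * E) \<le> (C\<^sup>2 + C\<^sup>2 / (1 - r) * c) * E" .
    qed
    also have "\<dots> = (1 - r) * (D * ((norm x0)\<^sup>2 + E))" using r by (simp add: D_def distrib_left)
    finally have "(\<Sum>t\<le>T. (norm (x t))\<^sup>2) \<le> D * ((norm x0)\<^sup>2 + E)"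
      using * r by (smt (verit) mult_le_cancel_left_pos)
    then show ?thesis by (simp add: E_def x_def add.assoc)
  qed
  with D show ?thesis by blast
qed

section \<open>The one-step identity and its sum along a trajectory\<close>

locale lqr =
  fixes A Q P :: "real^'n^'n" and B :: "real^'d^'n" and R :: "real^'d^'d"
  assumes psd_Q: "pos_semidef Q" and pd_R: "pos_definite R" and psd_P: "pos_semidef P"
    and detectable: "detectable A Q" and riccati: "riccati_solution A B Q R P"
begin

text \<open>\<open>S\<close> is half the Hessian in \<open>u\<close> of the one-step cost with
  terminal weight \<open>P\<close>. Up to sign, \<open>K\<close> and \<open>H\<close> turn the state
  and the adjoint vector into their shares of the optimal control.\<close>

definition S :: "real^'d^'d" where "S = R + transpose B ** P ** B"
definition K :: "real^'n^'d" where "K = lqr_gain A B R P"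
definition F :: "real^'n^'n" where "F = A - B ** K"
definition H :: "real^'n^'d" where "H = matrix_inv S ** transpose B"

lemma P_sym: "transpose P = P" and P_nonneg: "0 \<le> x \<bullet> (P *v x)"
  using psd_P by (auto simp: pos_semidef_def)

lemma Q_nonneg: "0 \<le> x \<bullet> (Q *v x)"
  using psd_Q by (auto simp: pos_semidef_def)

lemma R_nonneg: "0 \<le> u \<bullet> (R *v u)"
  using pos_definite_imp_pos_semidef[OF pd_R] by (auto simp: pos_semidef_def)

lemma P_inner: "(P *v x) \<bullet> y = x \<bullet> (P *v y)"
  by (simp only: matrix_vector_inner P_sym)

lemma S_form: "u \<bullet> (S *v v) = u \<bullet> (R *v v) + (B *v u) \<bullet> (P *v (B *v v))"
  by (simp only: S_def matrix_vector_mult_add_rdistrib inner_add_right matrix_vector_mul_assoc[symmetric]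
      matrix_vector_inner)

lemma S_sym: "transpose S = S"
  using pd_R by (simp add: S_def transpose_add matrix_transpose_mul P_sym pos_definite_def matrix_mul_assoc)

lemma pd_S: "pos_definite S"
  unfolding pos_definite_def
proof (intro conjI allI impI S_sym)
  fix u :: "real^'d" assume "u \<noteq> 0"
  then have "0 < u \<bullet> (R *v u)" using pd_R by (simp add: pos_definite_def)
  then show "0 < u \<bullet> (S *v u)" unfolding S_form using P_nonneg[of "B *v u"] by linarith
qed

lemma S_nonneg: "0 \<le> u \<bullet> (S *v u)"
  using pos_definite_imp_pos_semidef[OF pd_S] by (auto simp: pos_semidef_def)

lemma S_inner: "(S *v u) \<bullet> v = u \<bullet> (S *v v)"
  by (simp only: matrix_vector_inner S_sym)

lemma S_K: "S ** K = transpose B ** P ** A"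
  unfolding K_def lqr_gain_def S_def[symmetric]
  by (simp add: matrix_mul_assoc matrix_inv_right[OF pos_definite_invertible[OF pd_S]])

lemma S_H: "S *v (H *v q) = transpose B *v q"
  by (simp add: H_def matrix_vector_mul_assoc matrix_mul_assoc matrix_inv_right[OF pos_definite_invertible[OF pd_S]])

lemma H_PA: "H *v (P *v (A *v x)) = K *v x"
  by (simp add: H_def K_def lqr_gain_def S_def matrix_vector_mul_assoc matrix_mul_assoc)

lemma S_K_inner: "u \<bullet> (S *v (K *v x)) = (B *v u) \<bullet> (P *v (A *v x))"
  by (simp only: matrix_vector_mul_assoc S_K matrix_mul_assoc[symmetric])
    (simp only: matrix_vector_mul_assoc[symmetric] matrix_vector_inner)

text \<open>Since \<open>S ** K = transpose B ** P ** A\<close>, the subtracted term of the Riccati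
  equation is the quadratic form of \<open>S\<close> at \<open>K *v x\<close>.\<close>

lemma riccati_form:
  "x \<bullet> (P *v x) = x \<bullet> (Q *v x) + (A *v x) \<bullet> (P *v (A *v x)) - (K *v x) \<bullet> (S *v (K *v x))"
proof -
  have "P = Q + transpose A ** (P ** A) - transpose A ** (P ** (B ** K))"
    using riccati unfolding riccati_solution_def K_def lqr_gain_def by (simp add: matrix_mul_assoc)
  then have "P *v x = (Q + transpose A ** (P ** A) - transpose A ** (P ** (B ** K))) *v x" by simp
  also have "\<dots> = Q *v x + transpose A *v (P *v (A *v x)) - transpose A *v (P *v (B *v (K *v x)))"
    by (simp only: matrix_vector_mult_diff_rdistrib matrix_vector_mult_add_rdistrib matrix_vector_mul_assoc)
  finally have "x \<bullet> (P *v x) = x \<bullet> (Q *v x) + (A *v x) \<bullet> (P *v (A *v x)) - (A *v x) \<bullet> (P *v (B *v (K *v x)))"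
    by (simp add: inner_add inner_diff matrix_vector_inner)
  moreover have "(A *v x) \<bullet> (P *v (B *v (K *v x))) = (K *v x) \<bullet> (S *v (K *v x))"
    unfolding S_K_inner by (metis P_inner inner_commute)
  ultimately show ?thesis by simp
qed

text \<open>A Bellman step for the value function \<open>x . P x + 2 x . F^T q\<close>, whose linear
  part carries the future disturbances. As a function of \<open>u\<close> the left side is quadratic
  with leading form \<open>S\<close> and minimizer \<open>- K x - H q\<close>; what is left over
  involves \<open>w\<close> and \<open>q'\<close> only.\<close>

lemma complete_square:
  fixes x w q' :: "real^'n" and u :: "real^'d"
  defines "q \<equiv> P *v w + transpose F *v q'"
  defines "y \<equiv> A *v x + B *v u + w"
  defines "z \<equiv> u + K *v x + H *v q"
  shows "x \<bullet> (Q *v x) + u \<bullet> (R *v u) + y \<bullet> (P *v y) + 2 * (y \<bullet> (transpose F *v q'))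
    = x \<bullet> (P *v x) + 2 * (x \<bullet> (transpose F *v q)) + z \<bullet> (S *v z)
      + (w \<bullet> (P *v w) + 2 * (w \<bullet> (transpose F *v q')) - (H *v q) \<bullet> (S *v (H *v q)))"
proof -
  define e where "e = transpose F *v q'"
  define a where "a = A *v x"
  define b where "b = B *v u"
  define v where "v = K *v x"
  define g where "g = H *v q"
  have q: "q = P *v w + e" by (simp add: q_def e_def)
  have xF: "x \<bullet> (transpose F *v q) = a \<bullet> q - (B *v v) \<bullet> q"
    \<comment> \<open>\<open>F = A - B ** K\<close> splits the linear term; its part with
      \<open>B ** K\<close> cancels the mixed term of \<open>K *v x\<close> and
      \<open>H *v q\<close> in the square.\<close>
    unfolding matrix_vector_inner[symmetric]
    by (simp add: F_def a_def v_def matrix_vector_mult_diff_rdistrib inner_diff matrix_vector_mul_assoc)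
  have Sg: "s \<bullet> (S *v g) = (B *v s) \<bullet> q" for s
    by (simp add: g_def S_H matrix_vector_inner)
  have gS: "g \<bullet> (S *v s) = (B *v s) \<bullet> q" for s
    using Sg[of s] by (metis S_inner inner_commute)
  have uv: "u \<bullet> (S *v v) = b \<bullet> (P *v a)" by (simp add: v_def S_K_inner a_def b_def)
  have vu: "v \<bullet> (S *v u) = b \<bullet> (P *v a)" using uv by (metis S_inner inner_commute)
  have uu: "u \<bullet> (S *v u) = u \<bullet> (R *v u) + b \<bullet> (P *v b)" by (simp add: S_form b_def)
  have xx: "x \<bullet> (P *v x) = x \<bullet> (Q *v x) + a \<bullet> (P *v a) - v \<bullet> (S *v v)"
    by (simp add: riccati_form[of x] a_def v_def)
  have Pc: "c \<bullet> (P *v d) = d \<bullet> (P *v c)" for c d by (metis P_inner inner_commute)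
  have zz: "z \<bullet> (S *v z) = u \<bullet> (S *v u) + v \<bullet> (S *v v) + 2 * (b \<bullet> (P *v a))
      + 2 * (b \<bullet> q) + 2 * ((B *v v) \<bullet> q) + g \<bullet> (S *v g)"
    unfolding z_def g_def[symmetric] v_def[symmetric]
    by (simp add: matrix_vector_right_distrib inner_add Sg gS uv vu b_def algebra_simps)
  show ?thesis
    unfolding zz xF e_def[symmetric] g_def[symmetric] xx uu y_def a_def[symmetric] b_def[symmetric]
    by (simp add: matrix_vector_right_distrib inner_add q Pc[of b a] Pc[of w a] Pc[of w b] inner_commute algebra_simps)
qed

text \<open>The backward recursion is solved explicitly, since these finite sums are later compared
  term by term with the series in \<open>forecast\<close>.\<close>

definition adjoint_state :: "nat \<Rightarrow> (nat \<Rightarrow> real^'n) \<Rightarrow> nat \<Rightarrow> real^'n" where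
  "adjoint_state T w t = (\<Sum>i<T - t. matrix_power (transpose F) i *v (P *v w (t + i)))"

text \<open>The part of the one-step identity that no control influences. It has no definite sign,
  so absolute values are taken wherever such terms are discarded.\<close>

definition offset :: "nat \<Rightarrow> (nat \<Rightarrow> real^'n) \<Rightarrow> nat \<Rightarrow> real" where
  "offset T w t = w t \<bullet> (P *v w t) + 2 * (w t \<bullet> (transpose F *v adjoint_state T w (Suc t)))
     - (H *v adjoint_state T w t) \<bullet> (S *v (H *v adjoint_state T w t))"

definition deviation :: "real^'n \<Rightarrow> nat \<Rightarrow> (nat \<Rightarrow> real^'d) \<Rightarrow> (nat \<Rightarrow> real^'n) \<Rightarrow> nat \<Rightarrow> real^'d" where
  "deviation x0 T u w t = u t + K *v state A B x0 u w t + H *v adjoint_state T w t"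

lemma adjoint_state_step:
  assumes "t < T"
  shows "adjoint_state T w t = P *v w t + transpose F *v adjoint_state T w (Suc t)"
proof -
  have "T - t = Suc (T - Suc t)" using assms by simp
  then show ?thesis
    unfolding adjoint_state_def
    by (simp only: sum.lessThan_Suc_shift) (simp add: matrix_vector_sum matrix_vector_mul_assoc matrix_mul_assoc)
qed

lemma adjoint_state_end: "adjoint_state T w T = 0"
  by (simp add: adjoint_state_def)

definition stage_cost :: "real^'n \<Rightarrow> (nat \<Rightarrow> real^'d) \<Rightarrow> (nat \<Rightarrow> real^'n) \<Rightarrow> nat \<Rightarrow> real" where
  "stage_cost x0 u w t = state A B x0 u w t \<bullet> (Q *v state A B x0 u w t) + u t \<bullet> (R *v u t)"

definition initial_cost :: "real^'n \<Rightarrow> nat \<Rightarrow> (nat \<Rightarrow> real^'n) \<Rightarrow> real" where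
  "initial_cost x0 T w = x0 \<bullet> (P *v x0) + 2 * (x0 \<bullet> (transpose F *v adjoint_state T w 0))"

lemma stage_cost_nonneg: "0 \<le> stage_cost x0 u w t"
  by (simp add: stage_cost_def Q_nonneg R_nonneg)

text \<open>The horizon \<open>T\<close> of the adjoint sequence and the stopping time
  \<open>s\<close> are kept apart: averaging over stopping times needs the same terms in
  \<open>w\<close> for all of them. Stopping early leaves the value function at
  \<open>s\<close>.\<close>

lemma stage_cost_sum:
  assumes "s \<le> T"
  shows "(\<Sum>t<s. stage_cost x0 u w t)
    = initial_cost x0 T w
      + (\<Sum>t<s. deviation x0 T u w t \<bullet> (S *v deviation x0 T u w t) + offset T w t)
      - state A B x0 u w s \<bullet> (P *v state A B x0 u w s)
      - 2 * (state A B x0 u w s \<bullet> (transpose F *v adjoint_state T w s))"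
  using assms
proof (induction s)
  case 0
  then show ?case by (simp add: initial_cost_def)
next
  case (Suc s)
  then have q: "adjoint_state T w s = P *v w s + transpose F *v adjoint_state T w (Suc s)"
    by (intro adjoint_state_step) simp
  show ?case
    using Suc complete_square[of "state A B x0 u w s" "u s" "w s" "adjoint_state T w (Suc s)"]
    by (simp add: stage_cost_def deviation_def offset_def q[symmetric])
qed

lemma lqr_cost_eq:
  "lqr_cost A B Q R Qf x0 T u w = (\<Sum>t<T. stage_cost x0 u w t) + state A B x0 u w T \<bullet> (Qf *v state A B x0 u w T)"
  by (simp add: lqr_cost_def stage_cost_def)

text \<open>Without disturbances \<open>u = - K x\<close> has zero deviation and zero offset, so its
  stage costs sum to at most \<open>x0 \<bullet> (P *v x0)\<close> on every horizon. Detectability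
  turns this into summability of the squared states, which form an orbit of
  \<open>F\<close>.\<close>

lemma spec_radius_F: "spec_radius F < 1"
proof -
  obtain C where C: "C > 0" "\<And>x0 u w T. (\<Sum>t\<le>T. (norm (state A B x0 u w t))\<^sup>2)
    \<le> C * ((norm x0)\<^sup>2 + (\<Sum>t<T. state A B x0 u w t \<bullet> (Q *v state A B x0 u w t) + u t \<bullet> (R *v u t))
            + (\<Sum>t<T. (norm (w t))\<^sup>2))"
    using detectability_bound[OF psd_Q pd_R detectable] by blast
  show ?thesis
  proof (rule spec_radius_less_one[of _ "C * (1 + spectral_norm P)"])
    fix T and x0 :: "real^'n"
    define u where "u t = - (K *v (matrix_power F t *v x0))" for t
    have x: "state A B x0 u (\<lambda>_. 0) t = matrix_power F t *v x0" for t
    proof (induction t)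
      case (Suc t)
      have "F *v y = A *v y - B *v (K *v y)" for y
        by (simp add: F_def matrix_vector_mult_diff_rdistrib matrix_vector_mul_assoc)
      with Suc show ?case
        by (simp add: u_def matrix_vector_mult_minus_right matrix_vector_mul_assoc[symmetric])
    qed simp
    have z: "deviation x0 T u (\<lambda>_. 0) t = 0" and o: "offset T (\<lambda>_. 0) t = 0" for t
      by (auto simp: deviation_def x u_def offset_def adjoint_state_def)
    have "(\<Sum>t<T. stage_cost x0 u (\<lambda>_. 0) t) \<le> x0 \<bullet> (P *v x0)"
      using P_nonneg unfolding stage_cost_sum[OF order_refl] by (simp add: z o initial_cost_def adjoint_state_def)
    also have "\<dots> \<le> norm x0 * (spectral_norm P * norm x0)"
      by (intro order_trans[OF norm_cauchy_schwarz] mult_left_mono norm_matrix_vector) auto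
    finally have *: "(\<Sum>t<T. stage_cost x0 u (\<lambda>_. 0) t) \<le> spectral_norm P * (norm x0)\<^sup>2"
      by (simp add: power2_eq_square mult_ac)
    have "(\<Sum>t<T. (norm (matrix_power F t *v x0))\<^sup>2) \<le> (\<Sum>t\<le>T. (norm (matrix_power F t *v x0))\<^sup>2)"
      by (intro sum_mono2) auto
    also have "\<dots> \<le> C * ((norm x0)\<^sup>2 + (\<Sum>t<T. stage_cost x0 u (\<lambda>_. 0) t))"
      using C(2)[of x0 u "\<lambda>_. 0" T] by (simp add: x stage_cost_def)
    also have "\<dots> \<le> C * ((norm x0)\<^sup>2 + spectral_norm P * (norm x0)\<^sup>2)"
      using C(1) * by (intro mult_left_mono) auto
    finally show "(\<Sum>t<T. (norm (matrix_power F t *v x0))\<^sup>2) \<le> C * (1 + spectral_norm P) * (norm x0)\<^sup>2"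
      by (simp add: algebra_simps)
  qed
qed

text \<open>The sum of the identities stopped at each of the last \<open>N\<close> times. Dividing
  by \<open>N + c\<close> loses a factor tending to 1 as \<open>N\<close> grows, which requires
  \<open>c\<close> to be uniform in \<open>u\<close>, \<open>w\<close>, \<open>N\<close> and
  \<open>T\<close>; hence a predicate on \<open>c\<close>.\<close>

definition cost_lower_constant :: "real^'n^'n \<Rightarrow> real \<Rightarrow> bool" where
  "cost_lower_constant Qf c \<longleftrightarrow> 0 < c \<and> (\<forall>x0 u w N T. 0 < N \<longrightarrow> N \<le> T \<longrightarrow>
    real N * (initial_cost x0 T w
        + (\<Sum>t<T - N. deviation x0 T u w t \<bullet> (S *v deviation x0 T u w t) + offset T w t)
        - (\<Sum>t=T - N..<T. \<bar>offset T w t\<bar>))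
      - (\<Sum>t=T - N..<T. (norm (transpose F *v adjoint_state T w t))\<^sup>2)
      - c * ((norm x0)\<^sup>2 + (\<Sum>t<T. (norm (w t))\<^sup>2))
    \<le> (real N + c) * lqr_cost A B Q R Qf x0 T u w)"

lemma cost_lower_constantD:
  assumes "cost_lower_constant Qf c" and "0 < N" and "N \<le> T"
  shows "real N * (initial_cost x0 T w
        + (\<Sum>t<T - N. deviation x0 T u w t \<bullet> (S *v deviation x0 T u w t) + offset T w t)
        - (\<Sum>t=T - N..<T. \<bar>offset T w t\<bar>))
      - (\<Sum>t=T - N..<T. (norm (transpose F *v adjoint_state T w t))\<^sup>2)
      - c * ((norm x0)\<^sup>2 + (\<Sum>t<T. (norm (w t))\<^sup>2))
    \<le> (real N + c) * lqr_cost A B Q R Qf x0 T u w"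
  using assms unfolding cost_lower_constant_def by blast

lemma cost_lower_bound:
  assumes Qf: "pos_semidef Qf"
  shows "\<exists>c. cost_lower_constant Qf c"
proof -
  obtain C where C: "C > 0" "\<And>x0 u w T. (\<Sum>t\<le>T. (norm (state A B x0 u w t))\<^sup>2)
    \<le> C * ((norm x0)\<^sup>2 + (\<Sum>t<T. state A B x0 u w t \<bullet> (Q *v state A B x0 u w t) + u t \<bullet> (R *v u t))
            + (\<Sum>t<T. (norm (w t))\<^sup>2))"
    using detectability_bound[OF psd_Q pd_R detectable] by blast
  \<comment> \<open>The 1 pays for the mixed term \<open>2 * (x s \<bullet> e s)\<close> of the
    value function at the stopping time.\<close>
  define p where "p = spectral_norm P + 1"
  have p: "p > 0" using spectral_norm_nonneg[of P] by (simp add: p_def)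
  have "real N * (initial_cost x0 T w
        + (\<Sum>t<T - N. deviation x0 T u w t \<bullet> (S *v deviation x0 T u w t) + offset T w t)
        - (\<Sum>t=T - N..<T. \<bar>offset T w t\<bar>))
      - (\<Sum>t=T - N..<T. (norm (transpose F *v adjoint_state T w t))\<^sup>2)
      - p * C * ((norm x0)\<^sup>2 + (\<Sum>t<T. (norm (w t))\<^sup>2))
    \<le> (real N + p * C) * lqr_cost A B Q R Qf x0 T u w"
    if N: "N \<le> T" for x0 u w N T
  proof -
    define J where "J = lqr_cost A B Q R Qf x0 T u w"
    define x where "x = state A B x0 u w"
    define e where "e t = transpose F *v adjoint_state T w t" for t
    define zz where "zz t = deviation x0 T u w t \<bullet> (S *v deviation x0 T u w t)" for t
    define Z where "Z = initial_cost x0 T w + (\<Sum>t<T - N. zz t + offset T w t) - (\<Sum>t=T - N..<T. \<bar>offset T w t\<bar>)"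
    have "0 \<le> x T \<bullet> (Qf *v x T)" using Qf by (simp add: pos_semidef_def)
    then have J: "(\<Sum>t<T. stage_cost x0 u w t) \<le> J"
      by (simp add: J_def lqr_cost_eq x_def)
    \<comment> \<open>Stage costs before \<open>s\<close> do not exceed \<open>J\<close>; deviations
      from \<open>T - N\<close> on are dropped as nonnegative, and offsets there are bounded by
      their absolute values.\<close>
    have pre: "Z \<le> J + p * (norm (x s))\<^sup>2 + (norm (e s))\<^sup>2" if s: "s \<in> {T - N..<T}" for s
    proof -
      have "(\<Sum>t<s. zz t + offset T w t) = (\<Sum>t<T - N. zz t + offset T w t) + (\<Sum>t=T - N..<s. zz t + offset T w t)"
        using s by (subst sum.atLeastLessThan_concat[of 0 "T - N" s, symmetric, folded lessThan_atLeast0]) auto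
      moreover have "(\<Sum>t=T - N..<s. zz t + offset T w t) \<ge> (\<Sum>t=T - N..<s. - \<bar>offset T w t\<bar>)"
        using S_nonneg by (intro sum_mono) (smt (verit) zz_def)
      moreover have "(\<Sum>t=T - N..<s. \<bar>offset T w t\<bar>) \<le> (\<Sum>t=T - N..<T. \<bar>offset T w t\<bar>)"
        using s by (intro sum_mono2) auto
      ultimately have 1: "Z \<le> initial_cost x0 T w + (\<Sum>t<s. zz t + offset T w t)"
        by (simp add: Z_def sum_negf)
      have "(\<Sum>t<s. stage_cost x0 u w t) \<le> (\<Sum>t<T. stage_cost x0 u w t)"
        using s by (intro sum_mono2 stage_cost_nonneg) auto
      then have 2: "(\<Sum>t<s. stage_cost x0 u w t) \<le> J" using J by simp
      have "x s \<bullet> (P *v x s) \<le> norm (x s) * (spectral_norm P * norm (x s))"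
        by (intro order_trans[OF norm_cauchy_schwarz] mult_left_mono norm_matrix_vector) auto
      then have 3: "x s \<bullet> (P *v x s) \<le> spectral_norm P * (norm (x s))\<^sup>2"
        by (simp add: power2_eq_square mult_ac)
      have "0 \<le> (norm (x s - e s))\<^sup>2" by simp
      then have 4: "2 * (x s \<bullet> e s) \<le> (norm (x s))\<^sup>2 + (norm (e s))\<^sup>2"
        by (simp add: power2_norm_eq_inner inner_diff inner_commute)
      have "s \<le> T" using s by simp
      from stage_cost_sum[OF this, of x0 u w] 1 2 3 4 show ?thesis
        by (simp add: x_def[symmetric] e_def[symmetric] zz_def[symmetric] p_def algebra_simps)
    qed
    have "real N * Z = (\<Sum>s=T - N..<T. Z)" using N by simp
    also have "\<dots> \<le> (\<Sum>s=T - N..<T. J + p * (norm (x s))\<^sup>2 + (norm (e s))\<^sup>2)" by (intro sum_mono pre)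
    also have "\<dots> = real N * J + p * (\<Sum>s=T - N..<T. (norm (x s))\<^sup>2) + (\<Sum>s=T - N..<T. (norm (e s))\<^sup>2)"
      using N by (simp add: sum.distrib sum_distrib_left)
    \<comment> \<open>The gain of averaging: all \<open>N\<close> stopping states together are paid
      by one multiple of the cost, instead of each by its own.\<close>
    also have "(\<Sum>s=T - N..<T. (norm (x s))\<^sup>2) \<le> (\<Sum>s\<le>T. (norm (x s))\<^sup>2)" by (intro sum_mono2) auto
    also have "\<dots> \<le> C * ((norm x0)\<^sup>2 + (\<Sum>t<T. stage_cost x0 u w t) + (\<Sum>t<T. (norm (w t))\<^sup>2))"
      using C(2)[where T = T] by (simp add: x_def stage_cost_def)
    also have "\<dots> \<le> C * ((norm x0)\<^sup>2 + J + (\<Sum>t<T. (norm (w t))\<^sup>2))"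
      using C(1) J by (intro mult_left_mono) auto
    finally show ?thesis
      using p by (simp add: Z_def J_def e_def zz_def algebra_simps)
  qed
  moreover have "0 < p * C" using C(1) p by simp
  ultimately show ?thesis unfolding cost_lower_constant_def by (intro exI[of _ "p * C"] conjI allI impI)
qed

end

section \<open>Conditional laws of the disturbances and nested minimization\<close>

text \<open>Fubini for a kernel and a signed integrand. The inner integrals are finite only almost
  everywhere, so the two parts are integrated in \<open>ennreal\<close> first and subtracted
  afterwards.\<close>

lemma integral_bind_kernel:
  fixes f :: "'b \<Rightarrow> real"
  assumes \<kappa>[measurable]: "\<kappa> \<in> measurable N (subprob_algebra B)" and ne: "space N \<noteq> {}"
    and int: "integrable (N \<bind> \<kappa>) f"
  shows "AE x in N. integrable (\<kappa> x) f"
    and "integrable N (\<lambda>x. integral\<^sup>L (\<kappa> x) f)"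
    and "integral\<^sup>L (N \<bind> \<kappa>) f = (\<integral>x. integral\<^sup>L (\<kappa> x) f \<partial>N)"
proof -
  have sets: "sets (N \<bind> \<kappa>) = sets B"
    by (rule sets_bind[OF sets_kernel[OF \<kappa>] ne]) auto
  have f[measurable]: "f \<in> borel_measurable B"
    using borel_measurable_integrable[OF int] by (simp add: measurable_cong_sets[OF sets refl])
  have sets\<kappa>: "x \<in> space N \<Longrightarrow> sets (\<kappa> x) = sets B" for x by (rule sets_kernel[OF \<kappa>])
  have pos: "(\<integral>\<^sup>+x. ennreal (g x) \<partial>(N \<bind> \<kappa>)) = (\<integral>\<^sup>+x. \<integral>\<^sup>+y. ennreal (g y) \<partial>\<kappa> x \<partial>N)"
    if [measurable]: "g \<in> borel_measurable B" for g
    by (rule nn_integral_bind[OF _ \<kappa>]) measurable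
  have fin: "(\<integral>\<^sup>+x. \<integral>\<^sup>+y. ennreal (norm (f y)) \<partial>\<kappa> x \<partial>N) < \<infinity>"
    using int unfolding integrable_iff_bounded by (subst (asm) pos) auto
  have AE_fin: "AE x in N. (\<integral>\<^sup>+y. ennreal (norm (f y)) \<partial>\<kappa> x) \<noteq> \<infinity>"
    by (rule nn_integral_PInf_AE) (use fin in \<open>auto intro!: nn_integral_measurable_subprob_algebra2\<close>)
  show AE: "AE x in N. integrable (\<kappa> x) f"
    using AE_fin AE_space
  proof eventually_elim
    case (elim x)
    then show ?case
      unfolding integrable_iff_bounded
      by (auto simp: measurable_cong_sets[OF sets\<kappa> refl] top.not_eq_extremum)
  qed
  \<comment> \<open>\<open>ennreal\<close> maps negative numbers to 0, so \<open>g = f\<close> and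
    \<open>g = - f\<close> give the positive and the negative part.\<close>
  have part: "integrable N (\<lambda>x. enn2real (\<integral>\<^sup>+y. ennreal (g y) \<partial>\<kappa> x)) \<and>
      (\<integral>x. enn2real (\<integral>\<^sup>+y. ennreal (g y) \<partial>\<kappa> x) \<partial>N) = enn2real (\<integral>\<^sup>+x. ennreal (g x) \<partial>(N \<bind> \<kappa>))"
    if [measurable]: "g \<in> borel_measurable B" and le: "\<And>y. g y \<le> norm (f y)" for g
  proof -
    have [measurable]: "(\<lambda>x. \<integral>\<^sup>+y. ennreal (g y) \<partial>\<kappa> x) \<in> borel_measurable N"
      by (auto intro!: nn_integral_measurable_subprob_algebra2)
    have eq: "(\<integral>\<^sup>+x. ennreal (enn2real (\<integral>\<^sup>+y. ennreal (g y) \<partial>\<kappa> x)) \<partial>N)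
        = (\<integral>\<^sup>+x. ennreal (g x) \<partial>(N \<bind> \<kappa>))"
      unfolding pos[OF that(1)]
    proof (rule nn_integral_cong_AE, use AE_fin in eventually_elim)
      case (elim x)
      have "(\<integral>\<^sup>+y. ennreal (g y) \<partial>\<kappa> x) \<le> (\<integral>\<^sup>+y. ennreal (norm (f y)) \<partial>\<kappa> x)"
        by (intro nn_integral_mono ennreal_leI le)
      with elim show ?case by (simp add: top.not_eq_extremum)
    qed
    have "(\<integral>\<^sup>+x. ennreal (g x) \<partial>(N \<bind> \<kappa>)) \<le> (\<integral>\<^sup>+x. ennreal (norm (f x)) \<partial>(N \<bind> \<kappa>))"
      by (intro nn_integral_mono ennreal_leI le)
    also have "\<dots> < \<infinity>" using int unfolding integrable_iff_bounded by simp
    finally have "integrable N (\<lambda>x. enn2real (\<integral>\<^sup>+y. ennreal (g y) \<partial>\<kappa> x))"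
      by (intro integrableI_nonneg) (auto simp: eq)
    moreover have "(\<integral>x. enn2real (\<integral>\<^sup>+y. ennreal (g y) \<partial>\<kappa> x) \<partial>N) = enn2real (\<integral>\<^sup>+x. ennreal (g x) \<partial>(N \<bind> \<kappa>))"
      by (subst integral_eq_nn_integral) (auto simp: eq)
    ultimately show ?thesis by simp
  qed
  have [measurable]: "(\<lambda>x. integral\<^sup>L (\<kappa> x) f) \<in> borel_measurable N"
    by (rule measurable_compose[OF \<kappa>]) measurable
  have p1: "integrable N (\<lambda>x. enn2real (\<integral>\<^sup>+y. ennreal (f y) \<partial>\<kappa> x))"
      "(\<integral>x. enn2real (\<integral>\<^sup>+y. ennreal (f y) \<partial>\<kappa> x) \<partial>N) = enn2real (\<integral>\<^sup>+x. ennreal (f x) \<partial>(N \<bind> \<kappa>))"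
    using part[of f] by auto
  have p2: "integrable N (\<lambda>x. enn2real (\<integral>\<^sup>+y. ennreal (- f y) \<partial>\<kappa> x))"
      "(\<integral>x. enn2real (\<integral>\<^sup>+y. ennreal (- f y) \<partial>\<kappa> x) \<partial>N) = enn2real (\<integral>\<^sup>+x. ennreal (- f x) \<partial>(N \<bind> \<kappa>))"
    using part[of "\<lambda>y. - f y"] by auto
  have eq: "AE x in N. integral\<^sup>L (\<kappa> x) f
      = enn2real (\<integral>\<^sup>+y. ennreal (f y) \<partial>\<kappa> x) - enn2real (\<integral>\<^sup>+y. ennreal (- f y) \<partial>\<kappa> x)"
    using AE by eventually_elim (rule real_lebesgue_integral_def)
  show "integrable N (\<lambda>x. integral\<^sup>L (\<kappa> x) f)"
    by (subst integrable_cong_AE[OF _ _ eq]) (use p1 p2 in auto)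
  have "(\<integral>x. integral\<^sup>L (\<kappa> x) f \<partial>N)
      = (\<integral>x. enn2real (\<integral>\<^sup>+y. ennreal (f y) \<partial>\<kappa> x) - enn2real (\<integral>\<^sup>+y. ennreal (- f y) \<partial>\<kappa> x) \<partial>N)"
    by (rule integral_cong_AE[OF _ _ eq]) (use p1 p2 in auto)
  also have "\<dots> = enn2real (\<integral>\<^sup>+x. ennreal (f x) \<partial>(N \<bind> \<kappa>)) - enn2real (\<integral>\<^sup>+x. ennreal (- f x) \<partial>(N \<bind> \<kappa>))"
    using p1 p2 by simp
  also have "\<dots> = integral\<^sup>L (N \<bind> \<kappa>) f" by (rule real_lebesgue_integral_def[OF int, symmetric])
  finally show "integral\<^sup>L (N \<bind> \<kappa>) f = (\<integral>x. integral\<^sup>L (\<kappa> x) f \<partial>N)" ..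
qed

lemma nn_integral_distr_codomain:
  assumes "T \<in> measurable M N" and "f \<in> borel_measurable N"
  shows "(\<integral>\<^sup>+x. f x \<partial>distr M N T) = (\<integral>\<^sup>+x. f (T x) \<partial>M)"
  using assms by (intro nn_integral_distr) auto

text \<open>Truncating negative values can only increase an integral. This carries signed lower
  bounds into nested expectations of \<open>ennreal\<close> values.\<close>

lemma ennreal_integral_le_nn_integral:
  fixes f :: "'a \<Rightarrow> real"
  assumes "integrable M f"
  shows "ennreal (integral\<^sup>L M f) \<le> (\<integral>\<^sup>+x. ennreal (f x) \<partial>M)"
proof -
  have "integral\<^sup>L M f \<le> (\<integral>x. max 0 (f x) \<partial>M)"
    using assms by (intro integral_mono) auto
  then have "ennreal (integral\<^sup>L M f) \<le> ennreal (\<integral>x. max 0 (f x) \<partial>M)" by (rule ennreal_leI)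
  also have "\<dots> = (\<integral>\<^sup>+x. ennreal (max 0 (f x)) \<partial>M)"
    using assms by (intro nn_integral_eq_integral[symmetric]) auto
  also have "\<dots> = (\<integral>\<^sup>+x. ennreal (f x) \<partial>M)"
    by (intro nn_integral_cong) (auto simp: max_def ennreal_neg)
  finally show ?thesis .
qed

section \<open>Kernels of the remaining disturbances given a history\<close>

text \<open>\<open>future W n s h\<close> is the law of \<open>(w\<^sub>0, \<dots>, w\<^sub>s\<^sub>+\<^sub>n\<^sub>-\<^sub>1)\<close> given \<open>(w\<^sub>0, \<dots>, w\<^sub>s\<^sub>-\<^sub>1) = h\<close>.\<close>

primrec future :: "(nat \<Rightarrow> (nat \<Rightarrow> real^'n) \<Rightarrow> (real^'n) measure) \<Rightarrow> nat \<Rightarrow> nat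
    \<Rightarrow> (nat \<Rightarrow> real^'n) \<Rightarrow> (nat \<Rightarrow> real^'n) measure" where
  "future W 0 s h = return (hist_space s) h"
| "future W (Suc n) s h = W s h \<bind> (\<lambda>y. future W n (Suc s) (h(s := y)))"

lemma measurable_hist_update:
  "(\<lambda>(h, y). h(s := y)) \<in> measurable (hist_space s \<Otimes>\<^sub>M borel) (hist_space (Suc s) :: (nat \<Rightarrow> real^'n) measure)"
  by (subst case_prod_beta') (rule measurable_fun_upd[where J = "{..<s}"], auto)

lemma hist_space_update: "h \<in> space (hist_space s) \<Longrightarrow> h(s := y) \<in> space (hist_space (Suc s))"
  by (auto simp: space_PiM PiE_def extensional_def)

lemma hist_space_eqI: "h \<in> space (hist_space s) \<Longrightarrow> h' \<in> space (hist_space s) \<Longrightarrow> (\<And>i. i < s \<Longrightarrow> h i = h' i) \<Longrightarrow> h = h'"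
  by (auto simp: space_PiM intro: PiE_ext)

lemma restrict_hist_space: "restrict h {..<s} \<in> space (hist_space s)"
  by (auto simp: space_PiM)

locale disturbance_kernels =
  fixes W :: "nat \<Rightarrow> (nat \<Rightarrow> real^'n) \<Rightarrow> (real^'n) measure"
  assumes W: "\<And>t. W t \<in> measurable (hist_space t) (prob_algebra borel)"
begin

lemma measurable_future: "future W n s \<in> measurable (hist_space s) (prob_algebra (hist_space (s + n)))"
proof (induction n arbitrary: s)
  case 0
  have "future W 0 s = return (hist_space s)" by auto
  then show ?case by simp
next
  case (Suc n)
  have "(\<lambda>x. future W n (Suc s) (case x of (h, y) \<Rightarrow> h(s := y)))
      \<in> measurable (hist_space s \<Otimes>\<^sub>M borel) (prob_algebra (hist_space (Suc s + n)))"
    by (rule measurable_compose[OF measurable_hist_update Suc])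
  then have "(\<lambda>h. W s h \<bind> (\<lambda>y. future W n (Suc s) (h(s := y))))
      \<in> measurable (hist_space s) (prob_algebra (hist_space (Suc s + n)))"
    by (intro measurable_bind_prob_space2[OF W]) (simp add: case_prod_unfold)
  then show ?case by simp
qed

lemma measurable_future_update:
  assumes "h \<in> space (hist_space s)"
  shows "(\<lambda>y. future W n (Suc s) (h(s := y))) \<in> measurable (W s h) (subprob_algebra (hist_space (s + Suc n)))"
proof -
  have sets: "sets (W s h) = sets borel" using sets_kernel[OF measurable_prob_algebraD[OF W] assms] .
  have upd: "(\<lambda>y. h(s := y)) \<in> measurable borel (hist_space (Suc s))"
    using measurable_compose[OF measurable_Pair1'[OF assms, of borel] measurable_hist_update[of s]] by simp
  have "(\<lambda>y. future W n (Suc s) (h(s := y))) \<in> measurable borel (subprob_algebra (hist_space (Suc s + n)))"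
    by (rule measurable_compose[OF upd measurable_prob_algebraD[OF measurable_future]])
  then show ?thesis unfolding measurable_cong_sets[OF sets refl] add_Suc_shift .
qed

lemma prob_space_W: "h \<in> space (hist_space s) \<Longrightarrow> prob_space (W s h)"
  using measurable_space[OF W] by (simp add: space_prob_algebra)

lemma prob_space_future: "h \<in> space (hist_space s) \<Longrightarrow> prob_space (future W n s h)"
  using measurable_space[OF measurable_future] by (simp add: space_prob_algebra)

lemma sets_future: "h \<in> space (hist_space s) \<Longrightarrow> sets (future W n s h) = sets (hist_space (s + n))"
  using measurable_space[OF measurable_future] by (simp add: space_prob_algebra)

text \<open>One conditioning step. The inequality comes from truncating negative inner integrals and
  points the way lower bounds need; integrability survives for almost every \<open>y\<close>
  only.\<close>

lemma future_Suc_integral: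
  fixes \<Phi> :: "(nat \<Rightarrow> real^'n) \<Rightarrow> real"
  assumes "h \<in> space (hist_space s)" and "integrable (future W (Suc n) s h) \<Phi>"
  shows "AE y in W s h. integrable (future W n (Suc s) (h(s := y))) \<Phi>"
    and "ennreal (integral\<^sup>L (future W (Suc n) s h) \<Phi>)
      \<le> (\<integral>\<^sup>+y. ennreal (integral\<^sup>L (future W n (Suc s) (h(s := y))) \<Phi>) \<partial>W s h)"
proof -
  note * = integral_bind_kernel[OF measurable_future_update[OF assms(1)]
      prob_space.not_empty[OF prob_space_W[OF assms(1)]] assms(2)[unfolded future.simps]]
  show "AE y in W s h. integrable (future W n (Suc s) (h(s := y))) \<Phi>" by (rule *)
  show "ennreal (integral\<^sup>L (future W (Suc n) s h) \<Phi>)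
      \<le> (\<integral>\<^sup>+y. ennreal (integral\<^sup>L (future W n (Suc s) (h(s := y))) \<Phi>) \<partial>W s h)"
    unfolding future.simps *(3) by (rule ennreal_integral_le_nn_integral[OF *(2)])
qed

lemma future_Suc_nn_integral:
  assumes "h \<in> space (hist_space s)" and "g \<in> borel_measurable (hist_space (s + Suc n))"
  shows "(\<integral>\<^sup>+x. g x \<partial>future W (Suc n) s h) = (\<integral>\<^sup>+y. \<integral>\<^sup>+x. g x \<partial>future W n (Suc s) (h(s := y)) \<partial>W s h)"
  unfolding future.simps by (rule nn_integral_bind[OF assms(2) measurable_future_update[OF assms(1)]])

text \<open>Under this law functions of the past are constants; this is how known quantities are
  taken out of conditional integrals.\<close>

lemma future_extends:
  assumes "h \<in> space (hist_space s)"
  shows "AE x in future W n s h. \<forall>i<s. x i = h i"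
proof -
  have "AE x in future W n s h. x i = h i" if "i < s" for i
    using assms that
  proof (induction n arbitrary: s h)
    case 0
    have [measurable]: "(\<lambda>x. x i) \<in> borel_measurable (hist_space s :: (nat \<Rightarrow> real^'n) measure)"
      using 0(2) by (intro measurable_component_singleton) auto
    show ?case unfolding future.simps by (subst AE_return[OF 0(1)]) auto
  next
    case (Suc n)
    show ?case
      unfolding future.simps
    proof (subst AE_bind[OF measurable_future_update[OF Suc.prems(1)]])
      have [measurable]: "(\<lambda>x. x i) \<in> borel_measurable (hist_space (s + Suc n) :: (nat \<Rightarrow> real^'n) measure)"
        using Suc.prems(2) by (intro measurable_component_singleton) auto
      show "Measurable.pred (hist_space (s + Suc n)) (\<lambda>x. x i = h i)" by measurable
      have "AE x in future W n (Suc s) (h(s := y)). x i = h i" for y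
        using Suc.IH[OF hist_space_update[OF Suc.prems(1), of y]] Suc.prems(2) by simp
      then show "AE y in W s h. AE x in future W n (Suc s) (h(s := y)). x i = h i" by simp
    qed
  qed
  then have "\<forall>i\<in>{..<s}. AE x in future W n s h. x i = h i" by blast
  then have "AE x in future W n s h. \<forall>i\<in>{..<s}. x i = h i"
    by (subst AE_ball_countable) auto
  then show ?thesis by auto
qed

section \<open>Nested expectations and minima bounded from both sides\<close>

lemma integrable_future_bound:
  fixes f :: "(nat \<Rightarrow> real^'n) \<Rightarrow> 'b::{banach, second_countable_topology}" and \<Psi> :: "_ \<Rightarrow> real"
  assumes "h \<in> space (hist_space s)" and "s + n = T" and "integrable (future W n s h) \<Psi>"
    and f: "f \<in> borel_measurable (hist_space T)" "\<And>x. x \<in> space (hist_space T) \<Longrightarrow> norm (f x) \<le> \<Psi> x"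
  shows "integrable (future W n s h) f"
proof (rule Bochner_Integration.integrable_bound[OF assms(3)])
  have sets: "sets (future W n s h) = sets (hist_space T)"
    using sets_future[OF assms(1), of n] assms(2) by simp
  show "f \<in> borel_measurable (future W n s h)"
    using f(1) by (simp add: measurable_cong_sets[OF sets refl])
  show "AE x in future W n s h. norm (f x) \<le> norm (\<Psi> x)"
  proof (rule AE_I2)
    fix x assume "x \<in> space (future W n s h)"
    then have "norm (f x) \<le> \<Psi> x" using f(2) sets_eq_imp_space_eq[OF sets] by simp
    then show "norm (f x) \<le> norm (\<Psi> x)" by simp
  qed
qed

text \<open>Conditional integrability holds almost surely only, so it is carried along as a
  hypothesis on one dominating \<open>\<Psi>\<close>. Of \<open>g\<close> just a bound is asked,
  because \<open>nn_integral\<close> is monotone for arbitrary functions.\<close>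

lemma draws_lower:
  fixes G \<Psi> :: "(nat \<Rightarrow> real^'n) \<Rightarrow> real"
  assumes G: "G \<in> borel_measurable (hist_space T)" "\<And>x. x \<in> space (hist_space T) \<Longrightarrow> \<bar>G x\<bar> \<le> \<Psi> x"
    and g: "\<And>h. h \<in> space (hist_space s') \<Longrightarrow> integrable (future W n' s' h) \<Psi>
       \<Longrightarrow> ennreal (integral\<^sup>L (future W n' s' h) G) \<le> g h"
    and "s + n = s'" "s' + n' = T" and "h \<in> space (hist_space s)" and "integrable (future W (n + n') s h) \<Psi>"
  shows "ennreal (integral\<^sup>L (future W (n + n') s h) G) \<le> draws W n s g h"
  using assms(4,6,7)
proof (induction n arbitrary: s h)
  case 0
  then show ?case using g by simp
next
  case (Suc n)
  have int: "integrable (future W (Suc (n + n')) s h) G"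
    using integrable_future_bound[OF Suc.prems(2) _ _ G(1), of "Suc (n + n')" \<Psi>] G(2) Suc.prems assms(5) by simp
  have "AE y in W s h. integrable (future W (n + n') (Suc s) (h(s := y))) \<Psi>"
    using future_Suc_integral(1)[OF Suc.prems(2)] Suc.prems(3) by simp
  then have "AE y in W s h. ennreal (integral\<^sup>L (future W (n + n') (Suc s) (h(s := y))) G)
      \<le> draws W n (Suc s) g (h(s := y))"
    by eventually_elim (rule Suc.IH[OF _ hist_space_update[OF Suc.prems(2)]], use Suc.prems(1) in simp)
  then have "(\<integral>\<^sup>+y. ennreal (integral\<^sup>L (future W (n + n') (Suc s) (h(s := y))) G) \<partial>W s h)
      \<le> draws W (Suc n) s g h"
    by (simp add: nn_integral_mono_AE)
  with future_Suc_integral(2)[OF Suc.prems(2) int] show ?case by simp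
qed

text \<open>Weak duality with \<open>c\<close> as a multiplier for the restriction on what controls
  may know: \<open>\<nu> \<tau>\<close> is fixed once \<open>u \<tau>\<close> is chosen and
  \<open>w\<close> is revealed up to \<open>\<tau> + k - 1\<close>, and from there
  \<open>c \<tau>\<close> has mean zero. The induction keeps the terms below \<open>t\<close>, whose
  \<open>\<nu>\<close> is already fixed but whose \<open>c\<close> may still be random.\<close>

lemma min_exp_lower:
  fixes G \<Psi> :: "(nat \<Rightarrow> real^'n) \<Rightarrow> real" and c :: "nat \<Rightarrow> (nat \<Rightarrow> real^'n) \<Rightarrow> real^'d"
    and \<nu> :: "nat \<Rightarrow> (nat \<Rightarrow> real^'d) \<Rightarrow> (nat \<Rightarrow> real^'n) \<Rightarrow> real^'d"
  assumes J: "\<And>u h. h \<in> space (hist_space T) \<Longrightarrow> G h + (\<Sum>\<tau><T - k. \<nu> \<tau> u h \<bullet> c \<tau> h) \<le> J u h"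
    and \<nu>: "\<And>\<tau> u u' h h'. (\<And>i. i \<le> \<tau> \<Longrightarrow> u i = u' i) \<Longrightarrow> (\<And>i. i < \<tau> + k \<Longrightarrow> h i = h' i) \<Longrightarrow> \<nu> \<tau> u h = \<nu> \<tau> u' h'"
    and G: "G \<in> borel_measurable (hist_space T)" "\<And>x. x \<in> space (hist_space T) \<Longrightarrow> \<bar>G x\<bar> \<le> \<Psi> x"
    and c: "\<And>\<tau>. c \<tau> \<in> borel_measurable (hist_space T)"
      "\<And>\<tau> x. x \<in> space (hist_space T) \<Longrightarrow> \<tau> < T - k \<Longrightarrow> norm (c \<tau> x) \<le> \<Psi> x"
    and mean_zero: "\<And>\<tau> h. \<tau> < T - k \<Longrightarrow> h \<in> space (hist_space (\<tau> + k))
      \<Longrightarrow> integrable (future W (T - (\<tau> + k)) (\<tau> + k) h) \<Psi> \<Longrightarrow> (\<integral>x. c \<tau> x \<partial>future W (T - (\<tau> + k)) (\<tau> + k) h) = 0"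
    and "t + k + n = T" and "h \<in> space (hist_space (t + k))" and "integrable (future W n (t + k) h) \<Psi>"
  shows "ennreal (\<integral>x. G x + (\<Sum>\<tau><t. \<nu> \<tau> u h \<bullet> c \<tau> x) \<partial>future W n (t + k) h) \<le> min_exp W k J n t u h"
  using assms(8-10)
proof (induction n arbitrary: t u h)
  case 0
  then have t: "t = T - k" "t + k = T" by auto
  have le: "ennreal (G h + (\<Sum>\<tau><t. \<nu> \<tau> u h \<bullet> c \<tau> h)) \<le> ennreal (J u' h)" if "\<forall>i<t. u' i = u i" for u'
  proof (rule ennreal_leI)
    have "(\<Sum>\<tau><t. \<nu> \<tau> u h \<bullet> c \<tau> h) = (\<Sum>\<tau><t. \<nu> \<tau> u' h \<bullet> c \<tau> h)"
      using that by (intro sum.cong refl arg_cong[where f = "\<lambda>v. v \<bullet> _"] \<nu>) auto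
    with J[of h u'] 0 t show "G h + (\<Sum>\<tau><t. \<nu> \<tau> u h \<bullet> c \<tau> h) \<le> J u' h" by simp
  qed
  have eq: "(\<integral>x. G x + (\<Sum>\<tau><t. \<nu> \<tau> u h \<bullet> c \<tau> x) \<partial>future W 0 (t + k) h) = G h + (\<Sum>\<tau><t. \<nu> \<tau> u h \<bullet> c \<tau> h)"
    unfolding future.simps using 0(2) G(1) c(1) by (subst integral_return) (auto simp: t(2))
  show ?case unfolding min_exp.simps eq by (rule INF_greatest) (use le in auto)
next
  case (Suc n)
  let ?\<mu> = "future W (Suc n) (t + k) h"
  have T: "T - (t + k) = Suc n" and tk: "t < T - k" using Suc.prems(1) by auto
  have intG: "integrable ?\<mu> G"
    using integrable_future_bound[OF Suc.prems(2,1,3) G(1)] G(2) by simp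
  have intc: "integrable ?\<mu> (c \<tau>)" if "\<tau> \<le> t" for \<tau>
    using integrable_future_bound[OF Suc.prems(2,1,3) c(1)] c(2)[of _ \<tau>] tk that by simp
  have "ennreal (\<integral>x. G x + (\<Sum>\<tau><t. \<nu> \<tau> u h \<bullet> c \<tau> x) \<partial>?\<mu>)
      \<le> (\<integral>\<^sup>+y. min_exp W k J n (Suc t) (u(t := v)) (h(t + k := y)) \<partial>W (t + k) h)" for v
  proof -
    define \<Phi> where "\<Phi> x = G x + (\<Sum>\<tau><Suc t. \<nu> \<tau> (u(t := v)) h \<bullet> c \<tau> x)" for x
    have int\<Phi>: "integrable ?\<mu> \<Phi>"
      unfolding \<Phi>_def by (intro Bochner_Integration.integrable_add intG Bochner_Integration.integrable_sum
        integrable_inner_right intc) auto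
    \<comment> \<open>Adding the term with index \<open>t\<close> leaves the integral unchanged
      whatever \<open>v\<close> is, so one bound serves all \<open>v\<close>.\<close>
    have "(\<integral>x. \<Phi> x \<partial>?\<mu>) = (\<integral>x. G x + (\<Sum>\<tau><t. \<nu> \<tau> u h \<bullet> c \<tau> x) \<partial>?\<mu>) + \<nu> t (u(t := v)) h \<bullet> (\<integral>x. c t x \<partial>?\<mu>)"
    proof -
      have "\<nu> \<tau> (u(t := v)) h = \<nu> \<tau> u h" if "\<tau> < t" for \<tau>
        using that by (intro \<nu>) auto
      then have "\<Phi> = (\<lambda>x. (G x + (\<Sum>\<tau><t. \<nu> \<tau> u h \<bullet> c \<tau> x)) + \<nu> t (u(t := v)) h \<bullet> c t x)"
        by (auto simp: \<Phi>_def)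
      moreover have "integrable ?\<mu> (\<lambda>x. G x + (\<Sum>\<tau><t. \<nu> \<tau> u h \<bullet> c \<tau> x))"
        by (intro Bochner_Integration.integrable_add intG Bochner_Integration.integrable_sum
          integrable_inner_right intc) auto
      ultimately show ?thesis using intc[of t] by (simp del: future.simps)
    qed
    also have "(\<integral>x. c t x \<partial>?\<mu>) = 0"
      using mean_zero[OF tk Suc.prems(2)] Suc.prems(3) unfolding T by simp
    finally have eq: "(\<integral>x. G x + (\<Sum>\<tau><t. \<nu> \<tau> u h \<bullet> c \<tau> x) \<partial>?\<mu>) = integral\<^sup>L ?\<mu> \<Phi>" by simp
    have "AE y in W (t + k) h. integrable (future W n (Suc (t + k)) (h(t + k := y))) \<Psi>"
      by (rule future_Suc_integral(1)[OF Suc.prems(2,3)])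
    then have "AE y in W (t + k) h. ennreal (integral\<^sup>L (future W n (Suc (t + k)) (h(t + k := y))) \<Phi>)
        \<le> min_exp W k J n (Suc t) (u(t := v)) (h(t + k := y))"
    proof eventually_elim
      case (elim y)
      \<comment> \<open>Revealing \<open>w\<close> at index \<open>t + k\<close> does not affect
        \<open>\<nu> \<tau>\<close> for \<open>\<tau> \<le> t\<close>, which reads only indices
        below \<open>\<tau> + k\<close>.\<close>
      have "\<nu> \<tau> (u(t := v)) h = \<nu> \<tau> (u(t := v)) (h(t + k := y))" if "\<tau> < Suc t" for \<tau>
        using that by (intro \<nu>) auto
      then have "\<Phi> = (\<lambda>x. G x + (\<Sum>\<tau><Suc t. \<nu> \<tau> (u(t := v)) (h(t + k := y)) \<bullet> c \<tau> x))"
        by (auto simp: \<Phi>_def)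
      then show ?case
        using Suc.IH[of "Suc t" "h(t + k := y)" "u(t := v)"] hist_space_update[OF Suc.prems(2), of y] elim Suc.prems(1)
        by (simp del: fun_upd_apply)
    qed
    then have "(\<integral>\<^sup>+y. ennreal (integral\<^sup>L (future W n (Suc (t + k)) (h(t + k := y))) \<Phi>) \<partial>W (t + k) h)
        \<le> (\<integral>\<^sup>+y. min_exp W k J n (Suc t) (u(t := v)) (h(t + k := y)) \<partial>W (t + k) h)"
      by (rule nn_integral_mono_AE)
    with future_Suc_integral(2)[OF Suc.prems(2) int\<Phi>] show ?thesis unfolding eq by (rule order_trans)
  qed
  then show ?case unfolding min_exp.simps by (rule INF_greatest)
qed

lemma draws_upper:
  assumes g: "\<And>h. h \<in> space (hist_space s') \<Longrightarrow> g h \<le> (\<integral>\<^sup>+x. f x \<partial>future W n' s' h)"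
    and f: "f \<in> borel_measurable (hist_space (s' + n'))"
    and "s + n = s'" and "h \<in> space (hist_space s)"
  shows "draws W n s g h \<le> (\<integral>\<^sup>+x. f x \<partial>future W (n + n') s h)"
  using assms(3,4)
proof (induction n arbitrary: s h)
  case 0
  then show ?case using g by simp
next
  case (Suc n)
  have "draws W (Suc n) s g h \<le> (\<integral>\<^sup>+y. \<integral>\<^sup>+x. f x \<partial>future W (n + n') (Suc s) (h(s := y)) \<partial>W s h)"
    unfolding draws.simps
    by (intro nn_integral_mono Suc.IH hist_space_update[OF Suc.prems(2)]) (use Suc.prems(1) in simp)
  also have "\<dots> = (\<integral>\<^sup>+x. f x \<partial>future W (Suc (n + n')) s h)"
  proof (rule future_Suc_nn_integral[symmetric, OF Suc.prems(2)])
    have "s' + n' = s + Suc (n + n')" using Suc.prems(1) by simp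
    with f show "f \<in> borel_measurable (hist_space (s + Suc (n + n')))" by (simp only:)
  qed
  finally show ?case by simp
qed

text \<open>Each minimum is at most the value at the control of \<open>\<pi>\<close>. In the last
  \<open>k\<close> steps \<open>\<pi>\<close> still looks \<open>k\<close> steps ahead, beyond the
  horizon; therefore the history is drawn up to \<open>T + k\<close> although \<open>J\<close> reads
  it only up to \<open>T\<close>.\<close>

lemma min_exp_upper:
  fixes \<pi> :: "nat \<Rightarrow> (nat \<Rightarrow> real^'n) \<Rightarrow> real^'d"
  assumes \<pi>: "\<And>i h h'. (\<And>j. j < i + k \<Longrightarrow> h j = h' j) \<Longrightarrow> \<pi> i h = \<pi> i h'"
    and J: "\<And>u h h'. (\<And>j. j < T \<Longrightarrow> h j = h' j) \<Longrightarrow> J u h = J u h'"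
    and meas: "(\<lambda>h. J (\<lambda>i. \<pi> i h) h) \<in> borel_measurable (hist_space (T + k))"
    and "t + k + n = T" and "h \<in> space (hist_space (t + k))" and "\<forall>i<t. u i = \<pi> i h"
  shows "min_exp W k J n t u h \<le> (\<integral>\<^sup>+x. ennreal (J (\<lambda>i. \<pi> i x) x) \<partial>future W (n + k) (t + k) h)"
  using assms(4-6)
proof (induction n arbitrary: t u h)
  case 0
  then have t: "t + k = T" by simp
  have "AE x in future W k T h. \<forall>i<T. x i = h i" using 0 t by (intro future_extends) auto
  \<comment> \<open>The final minimum sees only \<open>w\<close> before \<open>T\<close>, yet it
    lies below \<open>J\<close> at the controls belonging to any continuation \<open>x\<close>, and
    hence below their average.\<close>
  then have "AE x in future W k T h. min_exp W k J 0 t u h \<le> ennreal (J (\<lambda>i. \<pi> i x) x)"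
  proof eventually_elim
    case (elim x)
    have "\<pi> i x = u i" if "i < t" for i
      using that 0(3) elim t \<pi>[of i x h] by auto
    then have "min_exp W k J 0 t u h \<le> ennreal (J (\<lambda>i. \<pi> i x) h)"
      unfolding min_exp.simps by (intro INF_lower) auto
    also have "J (\<lambda>i. \<pi> i x) h = J (\<lambda>i. \<pi> i x) x" using elim by (intro J) auto
    finally show ?case .
  qed
  then have "(\<integral>\<^sup>+x. min_exp W k J 0 t u h \<partial>future W k T h) \<le> (\<integral>\<^sup>+x. ennreal (J (\<lambda>i. \<pi> i x) x) \<partial>future W k T h)"
    by (rule nn_integral_mono_AE)
  moreover have "emeasure (future W k T h) (space (future W k T h)) = 1"
    using prob_space_future[of h T k] 0 t by (simp add: prob_space.emeasure_space_1)
  ultimately show ?case by (simp add: t)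
next
  case (Suc n)
  have "min_exp W k J (Suc n) t u h
      \<le> (\<integral>\<^sup>+y. min_exp W k J n (Suc t) (u(t := \<pi> t h)) (h(t + k := y)) \<partial>W (t + k) h)"
    unfolding min_exp.simps by (rule INF_lower) simp
  also have "\<dots> \<le> (\<integral>\<^sup>+y. \<integral>\<^sup>+x. ennreal (J (\<lambda>i. \<pi> i x) x) \<partial>future W (n + k) (Suc (t + k)) (h(t + k := y)) \<partial>W (t + k) h)"
  proof (intro nn_integral_mono)
    fix y
    have "(u(t := \<pi> t h)) i = \<pi> i (h(t + k := y))" if "i < Suc t" for i
    proof -
      have "\<pi> i h = \<pi> i (h(t + k := y))" using that by (intro \<pi>) auto
      then show ?thesis using that Suc.prems(3) by (cases "i = t") auto
    qed
    with Suc.IH[of "Suc t" "h(t + k := y)"] hist_space_update[OF Suc.prems(2), of y] Suc.prems(1)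
    show "min_exp W k J n (Suc t) (u(t := \<pi> t h)) (h(t + k := y))
        \<le> (\<integral>\<^sup>+x. ennreal (J (\<lambda>i. \<pi> i x) x) \<partial>future W (n + k) (Suc (t + k)) (h(t + k := y)))"
      by (simp del: fun_upd_apply)
  qed
  also have "\<dots> = (\<integral>\<^sup>+x. ennreal (J (\<lambda>i. \<pi> i x) x) \<partial>future W (Suc (n + k)) (t + k) h)"
  proof (rule future_Suc_nn_integral[symmetric, OF Suc.prems(2)])
    have "t + k + Suc (n + k) = T + k" using Suc.prems(1) by simp
    then show "(\<lambda>x. ennreal (J (\<lambda>i. \<pi> i x) x)) \<in> borel_measurable (hist_space (t + k + Suc (n + k)))"
      using meas by (simp only: measurable_compose[OF _ measurable_ennreal])
  qed
  finally show ?case by simp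
qed

end

section \<open>The kernels as conditional laws of the given process\<close>

locale disturbances = prob_space M + disturbance_kernels W
  for M :: "'a measure" and W :: "nat \<Rightarrow> (nat \<Rightarrow> real^'n) \<Rightarrow> (real^'n) measure" +
  fixes w :: "nat \<Rightarrow> 'a \<Rightarrow> real^'n"
  assumes w_measurable[measurable]: "\<And>t. w t \<in> borel_measurable M"
    and joint_law: "\<And>t X Y. X \<in> sets (hist_space t) \<Longrightarrow> Y \<in> sets borel \<Longrightarrow>
      emeasure M {\<omega>\<in>space M. hist w t \<omega> \<in> X \<and> w t \<omega> \<in> Y}
        = (\<integral>\<^sup>+\<omega>. indicator X (hist w t \<omega>) * emeasure (W t (hist w t \<omega>)) Y \<partial>M)"
begin

lemma measurable_hist[measurable]: "hist w s \<in> measurable M (hist_space s)"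
  unfolding hist_def by (rule measurable_restrict) auto

lemma hist_in_space: "hist w s \<omega> \<in> space (hist_space s)"
  by (auto simp: hist_def space_PiM)

lemma hist_Suc: "hist w (Suc s) \<omega> = (hist w s \<omega>)(s := w s \<omega>)"
  by (auto simp: hist_def)

lemma emeasure_distr_hist:
  assumes X: "X \<in> sets (hist_space s)"
  shows "emeasure (distr M (hist_space s) (hist w s)) X = (\<integral>\<^sup>+\<omega>. indicator X (hist w s \<omega>) \<partial>M)"
proof -
  have "emeasure (distr M (hist_space s) (hist w s)) X = (\<integral>\<^sup>+x. indicator X x \<partial>distr M (hist_space s) (hist w s))"
    using X by simp
  also have "\<dots> = (\<integral>\<^sup>+\<omega>. indicator X (hist w s \<omega>) \<partial>M)"
    using X by (intro nn_integral_distr measurable_hist) auto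
  finally show ?thesis .
qed

text \<open>\<open>joint_law\<close> fixes the law of history and next disturbance on rectangles
  only. Rectangles are a generator stable under intersection, so the measures agree and all
  nonnegative measurable functions can be integrated.\<close>

lemma nn_integral_hist_Suc:
  assumes f: "f \<in> borel_measurable (hist_space (Suc s))"
  shows "(\<integral>\<^sup>+\<omega>. f (hist w (Suc s) \<omega>) \<partial>M) = (\<integral>\<^sup>+\<omega>. \<integral>\<^sup>+y. f ((hist w s \<omega>)(s := y)) \<partial>W s (hist w s \<omega>) \<partial>M)"
proof -
  let ?X = "hist_space s :: (nat \<Rightarrow> real^'n) measure"
  \<comment> \<open>\<open>\<kappa> h\<close> is the law of the pair of the fixed \<open>h\<close>
    and the next disturbance; with \<open>h\<close> kept in the pair, both descriptions are measures
    on one product space.\<close>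
  define \<kappa> where "\<kappa> h = distr (W s h) (?X \<Otimes>\<^sub>M borel) (\<lambda>y. (h, y))" for h
  define D where "D = distr M ?X (hist w s)"
  define L where "L = distr M (?X \<Otimes>\<^sub>M borel) (\<lambda>\<omega>. (hist w s \<omega>, w s \<omega>))"
  have D: "space D \<noteq> {}" by (simp add: D_def)
  have \<kappa>: "\<kappa> \<in> measurable D (subprob_algebra (?X \<Otimes>\<^sub>M borel))"
    unfolding \<kappa>_def D_def measurable_distr_eq1
    by (rule measurable_distr2[OF _ measurable_prob_algebraD[OF W]]) simp
  have setsW: "sets (W s h) = sets borel" if "h \<in> space ?X" for h
    using sets_kernel[OF measurable_prob_algebraD[OF W] that] .
  have pair: "Pair h \<in> measurable (W s h) (?X \<Otimes>\<^sub>M borel)" if "h \<in> space ?X" for h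
    using that by (simp add: measurable_cong_sets[OF setsW refl])
  have sets\<kappa>: "sets (D \<bind> \<kappa>) = sets (?X \<Otimes>\<^sub>M borel)"
    by (rule sets_bind[OF sets_kernel[OF \<kappa>] D]) auto
  have "L = D \<bind> \<kappa>"
  proof (rule measure_eqI_generator_eq[OF Int_stable_pair_measure_generator pair_measure_closed])
    fix Z assume "Z \<in> {a \<times> b |a b. a \<in> sets ?X \<and> b \<in> sets (borel :: (real^'n) measure)}"
    then obtain X Y where Z: "Z = X \<times> Y" and X[measurable]: "X \<in> sets ?X" and Y[measurable]: "Y \<in> sets borel"
      by auto
    have "emeasure L Z = emeasure M {\<omega>\<in>space M. hist w s \<omega> \<in> X \<and> w s \<omega> \<in> Y}"
      unfolding L_def Z by (subst emeasure_distr) (auto intro!: arg_cong[where f = "emeasure M"])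
    also have "\<dots> = (\<integral>\<^sup>+\<omega>. indicator X (hist w s \<omega>) * emeasure (W s (hist w s \<omega>)) Y \<partial>M)"
      by (rule joint_law[OF X Y])
    also have "\<dots> = (\<integral>\<^sup>+h. indicator X h * emeasure (W s h) Y \<partial>D)"
      unfolding D_def using measurable_emeasure_kernel[OF measurable_prob_algebraD[OF W] Y]
      by (subst nn_integral_distr) auto
    also have "\<dots> = (\<integral>\<^sup>+h. emeasure (\<kappa> h) Z \<partial>D)"
    proof (rule nn_integral_cong)
      fix h assume "h \<in> space D"
      then have h: "h \<in> space ?X" by (simp add: D_def)
      have "space (W s h) = UNIV" using sets_eq_imp_space_eq[OF setsW[OF h]] by simp
      then have "Pair h -` (X \<times> Y) \<inter> space (W s h) = (if h \<in> X then Y else {})" by auto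
      then show "indicator X h * emeasure (W s h) Y = emeasure (\<kappa> h) Z"
        unfolding \<kappa>_def Z by (subst emeasure_distr[OF pair[OF h]]) auto
    qed
    also have "\<dots> = emeasure (D \<bind> \<kappa>) Z"
      by (rule emeasure_bind[OF D \<kappa>, symmetric]) (simp add: Z)
    finally show "emeasure L Z = emeasure (D \<bind> \<kappa>) Z" .
  next
    show "sets L = sigma_sets (space ?X \<times> space borel) {a \<times> b |a b. a \<in> sets ?X \<and> b \<in> sets borel}"
      by (simp add: L_def sets_pair_measure)
    show "sets (D \<bind> \<kappa>) = sigma_sets (space ?X \<times> space borel) {a \<times> b |a b. a \<in> sets ?X \<and> b \<in> sets borel}"
      by (simp add: sets\<kappa> sets_pair_measure)
    show "range (\<lambda>_::nat. space ?X \<times> space (borel :: (real^'n) measure)) \<subseteq> {a \<times> b |a b. a \<in> sets ?X \<and> b \<in> sets borel}"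
      using sets.top[of ?X] sets.top[of "borel :: (real^'n) measure"] by blast
    have "prob_space L" unfolding L_def by (rule prob_space_distr) simp
    then interpret L: prob_space L .
    show "emeasure L (space ?X \<times> space borel) \<noteq> \<infinity>" by simp
  qed auto
  have g: "(\<lambda>x. f (case x of (h, y) \<Rightarrow> h(s := y))) \<in> borel_measurable (?X \<Otimes>\<^sub>M borel)"
    by (rule measurable_compose[OF measurable_hist_update f])
  have "(\<integral>\<^sup>+\<omega>. f (hist w (Suc s) \<omega>) \<partial>M) = (\<integral>\<^sup>+x. f (case x of (h, y) \<Rightarrow> h(s := y)) \<partial>L)"
    unfolding L_def using g by (subst nn_integral_distr) (auto simp: hist_Suc)
  also have "\<dots> = (\<integral>\<^sup>+h. \<integral>\<^sup>+x. f (case x of (h, y) \<Rightarrow> h(s := y)) \<partial>\<kappa> h \<partial>D)"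
    unfolding \<open>L = D \<bind> \<kappa>\<close> by (rule nn_integral_bind[OF g \<kappa>])
  also have "\<dots> = (\<integral>\<^sup>+\<omega>. \<integral>\<^sup>+x. f (case x of (h, y) \<Rightarrow> h(s := y)) \<partial>\<kappa> (hist w s \<omega>) \<partial>M)"
    unfolding D_def
    by (rule nn_integral_distr[OF measurable_hist])
      (use measurable_compose[OF \<kappa> nn_integral_measurable_subprob_algebra[OF g]] in \<open>simp add: D_def\<close>)
  also have "\<dots> = (\<integral>\<^sup>+\<omega>. \<integral>\<^sup>+y. f ((hist w s \<omega>)(s := y)) \<partial>W s (hist w s \<omega>) \<partial>M)"
    unfolding \<kappa>_def by (intro nn_integral_cong, subst nn_integral_distr_codomain[OF pair[OF hist_in_space] g]) simp
  finally show ?thesis .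
qed

lemma nn_integral_hist:
  assumes f: "f \<in> borel_measurable (hist_space (s + n))"
  shows "(\<integral>\<^sup>+\<omega>. f (hist w (s + n) \<omega>) \<partial>M) = (\<integral>\<^sup>+\<omega>. \<integral>\<^sup>+x. f x \<partial>future W n s (hist w s \<omega>) \<partial>M)"
  using f
proof (induction n arbitrary: s)
  case 0
  then show ?case using nn_integral_return[OF hist_in_space] by simp
next
  case (Suc n)
  have f: "f \<in> borel_measurable (hist_space (Suc s + n))" using Suc.prems by (simp only: add_Suc_shift)
  have "(\<integral>\<^sup>+\<omega>. f (hist w (s + Suc n) \<omega>) \<partial>M) = (\<integral>\<^sup>+\<omega>. \<integral>\<^sup>+x. f x \<partial>future W n (Suc s) (hist w (Suc s) \<omega>) \<partial>M)"
    using Suc.IH[OF f] by (simp only: add_Suc_shift)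
  also have "\<dots> = (\<integral>\<^sup>+\<omega>. \<integral>\<^sup>+y. \<integral>\<^sup>+x. f x \<partial>future W n (Suc s) ((hist w s \<omega>)(s := y)) \<partial>W s (hist w s \<omega>) \<partial>M)"
    by (rule nn_integral_hist_Suc)
      (rule measurable_compose[OF measurable_prob_algebraD[OF measurable_future] nn_integral_measurable_subprob_algebra[OF f]])
  also have "\<dots> = (\<integral>\<^sup>+\<omega>. \<integral>\<^sup>+x. f x \<partial>future W (Suc n) s (hist w s \<omega>) \<partial>M)"
    by (intro nn_integral_cong future_Suc_nn_integral[OF hist_in_space Suc.prems, symmetric])
  finally show ?case .
qed

text \<open>Casts the disintegration as an equality of measures, the form in which
  \<open>integral_bind_kernel\<close> applies to signed integrands.\<close>

lemma distr_hist_eq_bind: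
  "distr M (hist_space (s + n)) (hist w (s + n)) = distr M (hist_space s) (hist w s) \<bind> future W n s"
proof -
  have ne: "space (distr M (hist_space s) (hist w s)) \<noteq> {}" using hist_in_space[of s undefined] by auto
  have K: "future W n s \<in> measurable (distr M (hist_space s) (hist w s)) (subprob_algebra (hist_space (s + n)))"
    unfolding measurable_distr_eq1 by (rule measurable_prob_algebraD[OF measurable_future])
  have sets: "sets (distr M (hist_space s) (hist w s) \<bind> future W n s) = sets (hist_space (s + n))"
    by (rule sets_bind[OF sets_kernel[OF K] ne]) auto
  show ?thesis
  proof (rule measure_eqI)
    fix X assume "X \<in> sets (distr M (hist_space (s + n)) (hist w (s + n)))"
    then have X[measurable]: "X \<in> sets (hist_space (s + n))" by simp
    have "emeasure (distr M (hist_space (s + n)) (hist w (s + n))) X = (\<integral>\<^sup>+\<omega>. indicator X (hist w (s + n) \<omega>) \<partial>M)"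
      by (rule emeasure_distr_hist[OF X])
    also have "\<dots> = (\<integral>\<^sup>+\<omega>. \<integral>\<^sup>+x. indicator X x \<partial>future W n s (hist w s \<omega>) \<partial>M)"
      by (rule nn_integral_hist) simp
    also have "\<dots> = (\<integral>\<^sup>+h. \<integral>\<^sup>+x. indicator X x \<partial>future W n s h \<partial>distr M (hist_space s) (hist w s))"
      by (rule sym, rule nn_integral_distr_codomain[OF measurable_hist],
          rule measurable_compose[OF measurable_prob_algebraD[OF measurable_future] nn_integral_measurable_subprob_algebra]) simp
    also have "\<dots> = (\<integral>\<^sup>+x. indicator X x \<partial>(distr M (hist_space s) (hist w s) \<bind> future W n s))"
      by (rule nn_integral_bind[OF _ K, symmetric]) simp
    also have "\<dots> = emeasure (distr M (hist_space s) (hist w s) \<bind> future W n s) X"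
      by (rule nn_integral_indicator) (simp add: sets)
    finally show "emeasure (distr M (hist_space (s + n)) (hist w (s + n))) X
        = emeasure (distr M (hist_space s) (hist w s) \<bind> future W n s) X" .
  qed (simp add: sets)
qed

lemma future_from_start: "future W T 0 (\<lambda>_. undefined) = distr M (hist_space T) (hist w T)"
proof (rule measure_eqI)
  have sp: "(\<lambda>_. undefined) \<in> space (hist_space 0 :: (nat \<Rightarrow> real^'n) measure)" by (simp add: space_PiM)
  show sets: "sets (future W T 0 (\<lambda>_. undefined)) = sets (distr M (hist_space T) (hist w T))"
    using sets_future[OF sp, of T] by simp
  \<comment> \<open>The empty history has one value, so conditioning on it yields the unconditional
    law.\<close>
  have h0: "hist w 0 \<omega> = (\<lambda>_. undefined)" for \<omega> by (auto simp: hist_def)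
  fix X assume "X \<in> sets (future W T 0 (\<lambda>_. undefined))"
  then have X[measurable]: "X \<in> sets (hist_space T)" using sets by simp
  have "emeasure (distr M (hist_space T) (hist w T)) X = (\<integral>\<^sup>+\<omega>. indicator X (hist w (0 + T) \<omega>) \<partial>M)"
    using emeasure_distr_hist[OF X] by simp
  also have "\<dots> = (\<integral>\<^sup>+\<omega>. \<integral>\<^sup>+x. indicator X x \<partial>future W T 0 (\<lambda>_. undefined) \<partial>M)"
    by (subst nn_integral_hist) (auto simp: h0)
  also have "\<dots> = emeasure (future W T 0 (\<lambda>_. undefined)) X"
    using \<open>X \<in> sets (future W T 0 _)\<close> by (simp add: emeasure_space_1)
  finally show "emeasure (future W T 0 (\<lambda>_. undefined)) X = emeasure (distr M (hist_space T) (hist w T)) X" ..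
qed

lemma subalgebra_past: "subalgebra M (past_algebra M w s)"
  unfolding subalgebra_def past_algebra_def
  by (auto simp: sets_vimage_algebra2 hist_in_space)

lemma measurable_hist_past: "hist w s \<in> measurable (past_algebra M w s) (hist_space s)"
  unfolding past_algebra_def by (rule measurable_vimage_algebra1) (auto simp: hist_in_space)

text \<open>Connects the conditional expectation, given up to null sets through a sigma-algebra,
  with an integral defined for every history. An event of the past is an event about the first
  \<open>s\<close> coordinates, so its indicator can be taken out of the integral against
  \<open>future\<close>.\<close>

lemma cond_exp_eq_future_mean:
  assumes j: "j < s + n" and int: "integrable M (w j)"
  shows "AE \<omega> in M. integrable (future W n s (hist w s \<omega>)) (\<lambda>x. x j) \<and>
    (\<chi> i. real_cond_exp M (past_algebra M w s) (\<lambda>\<omega>. w j \<omega> $ i) \<omega>) = (\<integral>x. x j \<partial>future W n s (hist w s \<omega>))"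
proof -
  interpret sub: finite_measure_subalgebra M "past_algebra M w s"
    by unfold_locales (rule subalgebra_past)
  let ?D = "distr M (hist_space s) (hist w s)"
  have ne: "space ?D \<noteq> {}" using hist_in_space[of s undefined] by auto
  have K: "future W n s \<in> measurable ?D (subprob_algebra (hist_space (s + n)))"
    unfolding measurable_distr_eq1 by (rule measurable_prob_algebraD[OF measurable_future])
  have comp[measurable]: "(\<lambda>x. x j) \<in> borel_measurable (hist_space (s + n) :: (nat \<Rightarrow> real^'n) measure)"
    using j by (intro measurable_component_singleton) auto
  have hj: "hist w (s + n) \<omega> j = w j \<omega>" for \<omega> using j by (simp add: hist_def)
  have main: "(AE \<omega> in M. integrable (future W n s (hist w s \<omega>)) f) \<and>
      integrable M (\<lambda>\<omega>. integral\<^sup>L (future W n s (hist w s \<omega>)) f) \<and>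
      (\<integral>\<omega>. f (hist w (s + n) \<omega>) \<partial>M) = (\<integral>\<omega>. integral\<^sup>L (future W n s (hist w s \<omega>)) f \<partial>M)"
    if f[measurable]: "f \<in> borel_measurable (hist_space (s + n))" and i: "integrable M (\<lambda>\<omega>. f (hist w (s + n) \<omega>))"
    for f :: "(nat \<Rightarrow> real^'n) \<Rightarrow> real"
  proof -
    have "integrable (?D \<bind> future W n s) f"
      unfolding distr_hist_eq_bind[symmetric] using i by (subst integrable_distr_eq) auto
    note b = integral_bind_kernel[OF K ne this]
    have m: "(\<lambda>h. integral\<^sup>L (future W n s h) f) \<in> borel_measurable (hist_space s)"
      by (rule measurable_compose[OF measurable_prob_algebraD[OF measurable_future] integral_measurable_subprob_algebra[OF f]])
    have "AE \<omega> in M. integrable (future W n s (hist w s \<omega>)) f"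
      by (rule AE_distrD[OF measurable_hist b(1)])
    moreover have "integrable M (\<lambda>\<omega>. integral\<^sup>L (future W n s (hist w s \<omega>)) f)"
      using b(2) m by (subst (asm) integrable_distr_eq) auto
    moreover have "(\<integral>\<omega>. f (hist w (s + n) \<omega>) \<partial>M) = (\<integral>\<omega>. integral\<^sup>L (future W n s (hist w s \<omega>)) f \<partial>M)"
      using b(3) unfolding distr_hist_eq_bind[symmetric] using m f by (simp add: integral_distr)
    ultimately show ?thesis by blast
  qed
  have eq: "AE \<omega> in M. real_cond_exp M (past_algebra M w s) (\<lambda>\<omega>. w j \<omega> $ i) \<omega>
      = (\<integral>x. x j $ i \<partial>future W n s (hist w s \<omega>))" for i
  proof (rule sub.real_cond_exp_charact)
    have [measurable]: "(\<lambda>x. x j $ i) \<in> borel_measurable (hist_space (s + n) :: (nat \<Rightarrow> real^'n) measure)"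
      by (rule measurable_compose[OF comp]) (intro borel_measurable_continuous_onI continuous_intros)
    show inti: "integrable M (\<lambda>\<omega>. w j \<omega> $ i)"
      by (rule integrable_bounded_linear[OF bounded_linear_vec_nth int])
    then show "integrable M (\<lambda>\<omega>. \<integral>x. x j $ i \<partial>future W n s (hist w s \<omega>))"
      using main[of "\<lambda>x. x j $ i"] by (simp add: hj)
    show "(\<lambda>\<omega>. \<integral>x. x j $ i \<partial>future W n s (hist w s \<omega>)) \<in> borel_measurable (past_algebra M w s)"
      by (rule measurable_compose[OF measurable_hist_past],
          rule measurable_compose[OF measurable_prob_algebraD[OF measurable_future] integral_measurable_subprob_algebra])
        measurable
    fix Z assume "Z \<in> sets (past_algebra M w s)"
    then obtain X where X[measurable]: "X \<in> sets (hist_space s)" and Z: "Z = hist w s -` X \<inter> space M"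
      unfolding past_algebra_def by (auto simp: sets_vimage_algebra2 hist_in_space)
    have rest[measurable]: "(\<lambda>x. restrict x {..<s}) \<in> measurable (hist_space (s + n)) (hist_space s)"
      by (rule measurable_restrict_subset) auto
    have restr: "restrict (hist w (s + n) \<omega>) {..<s} = hist w s \<omega>" for \<omega>
      by (auto simp: hist_def)
    \<comment> \<open>The indicator is read off the first \<open>s\<close> coordinates of the longer
      history, so that the whole integrand is a function of that history.\<close>
    define f where "f x = indicator X (restrict x {..<s}) * (x j $ i)" for x
    have f: "f \<in> borel_measurable (hist_space (s + n))" unfolding f_def by measurable
    have Zm[measurable]: "Z \<in> sets M" unfolding Z by (rule measurable_sets[OF measurable_hist X])
    have fh: "f (hist w (s + n) \<omega>) = indicator Z \<omega> * (w j \<omega> $ i)" if "\<omega> \<in> space M" for \<omega>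
      using that by (auto simp: f_def restr hj Z split: split_indicator)
    have "(\<integral>\<omega>\<in>Z. w j \<omega> $ i \<partial>M) = (\<integral>\<omega>. f (hist w (s + n) \<omega>) \<partial>M)"
      unfolding set_lebesgue_integral_def by (rule Bochner_Integration.integral_cong) (auto simp: fh)
    also have "\<dots> = (\<integral>\<omega>. integral\<^sup>L (future W n s (hist w s \<omega>)) f \<partial>M)"
    proof -
      have "integrable M (\<lambda>\<omega>. f (hist w (s + n) \<omega>))"
        by (subst Bochner_Integration.integrable_cong[OF refl fh]) (use integrable_mult_indicator[OF Zm inti] in auto)
      with main[OF f] show ?thesis by simp
    qed
    also have "\<dots> = (\<integral>\<omega>\<in>Z. (\<integral>x. x j $ i \<partial>future W n s (hist w s \<omega>)) \<partial>M)"
      unfolding set_lebesgue_integral_def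
    proof (rule Bochner_Integration.integral_cong[OF refl])
      fix \<omega> assume \<omega>: "\<omega> \<in> space M"
      let ?\<mu> = "future W n s (hist w s \<omega>)"
      have sets: "sets ?\<mu> = sets (hist_space (s + n))" by (rule sets_future[OF hist_in_space])
      have AE: "AE x in ?\<mu>. restrict x {..<s} = hist w s \<omega>"
        using future_extends[OF hist_in_space] by eventually_elim (auto simp: hist_def)
      have "integral\<^sup>L ?\<mu> f = (\<integral>x. indicator X (hist w s \<omega>) * (x j $ i) \<partial>?\<mu>)"
        by (rule integral_cong_AE) (use AE f in \<open>auto simp: measurable_cong_sets[OF sets refl] f_def elim!: eventually_mono\<close>)
      also have "\<dots> = indicator Z \<omega> * (\<integral>x. x j $ i \<partial>?\<mu>)"
        using \<omega> by (simp add: Z indicator_def)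
      finally show "integral\<^sup>L ?\<mu> f = indicator Z \<omega> *\<^sub>R (\<integral>x. x j $ i \<partial>?\<mu>)" by simp
    qed
    finally show "(\<integral>\<omega>\<in>Z. w j \<omega> $ i \<partial>M) = (\<integral>\<omega>\<in>Z. (\<integral>x. x j $ i \<partial>future W n s (hist w s \<omega>)) \<partial>M)" .
  qed
  then have "AE \<omega> in M. \<forall>i. real_cond_exp M (past_algebra M w s) (\<lambda>\<omega>. w j \<omega> $ i) \<omega>
      = (\<integral>x. x j $ i \<partial>future W n s (hist w s \<omega>))"
    by (simp add: AE_all_countable)
  \<comment> \<open>Integrability of the norm lets the componentwise integrals be assembled into a
    vector-valued one.\<close>
  moreover have "AE \<omega> in M. integrable (future W n s (hist w s \<omega>)) (\<lambda>x. norm (x j))"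
    using main[of "\<lambda>x. norm (x j)"] int by (simp add: hj)
  ultimately show ?thesis
  proof eventually_elim
    case (elim \<omega>)
    have i: "integrable (future W n s (hist w s \<omega>)) (\<lambda>x. x j)"
      using elim(2) by (rule integrable_norm_cancel)
        (simp add: measurable_cong_sets[OF sets_future[OF hist_in_space] refl])
    have "(\<integral>x. x j $ k \<partial>future W n s (hist w s \<omega>)) = (\<integral>x. x j \<partial>future W n s (hist w s \<omega>)) $ k" for k
      by (rule integral_bounded_linear[OF bounded_linear_vec_nth i])
    with elim(1) i show ?case by (simp add: vec_eq_iff)
  qed
qed

end

section \<open>Square-integrable random vectors\<close>

text \<open>Measurability, integrability and the numerical bound travel together, so that bounds
  uniform in time can be chained.\<close>

definition L2_le :: "'a measure \<Rightarrow> ('a \<Rightarrow> 'b::euclidean_space) \<Rightarrow> real \<Rightarrow> bool" where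
  "L2_le M X b \<longleftrightarrow> X \<in> borel_measurable M \<and> integrable M (\<lambda>\<omega>. (norm (X \<omega>))\<^sup>2) \<and> (\<integral>\<omega>. (norm (X \<omega>))\<^sup>2 \<partial>M) \<le> b"

lemma L2_le_measurable: "L2_le M X b \<Longrightarrow> X \<in> borel_measurable M"
  by (simp add: L2_le_def)

lemma L2_le_nonneg: "L2_le M X b \<Longrightarrow> 0 \<le> b"
  unfolding L2_le_def by (meson Bochner_Integration.integral_nonneg order_trans zero_le_power2)

lemma L2_le_mono: "L2_le M X b \<Longrightarrow> b \<le> b' \<Longrightarrow> L2_le M X b'"
  by (auto simp: L2_le_def)

lemma L2_le_dominated:
  assumes "X \<in> borel_measurable M" and g: "integrable M g" "(\<integral>\<omega>. g \<omega> \<partial>M) \<le> b"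
    and le: "AE \<omega> in M. (norm (X \<omega>))\<^sup>2 \<le> g \<omega>"
  shows "L2_le M X b"
proof -
  have [measurable]: "X \<in> borel_measurable M" by fact
  have int: "integrable M (\<lambda>\<omega>. (norm (X \<omega>))\<^sup>2)"
    by (rule Bochner_Integration.integrable_bound[OF g(1)]) (use le in \<open>auto elim!: eventually_mono\<close>)
  moreover have "(\<integral>\<omega>. (norm (X \<omega>))\<^sup>2 \<partial>M) \<le> (\<integral>\<omega>. g \<omega> \<partial>M)"
    by (rule integral_mono_AE[OF int g(1) le])
  ultimately show ?thesis using g(2) by (simp add: L2_le_def)
qed

lemma L2_le_cong_AE:
  assumes "L2_le M Y b" and "X \<in> borel_measurable M" and "AE \<omega> in M. X \<omega> = Y \<omega>"
  shows "L2_le M X b"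
  by (rule L2_le_dominated[where g = "\<lambda>\<omega>. (norm (Y \<omega>))\<^sup>2"]) (use assms in \<open>auto simp: L2_le_def elim!: eventually_mono\<close>)

lemma L2_le_add:
  assumes X: "L2_le M X a" and Y: "L2_le M Y b"
  shows "L2_le M (\<lambda>\<omega>. X \<omega> + Y \<omega>) (2 * a + 2 * b)"
proof (rule L2_le_dominated[where g = "\<lambda>\<omega>. 2 * (norm (X \<omega>))\<^sup>2 + 2 * (norm (Y \<omega>))\<^sup>2"])
  show "(\<lambda>\<omega>. X \<omega> + Y \<omega>) \<in> borel_measurable M" using X Y by (auto simp: L2_le_def)
  show "integrable M (\<lambda>\<omega>. 2 * (norm (X \<omega>))\<^sup>2 + 2 * (norm (Y \<omega>))\<^sup>2)"
    "(\<integral>\<omega>. 2 * (norm (X \<omega>))\<^sup>2 + 2 * (norm (Y \<omega>))\<^sup>2 \<partial>M) \<le> 2 * a + 2 * b"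
    using X Y by (auto simp: L2_le_def)
qed (simp add: power2_norm_add_le)

lemma L2_le_minus: "L2_le M X a \<Longrightarrow> L2_le M (\<lambda>\<omega>. - X \<omega>) a"
  by (auto simp: L2_le_def)

lemma L2_le_diff:
  assumes "L2_le M X a" and "L2_le M Y b"
  shows "L2_le M (\<lambda>\<omega>. X \<omega> - Y \<omega>) (2 * a + 2 * b)"
  using L2_le_add[OF assms(1) L2_le_minus[OF assms(2)]] by simp

lemma borel_measurable_matrix_vector[measurable (raw)]:
  fixes G :: "real^'n^'m"
  assumes "X \<in> borel_measurable M"
  shows "(\<lambda>\<omega>. G *v X \<omega>) \<in> borel_measurable M"
  using assms by (rule measurable_compose) (intro borel_measurable_continuous_onI matrix_vector_mult_linear_continuous_on)

lemma L2_le_bounded_image: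
  assumes X: "L2_le M X b" and "Y \<in> borel_measurable M" and "\<And>\<omega>. norm (Y \<omega>) \<le> c * norm (X \<omega>)" and "0 \<le> c"
  shows "L2_le M Y (c\<^sup>2 * b)"
proof (rule L2_le_dominated[where g = "\<lambda>\<omega>. c\<^sup>2 * (norm (X \<omega>))\<^sup>2"])
  show "AE \<omega> in M. (norm (Y \<omega>))\<^sup>2 \<le> c\<^sup>2 * (norm (X \<omega>))\<^sup>2"
    unfolding power_mult_distrib[symmetric] using assms(3) by (intro AE_I2 power_mono) auto
qed (use assms in \<open>auto simp: L2_le_def mult_left_mono\<close>)

lemma L2_le_matrix:
  fixes G :: "real^'n^'m"
  assumes "L2_le M X b"
  shows "L2_le M (\<lambda>\<omega>. G *v X \<omega>) ((spectral_norm G)\<^sup>2 * b)"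
  by (rule L2_le_bounded_image[OF assms])
    (use L2_le_measurable[OF assms] in \<open>auto simp: norm_matrix_vector spectral_norm_nonneg\<close>)

lemma (in prob_space) L2_le_const: "L2_le M (\<lambda>_. c) ((norm c)\<^sup>2)"
  by (simp add: L2_le_def prob_space)

lemma (in prob_space) integrable_norm_L2:
  assumes "L2_le M X b"
  shows "integrable M (\<lambda>\<omega>. norm (X \<omega>))"
proof (rule Bochner_Integration.integrable_bound[where f = "\<lambda>\<omega>. 1 + (norm (X \<omega>))\<^sup>2"])
  show "AE \<omega> in M. norm (norm (X \<omega>)) \<le> norm (1 + (norm (X \<omega>))\<^sup>2)"
  proof (rule AE_I2)
    fix \<omega>
    have "0 \<le> (norm (X \<omega>) - 1)\<^sup>2 + (norm (X \<omega>))\<^sup>2 + 1" by simp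
    then show "norm (norm (X \<omega>)) \<le> norm (1 + (norm (X \<omega>))\<^sup>2)" by (simp add: power2_eq_square algebra_simps)
  qed
qed (use assms in \<open>auto simp: L2_le_def\<close>)

lemma (in prob_space) integrable_L2: "L2_le M X b \<Longrightarrow> integrable M X"
  using integrable_norm_L2 L2_le_measurable integrable_norm_cancel by blast

lemma two_mult_le_squares: "2 * (a * b) \<le> a\<^sup>2 + (b::real)\<^sup>2"
  using zero_le_power2[of "a - b"] by (simp add: power2_eq_square algebra_simps)

lemma L2_le_inner:
  fixes X Y :: "'a \<Rightarrow> 'b::euclidean_space"
  assumes X: "L2_le M X a" and Y: "L2_le M Y b"
  shows "integrable M (\<lambda>\<omega>. X \<omega> \<bullet> Y \<omega>)" and "(\<integral>\<omega>. \<bar>X \<omega> \<bullet> Y \<omega>\<bar> \<partial>M) \<le> a + b"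
proof -
  have [measurable]: "X \<in> borel_measurable M" "Y \<in> borel_measurable M" using X Y by (auto simp: L2_le_def)
  have le: "\<bar>X \<omega> \<bullet> Y \<omega>\<bar> \<le> (norm (X \<omega>))\<^sup>2 + (norm (Y \<omega>))\<^sup>2" for \<omega>
    using Cauchy_Schwarz_ineq2[of "X \<omega>" "Y \<omega>"] two_mult_le_squares[of "norm (X \<omega>)" "norm (Y \<omega>)"]
    by (smt (verit) mult_nonneg_nonneg norm_ge_zero)
  have int: "integrable M (\<lambda>\<omega>. (norm (X \<omega>))\<^sup>2 + (norm (Y \<omega>))\<^sup>2)" using X Y by (auto simp: L2_le_def)
  show i: "integrable M (\<lambda>\<omega>. X \<omega> \<bullet> Y \<omega>)"
    by (rule Bochner_Integration.integrable_bound[OF int]) (use le in \<open>auto intro!: AE_I2\<close>)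
  have "(\<integral>\<omega>. \<bar>X \<omega> \<bullet> Y \<omega>\<bar> \<partial>M) \<le> (\<integral>\<omega>. (norm (X \<omega>))\<^sup>2 + (norm (Y \<omega>))\<^sup>2 \<partial>M)"
    using i by (intro integral_mono int le) auto
  also have "\<dots> \<le> a + b" using X Y by (auto simp: L2_le_def)
  finally show "(\<integral>\<omega>. \<bar>X \<omega> \<bullet> Y \<omega>\<bar> \<partial>M) \<le> a + b" .
qed

lemma integral_le_integral_abs:
  fixes f :: "'a \<Rightarrow> real"
  shows "integrable M f \<Longrightarrow> \<bar>\<integral>\<omega>. f \<omega> \<partial>M\<bar> \<le> (\<integral>\<omega>. \<bar>f \<omega>\<bar> \<partial>M)"
  using integral_norm_bound[of M f] by simp

text \<open>Cauchy-Schwarz after splitting each weight into two square roots; one of the factors is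
  a geometric sum.\<close>

lemma weighted_sum_square_le:
  fixes a :: "nat \<Rightarrow> real"
  assumes "0 < r" "r < 1"
  shows "(\<Sum>i<n. r ^ i * a i)\<^sup>2 \<le> 1 / (1 - r) * (\<Sum>i<n. r ^ i * (a i)\<^sup>2)"
proof -
  have "(\<Sum>i<n. r ^ i * a i)\<^sup>2 = (\<Sum>i<n. sqrt (r ^ i) * (sqrt (r ^ i) * a i))\<^sup>2"
    using assms by (simp add: mult.assoc[symmetric])
  also have "\<dots> \<le> (\<Sum>i<n. (sqrt (r ^ i))\<^sup>2) * (\<Sum>i<n. (sqrt (r ^ i) * a i)\<^sup>2)"
    by (rule Cauchy_Schwarz_ineq_sum)
  also have "\<dots> = (\<Sum>i<n. r ^ i) * (\<Sum>i<n. r ^ i * (a i)\<^sup>2)"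
    using assms by (simp add: power_mult_distrib)
  also have "\<dots> \<le> 1 / (1 - r) * (\<Sum>i<n. r ^ i * (a i)\<^sup>2)"
  proof (rule mult_right_mono)
    have "(\<Sum>i<n. r ^ i) \<le> (\<Sum>i. r ^ i)"
      using assms by (intro sum_le_suminf summable_geometric) auto
    then show "(\<Sum>i<n. r ^ i) \<le> 1 / (1 - r)" using assms by (simp add: suminf_geometric)
  qed (use assms in \<open>auto intro!: sum_nonneg\<close>)
  finally show ?thesis .
qed

text \<open>Geometric weights turn a uniform bound in mean square into almost sure convergence: the
  weighted squares have summable expectations, and wherever their sum is finite the series converges
  absolutely.\<close>

lemma L2_le_suminf:
  fixes G :: "nat \<Rightarrow> real^'n^'m" and v :: "nat \<Rightarrow> 'a \<Rightarrow> real^'n"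
  assumes v: "\<And>i. L2_le M (v i) b"
    and G: "\<And>i x. norm (G i *v x) \<le> D * r ^ i * norm x" and "0 \<le> D" and r: "0 < r" "r < 1"
  shows "AE \<omega> in M. summable (\<lambda>i. G i *v v i \<omega>)"
    and "L2_le M (\<lambda>\<omega>. \<Sum>i. G i *v v i \<omega>) ((D / (1 - r))\<^sup>2 * b)"
proof -
  have [measurable]: "v i \<in> borel_measurable M" for i using v by (simp add: L2_le_def)
  define q where "q i \<omega> = r ^ i * (norm (v i \<omega>))\<^sup>2" for i \<omega>
  have q0: "0 \<le> q i \<omega>" for i \<omega> using r by (simp add: q_def)
  have qi: "integrable M (q i)" "(\<integral>\<omega>. q i \<omega> \<partial>M) \<le> r ^ i * b" for i
    using v[of i] r by (auto simp: q_def[abs_def] L2_le_def intro!: mult_left_mono)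
  have b: "0 \<le> b" using L2_le_nonneg[OF v[of 0]] .
  have geo: "summable (\<lambda>i. r ^ i * b)" using r by (intro summable_mult2 summable_geometric) auto
  have Eq: "(\<integral>\<^sup>+\<omega>. (\<Sum>i. ennreal (q i \<omega>)) \<partial>M) \<le> ennreal (b / (1 - r))"
  proof -
    have "(\<integral>\<^sup>+\<omega>. (\<Sum>i. ennreal (q i \<omega>)) \<partial>M) = (\<Sum>i. \<integral>\<^sup>+\<omega>. ennreal (q i \<omega>) \<partial>M)"
      unfolding q_def by (rule nn_integral_suminf) measurable
    also have "\<dots> \<le> (\<Sum>i. ennreal (r ^ i * b))"
      by (intro suminf_le summableI) (use qi q0 in \<open>simp add: nn_integral_eq_integral ennreal_leI\<close>)
    also have "\<dots> = ennreal (\<Sum>i. r ^ i * b)"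
      using r b geo by (intro suminf_ennreal2) auto
    also have "(\<Sum>i. r ^ i * b) = b / (1 - r)"
      using r by (subst suminf_mult2[symmetric]) (auto simp: suminf_geometric summable_geometric)
    finally show ?thesis .
  qed
  have "AE \<omega> in M. (\<Sum>i. ennreal (q i \<omega>)) \<noteq> \<infinity>"
    by (rule nn_integral_PInf_AE) (use Eq in \<open>auto simp: q_def top_unique\<close>)
  then have sq: "AE \<omega> in M. summable (\<lambda>i. q i \<omega>)"
    by eventually_elim (use q0 in \<open>auto intro: summable_suminf_not_top\<close>)
  have key: "summable (\<lambda>i. G i *v v i \<omega>) \<and> (norm (\<Sum>i. G i *v v i \<omega>))\<^sup>2 \<le> D\<^sup>2 / (1 - r) * (\<Sum>i. q i \<omega>)"
    if s: "summable (\<lambda>i. q i \<omega>)" for \<omega>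
  proof -
    have le: "norm (G i *v v i \<omega>) \<le> D * (r ^ i + q i \<omega>)" for i
    proof -
      \<comment> \<open>Reduces absolute convergence to convergence of the weighted squares.\<close>
      have "norm (v i \<omega>) \<le> 1 + (norm (v i \<omega>))\<^sup>2"
        using two_mult_le_squares[of 1 "norm (v i \<omega>)"] norm_ge_zero[of "v i \<omega>"]
        unfolding power_one mult_1 by linarith
      then have "D * (r ^ i * norm (v i \<omega>)) \<le> D * (r ^ i * (1 + (norm (v i \<omega>))\<^sup>2))"
        using r \<open>0 \<le> D\<close> by (intro mult_left_mono) auto
      with G[of i "v i \<omega>"] show ?thesis by (simp add: q_def algebra_simps)
    qed
    have "summable (\<lambda>i. D * (r ^ i + q i \<omega>))"
      using s r by (intro summable_mult summable_add summable_geometric) auto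
    then have sum: "summable (\<lambda>i. G i *v v i \<omega>)"
      by (rule summable_comparison_test') (rule le)
    have "(norm (\<Sum>i<n. G i *v v i \<omega>))\<^sup>2 \<le> D\<^sup>2 / (1 - r) * (\<Sum>i. q i \<omega>)" for n
    proof -
      have "norm (\<Sum>i<n. G i *v v i \<omega>) \<le> (\<Sum>i<n. D * (r ^ i * norm (v i \<omega>)))"
        by (rule sum_norm_le) (use G in \<open>simp add: mult.assoc\<close>)
      then have "(norm (\<Sum>i<n. G i *v v i \<omega>))\<^sup>2 \<le> (D * (\<Sum>i<n. r ^ i * norm (v i \<omega>)))\<^sup>2"
        by (intro power_mono) (auto simp: sum_distrib_left)
      also have "\<dots> \<le> D\<^sup>2 * (1 / (1 - r) * (\<Sum>i<n. q i \<omega>))"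
        unfolding power_mult_distrib q_def using weighted_sum_square_le[OF r] by (intro mult_left_mono) auto
      also have "\<dots> \<le> D\<^sup>2 * (1 / (1 - r) * (\<Sum>i. q i \<omega>))"
        using r q0 s by (intro mult_left_mono sum_le_suminf) auto
      finally show ?thesis by simp
    qed
    moreover have "(\<lambda>n. (norm (\<Sum>i<n. G i *v v i \<omega>))\<^sup>2) \<longlonglongrightarrow> (norm (\<Sum>i. G i *v v i \<omega>))\<^sup>2"
      by (intro tendsto_power tendsto_norm summable_LIMSEQ sum)
    ultimately show ?thesis using sum by (auto intro: LIMSEQ_le_const2)
  qed
  show "AE \<omega> in M. summable (\<lambda>i. G i *v v i \<omega>)"
    using sq by eventually_elim (use key in blast)
  have nn: "(\<integral>\<^sup>+\<omega>. ennreal (\<Sum>i. q i \<omega>) \<partial>M) = (\<integral>\<^sup>+\<omega>. (\<Sum>i. ennreal (q i \<omega>)) \<partial>M)"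
    by (rule nn_integral_cong_AE, use sq in eventually_elim) (use q0 in \<open>simp add: suminf_ennreal2\<close>)
  have pos: "AE \<omega> in M. 0 \<le> (\<Sum>i. q i \<omega>)"
    using sq by eventually_elim (use q0 in \<open>auto intro: suminf_nonneg\<close>)
  have meas: "(\<lambda>\<omega>. \<Sum>i. q i \<omega>) \<in> borel_measurable M" unfolding q_def by measurable
  have int: "integrable M (\<lambda>\<omega>. \<Sum>i. q i \<omega>)"
  proof (rule integrableI_nonneg[OF meas pos])
    show "(\<integral>\<^sup>+\<omega>. ennreal (\<Sum>i. q i \<omega>) \<partial>M) < \<infinity>" unfolding nn using Eq by (rule le_less_trans) simp
  qed
  have "(\<integral>\<omega>. (\<Sum>i. q i \<omega>) \<partial>M) \<le> b / (1 - r)"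
    using Eq b r unfolding nn[symmetric] nn_integral_eq_integral[OF int pos] by simp
  then have "(\<integral>\<omega>. D\<^sup>2 / (1 - r) * (\<Sum>i. q i \<omega>) \<partial>M) \<le> D\<^sup>2 / (1 - r) * (b / (1 - r))"
    using r by (simp only: integral_mult_right_zero) (intro mult_left_mono, auto)
  also have "\<dots> = (D / (1 - r))\<^sup>2 * b" using r by (simp add: power2_eq_square)
  finally show "L2_le M (\<lambda>\<omega>. \<Sum>i. G i *v v i \<omega>) ((D / (1 - r))\<^sup>2 * b)"
    using int sq key by (intro L2_le_dominated[where g = "\<lambda>\<omega>. D\<^sup>2 / (1 - r) * (\<Sum>i. q i \<omega>)"])
      (auto elim!: eventually_mono)
qed

lemma borel_measurable_vec_lambda:
  fixes f :: "'n::finite \<Rightarrow> 'a \<Rightarrow> real"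
  assumes "\<And>i. f i \<in> borel_measurable M"
  shows "(\<lambda>\<omega>. \<chi> i. f i \<omega>) \<in> borel_measurable M"
proof -
  have "(\<lambda>\<omega>. \<chi> i. f i \<omega>) = (\<lambda>\<omega>. \<Sum>i\<in>UNIV. f i \<omega> *\<^sub>R axis i 1)"
    by (auto simp: vec_eq_iff axis_def if_distrib[where f = "(*) _"] cong: if_cong)
  then show ?thesis using assms by simp
qed

text \<open>Conditional Jensen for the square in each coordinate. The squares of the coordinates add
  up to the squared norm, so the constant \<open>b\<close> is not enlarged.\<close>

lemma (in prob_space) L2_le_cond_exp:
  fixes X :: "'a \<Rightarrow> real^'n"
  assumes X: "L2_le M X b" and F: "subalgebra M F"
  shows "L2_le M (\<lambda>\<omega>. \<chi> i. real_cond_exp M F (\<lambda>\<omega>. X \<omega> $ i) \<omega>) b"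
proof -
  interpret sub: finite_measure_subalgebra M F by unfold_locales (rule F)
  have [measurable]: "X \<in> borel_measurable M" using X by (simp add: L2_le_def)
  have [measurable]: "(\<lambda>\<omega>. X \<omega> $ i) \<in> borel_measurable M" for i
    by (rule measurable_compose[of X]) (auto intro!: borel_measurable_continuous_onI continuous_intros)
  have i1: "integrable M (\<lambda>\<omega>. X \<omega> $ i)" for i
    by (rule integrable_bounded_linear[OF bounded_linear_vec_nth integrable_L2[OF X]])
  have i2: "integrable M (\<lambda>\<omega>. (X \<omega> $ i)\<^sup>2)" for i
  proof (rule Bochner_Integration.integrable_bound)
    show "integrable M (\<lambda>\<omega>. (norm (X \<omega>))\<^sup>2)" using X by (simp add: L2_le_def)
    show "AE \<omega> in M. norm ((X \<omega> $ i)\<^sup>2) \<le> norm ((norm (X \<omega>))\<^sup>2)"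
      using component_le_norm_cart[of "X _" i] by (auto simp: abs_le_square_iff[symmetric])
  qed measurable
  have norm_sq: "(norm (v :: real^'n))\<^sup>2 = (\<Sum>i\<in>UNIV. (v $ i)\<^sup>2)" for v
    by (simp add: norm_vec_def L2_set_def sum_nonneg)
  have "AE \<omega> in M. (real_cond_exp M F (\<lambda>\<omega>. X \<omega> $ i) \<omega>)\<^sup>2 \<le> real_cond_exp M F (\<lambda>\<omega>. (X \<omega> $ i)\<^sup>2) \<omega>" for i
    by (rule sub.real_cond_exp_jensens_inequality(2)[where I = UNIV])
      (use i1 i2 convex_power2 in auto)
  then have "AE \<omega> in M. \<forall>i\<in>UNIV. (real_cond_exp M F (\<lambda>\<omega>. X \<omega> $ i) \<omega>)\<^sup>2 \<le> real_cond_exp M F (\<lambda>\<omega>. (X \<omega> $ i)\<^sup>2) \<omega>"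
    by (subst AE_ball_countable) auto
  then have "AE \<omega> in M. (norm (\<chi> i. real_cond_exp M F (\<lambda>\<omega>. X \<omega> $ i) \<omega>))\<^sup>2
      \<le> (\<Sum>i\<in>UNIV. real_cond_exp M F (\<lambda>\<omega>. (X \<omega> $ i)\<^sup>2) \<omega>)"
    by eventually_elim (auto simp: norm_sq intro!: sum_mono)
  moreover have "integrable M (\<lambda>\<omega>. \<Sum>i\<in>UNIV. real_cond_exp M F (\<lambda>\<omega>. (X \<omega> $ i)\<^sup>2) \<omega>)"
    by (intro Bochner_Integration.integrable_sum sub.real_cond_exp_int i2)
  moreover have "(\<integral>\<omega>. (\<Sum>i\<in>UNIV. real_cond_exp M F (\<lambda>\<omega>. (X \<omega> $ i)\<^sup>2) \<omega>) \<partial>M) \<le> b"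
  proof -
    have "(\<integral>\<omega>. (\<Sum>i\<in>UNIV. real_cond_exp M F (\<lambda>\<omega>. (X \<omega> $ i)\<^sup>2) \<omega>) \<partial>M) = (\<integral>\<omega>. (\<Sum>i\<in>UNIV. (X \<omega> $ i)\<^sup>2) \<partial>M)"
      using i2 sub.real_cond_exp_int by (simp add: Bochner_Integration.integral_sum)
    also have "\<dots> \<le> b" using X by (simp add: L2_le_def norm_sq)
    finally show ?thesis .
  qed
  ultimately show ?thesis
    by (intro L2_le_dominated borel_measurable_vec_lambda borel_measurable_cond_exp2)
qed

section \<open>The predictive policy\<close>

lemma sum_lessThan_add: "(\<Sum>i<k + n. f i) = (\<Sum>i<k. f i) + (\<Sum>i<n. f (k + i :: nat) :: 'a::comm_monoid_add)"
  by (induction n) (auto simp: add.assoc)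

lemma state_cong:
  assumes "\<And>i. i < t \<Longrightarrow> u i = u' i" and "\<And>i. i < t \<Longrightarrow> w i = w' i"
  shows "state A B x0 u w t = state A B x0 u' w' t"
  using assms by (induction t) auto

lemma feedback_state_eq: "feedback_state A B x0 w \<phi> t \<omega> = state A B x0 (\<lambda>t. feedback_control A B x0 w \<phi> t \<omega>) (\<lambda>t. w t \<omega>) t"
  by (induction t) (auto simp: feedback_control_def)

context lqr begin

definition rate :: real where "rate = (1 + spec_radius F) / 2"

lemma rate_bounds: "0 < rate" "rate < 1" "spec_radius F < rate"
  using spec_radius_F spec_radius_nonneg[of F] by (auto simp: rate_def)

text \<open>Half of the geometric rate: one factor \<open>decay ^ i\<close> keeps a series summable,
  the other remains available as a small factor for its tail.\<close>

definition decay :: real where "decay = sqrt rate"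

lemma decay_bounds: "0 < decay" "decay < 1" "decay\<^sup>2 = rate"
  using rate_bounds by (auto simp: decay_def)

definition growth :: real where
  "growth = (SOME C. C > 0 \<and> (\<forall>k x. norm (matrix_power F k *v x) \<le> C * rate ^ k * norm x))"

lemma growth: "growth > 0" "norm (matrix_power F k *v x) \<le> growth * rate ^ k * norm x"
  using someI_ex[OF matrix_power_bound[OF rate_bounds(3)]] unfolding growth_def by auto

lemma spectral_norm_power_F: "spectral_norm (matrix_power F k) \<le> growth * rate ^ k"
  by (rule spectral_norm_bound) (rule growth)

lemma norm_transpose_power: "norm (matrix_power (transpose F) k *v x) \<le> spectral_norm (matrix_power F k) * norm x"
  unfolding matrix_power_transpose by (rule norm_transpose_vector)

lemma rate_power: "rate ^ i = decay ^ (2 * i)"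
  by (simp add: power_mult decay_bounds)

definition weight :: real where "weight = growth * spectral_norm P"

lemma weight_nonneg: "0 \<le> weight"
  using growth(1) spectral_norm_nonneg[of P] by (simp add: weight_def)

lemma norm_power_P: "norm (matrix_power (transpose F) i *v (P *v x)) \<le> weight * decay ^ (2 * i) * norm x"
proof -
  have "norm (matrix_power (transpose F) i *v (P *v x)) \<le> (growth * rate ^ i) * (spectral_norm P * norm x)"
    by (intro order_trans[OF norm_transpose_power] mult_mono spectral_norm_power_F norm_matrix_vector)
      (use growth(1) rate_bounds in auto)
  then show ?thesis by (simp add: weight_def rate_power mult_ac)
qed

text \<open>The norm of the \<open>k\<close>-th power is kept instead of being bounded by
  \<open>rate ^ k\<close>, because the benefit of a prediction is to be compared with that norm
  itself.\<close>

lemma norm_power_shift_P: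
  "norm (matrix_power (transpose F) (k + i) *v (P *v x)) \<le> spectral_norm (matrix_power F k) * weight * decay ^ i * norm x"
proof -
  have "norm (matrix_power (transpose F) (k + i) *v (P *v x))
      = norm (matrix_power (transpose F) k *v (matrix_power (transpose F) i *v (P *v x)))"
    by (simp add: matrix_power_add matrix_vector_mul_assoc matrix_mul_assoc)
  also have "\<dots> \<le> spectral_norm (matrix_power F k) * (weight * decay ^ (2 * i) * norm x)"
    by (intro order_trans[OF norm_transpose_power] mult_left_mono norm_power_P spectral_norm_nonneg)
  also have "\<dots> \<le> spectral_norm (matrix_power F k) * (weight * decay ^ i * norm x)"
    using decay_bounds weight_nonneg
    by (intro mult_left_mono mult_right_mono power_decreasing spectral_norm_nonneg) auto
  finally show ?thesis by (simp add: mult_ac)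
qed

lemma norm_power_P_le: "norm (matrix_power (transpose F) i *v (P *v x)) \<le> weight * decay ^ i * norm x"
proof -
  have "decay ^ (2 * i) \<le> decay ^ i" using decay_bounds by (intro power_decreasing) auto
  then have "weight * decay ^ (2 * i) * norm x \<le> weight * decay ^ i * norm x"
    using weight_nonneg by (intro mult_left_mono mult_right_mono) auto
  with norm_power_P show ?thesis by (rule order_trans)
qed

lemma norm_power_P_tail:
  assumes "N \<le> i"
  shows "norm (matrix_power (transpose F) i *v (P *v x)) \<le> weight * decay ^ N * decay ^ i * norm x"
proof -
  have "decay ^ (2 * i) \<le> decay ^ (N + i)" using decay_bounds assms by (intro power_decreasing) auto
  then have "weight * decay ^ (2 * i) * norm x \<le> weight * decay ^ (N + i) * norm x"
    using weight_nonneg by (intro mult_left_mono mult_right_mono) auto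
  with norm_power_P[of i x] show ?thesis by (simp add: power_add mult.assoc)
qed

end

section \<open>The closed loop under the policy\<close>

locale lqr_disturbances = lqr A Q P B R + disturbances M W w
  for A Q P :: "real^'n^'n" and B :: "real^'d^'n" and R :: "real^'d^'d"
    and M :: "'a measure" and W :: "nat \<Rightarrow> (nat \<Rightarrow> real^'n) \<Rightarrow> (real^'n) measure" and w :: "nat \<Rightarrow> 'a \<Rightarrow> real^'n" +
  fixes x0 :: "real^'n" and Qf :: "real^'n^'n" and m :: real
  assumes psd_Qf: "pos_semidef Qf" and w_L2: "\<And>t. L2_le M (w t) m"
begin

text \<open>The conditional mean of the infinite-horizon adjoint vector at time \<open>t\<close>.
  With \<open>k\<close> predictions the last known index is \<open>t + k - 1\<close>, as asked for
  by the inclusive last argument of \<open>cond_mean\<close>; the tail is re-indexed to start at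
  0.\<close>

definition forecast :: "nat \<Rightarrow> nat \<Rightarrow> 'a \<Rightarrow> real^'n" where
  "forecast k t \<omega> = (\<Sum>i<k. matrix_power (transpose F) i *v (P *v w (t + i) \<omega>))
     + (\<Sum>i. matrix_power (transpose F) (k + i) *v (P *v cond_mean M w (t + (k + i)) (t + k - 1) \<omega>))"

definition policy :: "nat \<Rightarrow> nat \<Rightarrow> real^'n \<Rightarrow> 'a \<Rightarrow> real^'d" where
  "policy k t x \<omega> = - (H *v (P *v (A *v x)
     + (\<Sum>i<k. matrix_power (transpose F) i *v (P *v w (t + i) \<omega>))
     + (\<Sum>i. matrix_power (transpose F) (k + i) *v (P *v cond_mean M w (t + (k + i)) (t + k - 1) \<omega>))))"

definition X :: "nat \<Rightarrow> nat \<Rightarrow> 'a \<Rightarrow> real^'n" where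
  "X k = feedback_state A B x0 w (policy k)"

definition U :: "nat \<Rightarrow> nat \<Rightarrow> 'a \<Rightarrow> real^'d" where
  "U k = feedback_control A B x0 w (policy k)"

abbreviation q :: "nat \<Rightarrow> nat \<Rightarrow> 'a \<Rightarrow> real^'n" where
  "q T t \<omega> \<equiv> adjoint_state T (\<lambda>t. w t \<omega>) t"

definition Z :: "nat \<Rightarrow> nat \<Rightarrow> nat \<Rightarrow> 'a \<Rightarrow> real^'d" where
  "Z k T t \<omega> = deviation x0 T (\<lambda>t. U k t \<omega>) (\<lambda>t. w t \<omega>) t"

lemma m_nonneg: "0 \<le> m"
  using L2_le_nonneg[OF w_L2] .

lemma policy_eq: "policy k t x \<omega> = - (K *v x) - H *v forecast k t \<omega>"
  by (simp add: policy_def forecast_def add.assoc matrix_vector_right_distrib H_PA)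

lemma U_eq: "U k t \<omega> = - (K *v X k t \<omega>) - H *v forecast k t \<omega>"
  by (simp add: U_def feedback_control_def policy_eq X_def)

lemma X_state: "state A B x0 (\<lambda>t. U k t \<omega>) (\<lambda>t. w t \<omega>) t = X k t \<omega>"
  unfolding X_def U_def feedback_state_eq ..

lemma X_0: "X k 0 \<omega> = x0"
  by (simp add: X_def)

lemma X_Suc: "X k (Suc t) \<omega> = F *v X k t \<omega> + (w t \<omega> - B *v (H *v forecast k t \<omega>))"
proof -
  have "X k (Suc t) \<omega> = A *v X k t \<omega> + B *v U k t \<omega> + w t \<omega>"
    by (simp add: X_def U_def feedback_control_def)
  then show ?thesis
    by (simp add: U_eq F_def matrix_vector_mult_diff_distrib matrix_vector_mult_minus_right
        matrix_vector_mult_diff_rdistrib matrix_vector_mul_assoc)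
qed

text \<open>The feedback \<open>- K x\<close> cancels the state, so the deviation measures only the
  error in forecasting the adjoint vector.\<close>

lemma Z_eq: "Z k T t \<omega> = H *v (q T t \<omega> - forecast k t \<omega>)"
  unfolding Z_def deviation_def X_state by (simp add: U_eq matrix_vector_mult_diff_distrib)

lemma cond_mean_L2: "L2_le M (cond_mean M w j s) m"
  unfolding cond_mean_def[abs_def] by (rule L2_le_cond_exp[OF w_L2 subalgebra_past])

lemma cond_mean_measurable[measurable]: "cond_mean M w j s \<in> borel_measurable M"
  by (rule L2_le_measurable[OF cond_mean_L2])

lemma L2_le_zero: "L2_le M (\<lambda>_. 0) m"
  using m_nonneg by (simp add: L2_le_def)

lemma forecast_measurable[measurable]: "forecast k t \<in> borel_measurable M"
  unfolding forecast_def by measurable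

lemma q_measurable[measurable]: "(\<lambda>\<omega>. q T t \<omega>) \<in> borel_measurable M"
  unfolding adjoint_state_def by measurable

definition gain :: real where "gain = (weight / (1 - decay))\<^sup>2"

lemma forecast_L2: "L2_le M (forecast k t) (gain * m)"
proof -
  define G where "G i = matrix_power (transpose F) i ** P" for i
  \<comment> \<open>Known disturbances and conditional means obey the same bound \<open>m\<close>,
    so the finite sum and the tail merge into one series.\<close>
  define v where "v i = (if i < k then w (t + i) else cond_mean M w (t + i) (t + k - 1))" for i
  have v: "L2_le M (v i) m" for i by (simp add: v_def w_L2 cond_mean_L2)
  have G: "norm (G i *v x) \<le> weight * decay ^ i * norm x" for i x
    using norm_power_P_le[of i x] by (simp add: G_def matrix_vector_mul_assoc)
  note L = L2_le_suminf[where v = v, OF v G weight_nonneg decay_bounds(1,2)]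
  show ?thesis unfolding gain_def
  proof (rule L2_le_cong_AE[OF L(2) forecast_measurable])
    show "AE \<omega> in M. forecast k t \<omega> = (\<Sum>i. G i *v v i \<omega>)"
      using L(1)
    proof eventually_elim
      case (elim \<omega>)
      have "(\<Sum>i. G i *v v i \<omega>) = (\<Sum>i. G (i + k) *v v (i + k) \<omega>) + (\<Sum>i<k. G i *v v i \<omega>)"
        by (rule suminf_split_initial_segment[OF elim])
      then show ?case
        by (simp add: forecast_def G_def v_def matrix_vector_mul_assoc add.commute)
    qed
  qed
qed

lemma q_L2: "L2_le M (\<lambda>\<omega>. q T t \<omega>) (gain * m)"
proof -
  define G where "G i = matrix_power (transpose F) i ** P" for i
  define v where "v i = (if i < T - t then w (t + i) else (\<lambda>_. 0))" for i
  have v: "L2_le M (v i) m" for i by (simp add: v_def w_L2 L2_le_zero)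
  have G: "norm (G i *v x) \<le> weight * decay ^ i * norm x" for i x
    using norm_power_P_le[of i x] by (simp add: G_def matrix_vector_mul_assoc)
  have "(\<Sum>i. G i *v v i \<omega>) = q T t \<omega>" for \<omega>
    by (subst suminf_finite[of "{..<T - t}"]) (auto simp: v_def G_def adjoint_state_def matrix_vector_mul_assoc)
  with L2_le_suminf(2)[where v = v, OF v G weight_nonneg decay_bounds(1,2)] show ?thesis by (simp add: gain_def)
qed

lemma Z_L2: "L2_le M (Z k T t) ((spectral_norm H)\<^sup>2 * (4 * (gain * m)))"
  unfolding Z_eq[abs_def]
  using L2_le_matrix[OF L2_le_diff[OF q_L2[of T t] forecast_L2[of k t]], of H] by (simp add: mult_ac)

text \<open>If \<open>t + k \<le> T\<close>, the first \<open>k\<close> terms of the adjoint vector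
  and of the forecast coincide; everything left starts at exponent \<open>k\<close>.\<close>

lemma Z_L2_small:
  assumes "t + k \<le> T"
  shows "L2_le M (Z k T t) ((spectral_norm H)\<^sup>2 * (gain * (4 * m)) * (spectral_norm (matrix_power F k))\<^sup>2)"
proof -
  define G where "G i = matrix_power (transpose F) (k + i) ** P" for i
  \<comment> \<open>Disturbances beyond the horizon are replaced by 0, which turns the finite sum
    into a series of the same form as the tail of the forecast.\<close>
  define v1 where "v1 i = (if t + k + i < T then w (t + (k + i)) else (\<lambda>_. 0))" for i
  define v2 where "v2 i = cond_mean M w (t + (k + i)) (t + k - 1)" for i
  have v1: "L2_le M (v1 i) m" and v2: "L2_le M (v2 i) m" for i
    by (auto simp: v1_def v2_def w_L2 L2_le_zero cond_mean_L2)
  have v: "L2_le M (\<lambda>\<omega>. v1 i \<omega> - v2 i \<omega>) (4 * m)" for i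
    using L2_le_diff[OF v1 v2] by simp
  define D where "D = spectral_norm (matrix_power F k) * weight"
  have D: "0 \<le> D" by (simp add: D_def spectral_norm_nonneg weight_nonneg)
  have G: "norm (G i *v x) \<le> D * decay ^ i * norm x" for i x
    using norm_power_shift_P[of k i x] by (simp add: G_def D_def matrix_vector_mul_assoc)
  have fin: "(\<lambda>i. G i *v v1 i \<omega>) sums (\<Sum>i<T - t - k. G i *v v1 i \<omega>)" for \<omega>
    by (rule sums_finite) (auto simp: v1_def)
  have "L2_le M (\<lambda>\<omega>. q T t \<omega> - forecast k t \<omega>) ((D / (1 - decay))\<^sup>2 * (4 * m))"
  proof (rule L2_le_cong_AE[OF L2_le_suminf(2)[where v = "\<lambda>i \<omega>. v1 i \<omega> - v2 i \<omega>", OF v G D decay_bounds(1,2)]])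
    show "AE \<omega> in M. q T t \<omega> - forecast k t \<omega> = (\<Sum>i. G i *v (v1 i \<omega> - v2 i \<omega>))"
      using L2_le_suminf(1)[where v = v2, OF v2 G D decay_bounds(1,2)]
    proof eventually_elim
      case (elim \<omega>)
      have "(\<Sum>i. G i *v (v1 i \<omega> - v2 i \<omega>)) = (\<Sum>i. G i *v v1 i \<omega>) - (\<Sum>i. G i *v v2 i \<omega>)"
        unfolding matrix_vector_mult_diff_distrib using fin elim by (intro suminf_diff[symmetric]) (auto dest: sums_summable)
      also have "(\<Sum>i. G i *v v1 i \<omega>) = (\<Sum>i<T - t - k. G i *v v1 i \<omega>)" using fin by (rule sums_unique[symmetric])
      finally have eq: "(\<Sum>i. G i *v (v1 i \<omega> - v2 i \<omega>)) = (\<Sum>i<T - t - k. G i *v v1 i \<omega>) - (\<Sum>i. G i *v v2 i \<omega>)" .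
      have "T - t = k + (T - t - k)" using assms by simp
      then have "q T t \<omega> = (\<Sum>i<k + (T - t - k). matrix_power (transpose F) i *v (P *v w (t + i) \<omega>))"
        by (simp only: adjoint_state_def)
      also have "\<dots> = (\<Sum>i<k. matrix_power (transpose F) i *v (P *v w (t + i) \<omega>))
          + (\<Sum>i<T - t - k. matrix_power (transpose F) (k + i) *v (P *v w (t + (k + i)) \<omega>))"
        by (simp add: sum_lessThan_add)
      also have "(\<Sum>i<T - t - k. matrix_power (transpose F) (k + i) *v (P *v w (t + (k + i)) \<omega>))
          = (\<Sum>i<T - t - k. G i *v v1 i \<omega>)"
        by (intro sum.cong) (auto simp: G_def v1_def matrix_vector_mul_assoc)
      finally show ?case unfolding eq by (simp add: forecast_def G_def v2_def matrix_vector_mul_assoc)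
    qed
  qed simp
  from L2_le_matrix[OF this, of H] show ?thesis
    unfolding Z_eq[abs_def] by (simp add: D_def gain_def power_mult_distrib power_divide mult_ac)
qed

lemma X_measurable[measurable]: "X k t \<in> borel_measurable M"
proof (induction t)
  case 0
  then show ?case by (simp add: X_def)
next
  case (Suc t)
  note [measurable] = Suc
  show ?case unfolding X_Suc[abs_def] by measurable
qed

lemma U_measurable[measurable]: "U k t \<in> borel_measurable M"
  unfolding U_eq[abs_def] by measurable

text \<open>\<open>F\<close> need not contract the Euclidean norm, so the recursion in mean square
  is run for the scalar majorant of the state.\<close>

lemma X_L2_bound: "\<exists>b. \<forall>k t. L2_le M (X k t) b"
proof -
  define d where "d k t \<omega> = w t \<omega> - B *v (H *v forecast k t \<omega>)" for k t \<omega>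
  define bd where "bd = 2 * m + 2 * ((spectral_norm B)\<^sup>2 * ((spectral_norm H)\<^sup>2 * (gain * m)))"
  have d: "L2_le M (d k t) bd" for k t
    unfolding d_def[abs_def] bd_def by (intro L2_le_diff w_L2 L2_le_matrix forecast_L2)
  have [measurable]: "d k t \<in> borel_measurable M" for k t using d by (rule L2_le_measurable)
  define y where "y k t \<omega> = majorant growth rate (norm x0) (\<lambda>t. norm (d k t \<omega>)) t" for k t \<omega>
  have [measurable]: "y k t \<in> borel_measurable M" for k t
    unfolding y_def by (induction t) auto
  \<comment> \<open>Chosen such that
    \<open>rate * b + growth\<^sup>2 / (1 - rate) * bd \<le> b\<close>: the bound reproduces itself
    at each step and also covers the start.\<close>
  define b where "b = growth\<^sup>2 * (norm x0)\<^sup>2 + growth\<^sup>2 / (1 - rate) * bd / (1 - rate)"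
  have bd: "0 \<le> bd" using L2_le_nonneg[OF d] .
  have bstep: "rate * b + growth\<^sup>2 / (1 - rate) * bd \<le> b"
  proof -
    define a where "a = growth\<^sup>2 * (norm x0)\<^sup>2"
    define c where "c = growth\<^sup>2 / (1 - rate) * bd"
    have "rate * (a + c / (1 - rate)) + c = (a + c / (1 - rate)) - (1 - rate) * a"
      using rate_bounds by (simp add: field_simps)
    then have "rate * b + c = b - (1 - rate) * a" by (simp add: b_def a_def c_def)
    moreover have "0 \<le> a" by (simp add: a_def)
    ultimately show ?thesis using rate_bounds by (simp add: c_def mult_nonneg_nonneg)
  qed
  have yL: "L2_le M (y k t) b" for k t
  proof (induction t)
    case 0
    have "L2_le M (\<lambda>_::'a. growth * norm x0) ((norm (growth * norm x0))\<^sup>2)" by (rule L2_le_const)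
    then have "L2_le M (y k 0) ((norm (growth * norm x0))\<^sup>2)" by (simp add: y_def[abs_def])
    then show ?case
      by (rule L2_le_mono) (use bd rate_bounds in \<open>auto simp: b_def power_mult_distrib\<close>)
  next
    case (Suc t)
    show ?case
    proof (rule L2_le_dominated)
      show "AE \<omega> in M. (norm (y k (Suc t) \<omega>))\<^sup>2
          \<le> rate * (norm (y k t \<omega>))\<^sup>2 + growth\<^sup>2 / (1 - rate) * (norm (d k t \<omega>))\<^sup>2"
        unfolding y_def real_norm_def power2_abs
        by (intro AE_I2 majorant_square_step rate_bounds)
      show "integrable M (\<lambda>\<omega>. rate * (norm (y k t \<omega>))\<^sup>2 + growth\<^sup>2 / (1 - rate) * (norm (d k t \<omega>))\<^sup>2)"
        using Suc d[of k t] by (auto simp: L2_le_def)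
      have "(\<integral>\<omega>. rate * (norm (y k t \<omega>))\<^sup>2 + growth\<^sup>2 / (1 - rate) * (norm (d k t \<omega>))\<^sup>2 \<partial>M)
          = rate * (\<integral>\<omega>. (norm (y k t \<omega>))\<^sup>2 \<partial>M) + growth\<^sup>2 / (1 - rate) * (\<integral>\<omega>. (norm (d k t \<omega>))\<^sup>2 \<partial>M)"
        using Suc d[of k t] by (auto simp: L2_le_def)
      also have "\<dots> \<le> rate * b + growth\<^sup>2 / (1 - rate) * bd"
        using Suc d[of k t] rate_bounds by (intro add_mono mult_left_mono) (auto simp: L2_le_def)
      finally show "(\<integral>\<omega>. rate * (norm (y k t \<omega>))\<^sup>2 + growth\<^sup>2 / (1 - rate) * (norm (d k t \<omega>))\<^sup>2 \<partial>M) \<le> b"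
        using bstep by simp
    qed measurable
  qed
  have "L2_le M (X k t) b" for k t
  proof -
    have "norm (X k t \<omega>) \<le> y k t \<omega>" for \<omega>
      unfolding y_def
      by (rule norm_le_majorant[of F growth rate "\<lambda>t. X k t \<omega>"])
        (use growth rate_bounds in \<open>auto simp: X_Suc X_0 d_def less_imp_le\<close>)
    then have "norm (X k t \<omega>) \<le> 1 * norm (y k t \<omega>)" for \<omega>
      by (metis abs_ge_self mult_1 order_trans real_norm_def)
    from L2_le_bounded_image[OF yL _ this] show ?thesis by simp
  qed
  then show ?thesis by blast
qed

end

section \<open>Expected cost of the policy\<close>

lemma L2_le_bilinear:
  fixes G :: "real^'n^'m"
  assumes "L2_le M X a" and "L2_le M Y b"
  shows "integrable M (\<lambda>\<omega>. X \<omega> \<bullet> (G *v Y \<omega>))"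
    and "(\<integral>\<omega>. \<bar>X \<omega> \<bullet> (G *v Y \<omega>)\<bar> \<partial>M) \<le> a + (spectral_norm G)\<^sup>2 * b"
    and "\<bar>\<integral>\<omega>. X \<omega> \<bullet> (G *v Y \<omega>) \<partial>M\<bar> \<le> a + (spectral_norm G)\<^sup>2 * b"
proof -
  note * = L2_le_inner[OF assms(1) L2_le_matrix[OF assms(2), of G]]
  show 1: "integrable M (\<lambda>\<omega>. X \<omega> \<bullet> (G *v Y \<omega>))" by (rule *(1))
  show 2: "(\<integral>\<omega>. \<bar>X \<omega> \<bullet> (G *v Y \<omega>)\<bar> \<partial>M) \<le> a + (spectral_norm G)\<^sup>2 * b" by (rule *(2))
  show "\<bar>\<integral>\<omega>. X \<omega> \<bullet> (G *v Y \<omega>) \<partial>M\<bar> \<le> a + (spectral_norm G)\<^sup>2 * b"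
    using integral_le_integral_abs[OF 1] 2 by linarith
qed

lemma feedback_state_cong:
  assumes "\<And>s x. s < t \<Longrightarrow> \<phi> s x \<omega> = \<phi>' s x \<omega>'" and "\<And>s. s < t \<Longrightarrow> w s \<omega> = w' s \<omega>'"
  shows "feedback_state A B x0 w \<phi> t \<omega> = feedback_state A B x0 w' \<phi>' t \<omega>'"
  using assms by (induction t) auto

lemma feedback_control_cong:
  assumes "\<And>s x. s \<le> t \<Longrightarrow> \<phi> s x \<omega> = \<phi>' s x \<omega>'" and "\<And>s. s < t \<Longrightarrow> w s \<omega> = w' s \<omega>'"
  shows "feedback_control A B x0 w \<phi> t \<omega> = feedback_control A B x0 w' \<phi>' t \<omega>'"
  unfolding feedback_control_def
  using feedback_state_cong[of t \<phi> \<omega> \<phi>' \<omega>' w w' A B x0] assms by auto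

lemma lqr_cost_cong:
  assumes "\<And>i. i < T \<Longrightarrow> u i = u' i" and "\<And>i. i < T \<Longrightarrow> w i = w' i"
  shows "lqr_cost A B Q R Qf x0 T u w = lqr_cost A B Q R Qf x0 T u' w'"
proof -
  have "state A B x0 u w t = state A B x0 u' w' t" if "t \<le> T" for t
    using that assms by (intro state_cong) auto
  then show ?thesis using assms by (simp add: lqr_cost_def)
qed

context lqr_disturbances begin

text \<open>One bound for all processes involved, uniform in the number of predictions, the horizon
  and time.\<close>

definition moment_bound :: real where
  "moment_bound = (SOME b. \<forall>k T t. L2_le M (X k t) b \<and> L2_le M (U k t) b \<and> L2_le M (\<lambda>\<omega>. q T t \<omega>) b \<and> L2_le M (Z k T t) b \<and> L2_le M (w t) b)"

lemma L2_moment_bound: "L2_le M (X k t) moment_bound" "L2_le M (U k t) moment_bound" "L2_le M (\<lambda>\<omega>. q T t \<omega>) moment_bound" "L2_le M (Z k T t) moment_bound" "L2_le M (w t) moment_bound"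
proof -
  obtain b where b: "\<And>k t. L2_le M (X k t) b" using X_L2_bound by blast
  define b1 where "b1 = 2 * ((spectral_norm K)\<^sup>2 * b) + 2 * ((spectral_norm H)\<^sup>2 * (gain * m))"
  have U: "L2_le M (U k t) b1" for k t
    unfolding U_eq[abs_def] b1_def by (intro L2_le_diff L2_le_minus L2_le_matrix b forecast_L2)
  define b2 where "b2 = \<bar>b\<bar> + \<bar>b1\<bar> + \<bar>gain * m\<bar> + \<bar>(spectral_norm H)\<^sup>2 * (4 * (gain * m))\<bar> + \<bar>m\<bar>"
  have "\<forall>k T t. L2_le M (X k t) b2 \<and> L2_le M (U k t) b2 \<and> L2_le M (\<lambda>\<omega>. q T t \<omega>) b2 \<and> L2_le M (Z k T t) b2 \<and> L2_le M (w t) b2"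
  proof (intro allI conjI)
    fix k T t
    show "L2_le M (X k t) b2" using b by (rule L2_le_mono) (simp add: b2_def)
    show "L2_le M (U k t) b2" using U by (rule L2_le_mono) (simp add: b2_def)
    show "L2_le M (\<lambda>\<omega>. q T t \<omega>) b2" using q_L2 by (rule L2_le_mono) (simp add: b2_def)
    show "L2_le M (Z k T t) b2" using Z_L2 by (rule L2_le_mono) (simp add: b2_def)
    show "L2_le M (w t) b2" using w_L2 by (rule L2_le_mono) (simp add: b2_def)
  qed
  from someI[of "\<lambda>b. \<forall>k T t. L2_le M (X k t) b \<and> L2_le M (U k t) b \<and> L2_le M (\<lambda>\<omega>. q T t \<omega>) b
      \<and> L2_le M (Z k T t) b \<and> L2_le M (w t) b", OF this]
  show "L2_le M (X k t) moment_bound" "L2_le M (U k t) moment_bound" "L2_le M (\<lambda>\<omega>. q T t \<omega>) moment_bound" "L2_le M (Z k T t) moment_bound" "L2_le M (w t) moment_bound"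
    unfolding moment_bound_def[symmetric] by auto
qed

lemma moment_bound_nonneg: "0 \<le> moment_bound"
  using L2_le_nonneg[OF L2_moment_bound(5)] .

definition expected_initial :: "nat \<Rightarrow> real" where "expected_initial T = (\<integral>\<omega>. initial_cost x0 T (\<lambda>t. w t \<omega>) \<partial>M)"
definition expected_offset :: "nat \<Rightarrow> nat \<Rightarrow> real" where "expected_offset T t = (\<integral>\<omega>. offset T (\<lambda>t. w t \<omega>) t \<partial>M)"
definition expected_deviation :: "nat \<Rightarrow> nat \<Rightarrow> nat \<Rightarrow> real" where "expected_deviation k T t = (\<integral>\<omega>. Z k T t \<omega> \<bullet> (S *v Z k T t \<omega>) \<partial>M)"
definition expected_stage :: "nat \<Rightarrow> nat \<Rightarrow> real" where
  "expected_stage k t = (\<integral>\<omega>. stage_cost x0 (\<lambda>t. U k t \<omega>) (\<lambda>t. w t \<omega>) t \<partial>M)"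
definition expected_cost :: "nat \<Rightarrow> nat \<Rightarrow> real" where
  "expected_cost k T = (\<integral>\<omega>. lqr_cost A B Q R Qf x0 T (\<lambda>t. U k t \<omega>) (\<lambda>t. w t \<omega>) \<partial>M)"

lemma Hq_L2: "L2_le M (\<lambda>\<omega>. H *v q T t \<omega>) ((spectral_norm H)\<^sup>2 * moment_bound)"
  by (rule L2_le_matrix[OF L2_moment_bound(3)])

lemma bilinear_integrable:
  "integrable M (\<lambda>\<omega>. X k t \<omega> \<bullet> (G *v X k t \<omega>))"
  "integrable M (\<lambda>\<omega>. U k t \<omega> \<bullet> (G' *v U k t \<omega>))"
  "integrable M (\<lambda>\<omega>. Z k T t \<omega> \<bullet> (G' *v Z k T t \<omega>))"
  "integrable M (\<lambda>\<omega>. X k t \<omega> \<bullet> (G *v q T s \<omega>))"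
  "integrable M (\<lambda>\<omega>. x \<bullet> (G *v q T s \<omega>))"
  "integrable M (\<lambda>\<omega>. w t \<omega> \<bullet> (G *v w t \<omega>))"
  "integrable M (\<lambda>\<omega>. w t \<omega> \<bullet> (G *v q T s \<omega>))"
  "integrable M (\<lambda>\<omega>. (H *v q T s \<omega>) \<bullet> (G' *v (H *v q T s \<omega>)))"
  by (rule L2_le_bilinear(1)[OF L2_moment_bound(1) L2_moment_bound(1)] L2_le_bilinear(1)[OF L2_moment_bound(2) L2_moment_bound(2)]
      L2_le_bilinear(1)[OF L2_moment_bound(4) L2_moment_bound(4)] L2_le_bilinear(1)[OF L2_moment_bound(1) L2_moment_bound(3)]
      L2_le_bilinear(1)[OF L2_le_const L2_moment_bound(3)] L2_le_bilinear(1)[OF L2_moment_bound(5) L2_moment_bound(5)]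
      L2_le_bilinear(1)[OF L2_moment_bound(5) L2_moment_bound(3)] L2_le_bilinear(1)[OF Hq_L2 Hq_L2])+

lemma initial_cost_integrable: "integrable M (\<lambda>\<omega>. initial_cost x0 T (\<lambda>t. w t \<omega>))"
  unfolding initial_cost_def
  by (intro Bochner_Integration.integrable_add integrable_mult_right integrable_const bilinear_integrable)

lemma offset_integrable: "integrable M (\<lambda>\<omega>. offset T (\<lambda>t. w t \<omega>) t)"
  unfolding offset_def
  by (intro Bochner_Integration.integrable_add Bochner_Integration.integrable_diff integrable_mult_right
      bilinear_integrable)

lemma offset_bound: "\<exists>c\<ge>0. \<forall>T t. (\<integral>\<omega>. \<bar>offset T (\<lambda>t. w t \<omega>) t\<bar> \<partial>M) \<le> c"
proof -
  let ?h = "(spectral_norm H)\<^sup>2 * moment_bound"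
  define c where "c = (moment_bound + (spectral_norm P)\<^sup>2 * moment_bound) + 2 * (moment_bound + (spectral_norm (transpose F))\<^sup>2 * moment_bound)
    + (?h + (spectral_norm S)\<^sup>2 * ?h)"
  have "(\<integral>\<omega>. \<bar>offset T (\<lambda>t. w t \<omega>) t\<bar> \<partial>M) \<le> c" for T t
  proof -
    define f where "f \<omega> = w t \<omega> \<bullet> (P *v w t \<omega>)" for \<omega>
    define g where "g \<omega> = w t \<omega> \<bullet> (transpose F *v q T (Suc t) \<omega>)" for \<omega>
    define h where "h \<omega> = (H *v q T t \<omega>) \<bullet> (S *v (H *v q T t \<omega>))" for \<omega>
    have f: "integrable M f" "(\<integral>\<omega>. \<bar>f \<omega>\<bar> \<partial>M) \<le> moment_bound + (spectral_norm P)\<^sup>2 * moment_bound"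
      unfolding f_def using L2_le_bilinear[OF L2_moment_bound(5) L2_moment_bound(5)] by auto
    have g: "integrable M g" "(\<integral>\<omega>. \<bar>g \<omega>\<bar> \<partial>M) \<le> moment_bound + (spectral_norm (transpose F))\<^sup>2 * moment_bound"
      unfolding g_def using L2_le_bilinear[OF L2_moment_bound(5) L2_moment_bound(3)] by auto
    have h: "integrable M h" "(\<integral>\<omega>. \<bar>h \<omega>\<bar> \<partial>M) \<le> ?h + (spectral_norm S)\<^sup>2 * ?h"
      unfolding h_def using L2_le_bilinear[OF Hq_L2 Hq_L2] by auto
    have "(\<integral>\<omega>. \<bar>offset T (\<lambda>t. w t \<omega>) t\<bar> \<partial>M) \<le> (\<integral>\<omega>. \<bar>f \<omega>\<bar> + 2 * \<bar>g \<omega>\<bar> + \<bar>h \<omega>\<bar> \<partial>M)"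
    proof (rule integral_mono)
      show "integrable M (\<lambda>\<omega>. \<bar>offset T (\<lambda>t. w t \<omega>) t\<bar>)" using offset_integrable by (rule integrable_abs)
      show "integrable M (\<lambda>\<omega>. \<bar>f \<omega>\<bar> + 2 * \<bar>g \<omega>\<bar> + \<bar>h \<omega>\<bar>)" using f(1) g(1) h(1) by simp
      fix \<omega>
      have "offset T (\<lambda>t. w t \<omega>) t = f \<omega> + 2 * g \<omega> - h \<omega>" by (simp add: offset_def f_def g_def h_def)
      then show "\<bar>offset T (\<lambda>t. w t \<omega>) t\<bar> \<le> \<bar>f \<omega>\<bar> + 2 * \<bar>g \<omega>\<bar> + \<bar>h \<omega>\<bar>" by linarith
    qed
    also have "\<dots> = (\<integral>\<omega>. \<bar>f \<omega>\<bar> \<partial>M) + 2 * (\<integral>\<omega>. \<bar>g \<omega>\<bar> \<partial>M) + (\<integral>\<omega>. \<bar>h \<omega>\<bar> \<partial>M)"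
      using f(1) g(1) h(1) by simp
    also have "\<dots> \<le> c" using f(2) g(2) h(2) by (simp add: c_def)
    finally show ?thesis .
  qed
  moreover have "0 \<le> c" using moment_bound_nonneg by (simp add: c_def)
  ultimately show ?thesis by blast
qed

lemma stage_cost_policy:
  "stage_cost x0 (\<lambda>t. U k t \<omega>) (\<lambda>t. w t \<omega>) t = X k t \<omega> \<bullet> (Q *v X k t \<omega>) + U k t \<omega> \<bullet> (R *v U k t \<omega>)"
  by (simp add: stage_cost_def X_state)

lemma stage_cost_integrable: "integrable M (\<lambda>\<omega>. stage_cost x0 (\<lambda>t. U k t \<omega>) (\<lambda>t. w t \<omega>) t)"
  unfolding stage_cost_policy by (intro Bochner_Integration.integrable_add bilinear_integrable)

lemma expected_stage_bounds: "0 \<le> expected_stage k t" "expected_stage k t \<le> 2 * moment_bound + (spectral_norm Q)\<^sup>2 * moment_bound + (spectral_norm R)\<^sup>2 * moment_bound"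
proof -
  show "0 \<le> expected_stage k t" unfolding expected_stage_def by (intro Bochner_Integration.integral_nonneg stage_cost_nonneg)
  have "expected_stage k t = (\<integral>\<omega>. X k t \<omega> \<bullet> (Q *v X k t \<omega>) \<partial>M) + (\<integral>\<omega>. U k t \<omega> \<bullet> (R *v U k t \<omega>) \<partial>M)"
    unfolding expected_stage_def stage_cost_policy by (intro Bochner_Integration.integral_add bilinear_integrable)
  with L2_le_bilinear(3)[OF L2_moment_bound(1) L2_moment_bound(1), of k t Q k t] L2_le_bilinear(3)[OF L2_moment_bound(2) L2_moment_bound(2), of k t R k t]
  show "expected_stage k t \<le> 2 * moment_bound + (spectral_norm Q)\<^sup>2 * moment_bound + (spectral_norm R)\<^sup>2 * moment_bound" by linarith
qed

lemma expected_stage_sum: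
  assumes "s \<le> T"
  shows "(\<Sum>t<s. expected_stage k t) = expected_initial T + (\<Sum>t<s. expected_deviation k T t + expected_offset T t)
    - (\<integral>\<omega>. X k s \<omega> \<bullet> (P *v X k s \<omega>) \<partial>M) - 2 * (\<integral>\<omega>. X k s \<omega> \<bullet> (transpose F *v q T s \<omega>) \<partial>M)"
proof -
  have iZ: "integrable M (\<lambda>\<omega>. Z k T t \<omega> \<bullet> (S *v Z k T t \<omega>))" for t by (intro bilinear_integrable)
  have iX: "integrable M (\<lambda>\<omega>. X k s \<omega> \<bullet> (P *v X k s \<omega>))" by (intro bilinear_integrable)
  have iq: "integrable M (\<lambda>\<omega>. X k s \<omega> \<bullet> (transpose F *v q T s \<omega>))" by (intro bilinear_integrable)
  have "(\<Sum>t<s. expected_stage k t) = (\<integral>\<omega>. (\<Sum>t<s. stage_cost x0 (\<lambda>t. U k t \<omega>) (\<lambda>t. w t \<omega>) t) \<partial>M)"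
    unfolding expected_stage_def by (intro Bochner_Integration.integral_sum[symmetric] stage_cost_integrable)
  also have "\<dots> = (\<integral>\<omega>. initial_cost x0 T (\<lambda>t. w t \<omega>)
      + (\<Sum>t<s. Z k T t \<omega> \<bullet> (S *v Z k T t \<omega>) + offset T (\<lambda>t. w t \<omega>) t)
      - X k s \<omega> \<bullet> (P *v X k s \<omega>) - 2 * (X k s \<omega> \<bullet> (transpose F *v q T s \<omega>)) \<partial>M)"
    unfolding stage_cost_sum[OF assms] Z_def X_state ..
  also have "\<dots> = expected_initial T + (\<Sum>t<s. expected_deviation k T t + expected_offset T t)
    - (\<integral>\<omega>. X k s \<omega> \<bullet> (P *v X k s \<omega>) \<partial>M) - 2 * (\<integral>\<omega>. X k s \<omega> \<bullet> (transpose F *v q T s \<omega>) \<partial>M)"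
    using iZ iX iq initial_cost_integrable offset_integrable
    by (simp add: expected_initial_def expected_deviation_def expected_offset_def Bochner_Integration.integral_sum)
  finally show ?thesis .
qed

lemma cost_integrable: "integrable M (\<lambda>\<omega>. lqr_cost A B Q R Qf x0 T (\<lambda>t. U k t \<omega>) (\<lambda>t. w t \<omega>))"
  unfolding lqr_cost_eq X_state
  by (intro Bochner_Integration.integrable_add Bochner_Integration.integrable_sum stage_cost_integrable
      bilinear_integrable)

lemma cost_nonneg: "0 \<le> lqr_cost A B Q R Qf x0 T u h"
  unfolding lqr_cost_eq using psd_Qf by (intro add_nonneg_nonneg sum_nonneg stage_cost_nonneg) (simp add: pos_semidef_def)

lemma nn_integral_cost:
  "(\<integral>\<^sup>+\<omega>. ennreal (lqr_cost A B Q R Qf x0 T (\<lambda>t. U k t \<omega>) (\<lambda>t. w t \<omega>)) \<partial>M) = ennreal (expected_cost k T)"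
  unfolding expected_cost_def by (intro nn_integral_eq_integral cost_integrable AE_I2 cost_nonneg)

lemma expected_cost_nonneg: "0 \<le> expected_cost k T"
  unfolding expected_cost_def by (intro Bochner_Integration.integral_nonneg cost_nonneg)

lemma expected_cost_eq: "expected_cost k T = (\<Sum>t<T. expected_stage k t) + (\<integral>\<omega>. X k T \<omega> \<bullet> (Qf *v X k T \<omega>) \<partial>M)"
proof -
  have "integrable M (\<lambda>\<omega>. X k T \<omega> \<bullet> (Qf *v X k T \<omega>))" by (intro bilinear_integrable)
  then show ?thesis
    unfolding expected_cost_def lqr_cost_eq X_state expected_stage_def using stage_cost_integrable
    by (simp add: Bochner_Integration.integral_sum)
qed

lemma expected_deviation_nonneg: "0 \<le> expected_deviation k T t"
  unfolding expected_deviation_def by (intro Bochner_Integration.integral_nonneg S_nonneg)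

text \<open>The constant is uniform in \<open>k\<close>, \<open>T\<close> and \<open>N\<close>. The
  estimate stopped at \<open>T - N\<close> is matched with the lower bound for the optimum; the
  two-sided one at \<open>T\<close>, in which only the deviations depend on \<open>k\<close>,
  compares different numbers of predictions.\<close>

definition cost_bound :: "real \<Rightarrow> bool" where
  "cost_bound c \<longleftrightarrow> 0 \<le> c \<and> (\<forall>k T. expected_cost k T \<le> c * (real T + 1))
    \<and> (\<forall>k T N. N \<le> T \<longrightarrow> expected_cost k T \<le> expected_initial T + (\<Sum>t<T - N. expected_deviation k T t + expected_offset T t) + c * (real N + 1))
    \<and> (\<forall>k T. \<bar>expected_cost k T - (expected_initial T + (\<Sum>t<T. expected_offset T t) + (\<Sum>t<T. expected_deviation k T t))\<bar> \<le> c)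
    \<and> (\<forall>k T t. expected_deviation k T t \<le> c)
    \<and> (\<forall>k T t. t + k \<le> T \<longrightarrow> expected_deviation k T t \<le> c * (spectral_norm (matrix_power F k))\<^sup>2)"

lemma cost_boundD:
  assumes "cost_bound c"
  shows "0 \<le> c" "\<And>k T. expected_cost k T \<le> c * (real T + 1)"
    "\<And>k T N. N \<le> T \<Longrightarrow> expected_cost k T \<le> expected_initial T + (\<Sum>t<T - N. expected_deviation k T t + expected_offset T t) + c * (real N + 1)"
    "\<And>k T. \<bar>expected_cost k T - (expected_initial T + (\<Sum>t<T. expected_offset T t) + (\<Sum>t<T. expected_deviation k T t))\<bar> \<le> c"
    "\<And>k T t. expected_deviation k T t \<le> c"
    "\<And>k T t. t + k \<le> T \<Longrightarrow> expected_deviation k T t \<le> c * (spectral_norm (matrix_power F k))\<^sup>2"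
  using assms by (simp_all add: cost_bound_def)

lemma cost_bound_exists: "\<exists>c. cost_bound c"
proof -
  define n2 :: "real^'n^'n \<Rightarrow> real" where "n2 G = (spectral_norm G)\<^sup>2" for G
  define cG where "cG = 2 * moment_bound + n2 Q * moment_bound + (spectral_norm R)\<^sup>2 * moment_bound"
  define \<kappa> where "\<kappa> G = moment_bound + n2 G * moment_bound" for G
  define cX where "cX = \<kappa> Qf + \<kappa> P + 2 * \<kappa> (transpose F)"
  define cZ where "cZ = (1 + (spectral_norm S)\<^sup>2) * ((spectral_norm H)\<^sup>2 * (gain * (4 * m)))"
  define c where "c = cG + cX + cZ + (moment_bound + (spectral_norm S)\<^sup>2 * moment_bound)"
  have nn: "0 \<le> cG" "0 \<le> cX" "0 \<le> cZ" "0 \<le> moment_bound + (spectral_norm S)\<^sup>2 * moment_bound"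
    using moment_bound_nonneg m_nonneg by (auto simp: cG_def cX_def cZ_def \<kappa>_def n2_def gain_def)
  then have c: "0 \<le> c" "cG \<le> c" "cX \<le> c" "cG + cX \<le> c" "cZ \<le> c" by (auto simp: c_def)
  have G: "expected_stage k t \<le> cG" for k t using expected_stage_bounds(2) by (simp add: cG_def n2_def)
  have XG: "\<bar>\<integral>\<omega>. X k t \<omega> \<bullet> (G *v X k t \<omega>) \<partial>M\<bar> \<le> \<kappa> G" for k t G
    unfolding \<kappa>_def n2_def by (intro L2_le_bilinear(3) L2_moment_bound)
  have XF: "\<bar>\<integral>\<omega>. X k t \<omega> \<bullet> (G *v q T t \<omega>) \<partial>M\<bar> \<le> \<kappa> G" for k t T G
    unfolding \<kappa>_def n2_def by (intro L2_le_bilinear(3) L2_moment_bound)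
  have nn': "0 \<le> \<kappa> G" for G using moment_bound_nonneg by (simp add: \<kappa>_def n2_def)
  have 1: "expected_cost k T \<le> c * (real T + 1)" for k T
  proof -
    have "(\<Sum>t<T. expected_stage k t) \<le> real T * cG" using sum_bounded_above[of "{..<T}" "expected_stage k" cG] G by simp
    moreover have "real T * cG \<le> real T * c" using c by (intro mult_left_mono) auto
    moreover have "\<bar>\<integral>\<omega>. X k T \<omega> \<bullet> (Qf *v X k T \<omega>) \<partial>M\<bar> \<le> c"
      using XG[of k T Qf] nn'[of P] nn'[of "transpose F"] c by (simp add: cX_def)
    ultimately show ?thesis unfolding expected_cost_eq by (simp add: algebra_simps)
  qed
  have 2: "expected_cost k T \<le> expected_initial T + (\<Sum>t<T - N. expected_deviation k T t + expected_offset T t) + c * (real N + 1)" if N: "N \<le> T" for k T N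
  proof -
    \<comment> \<open>The identity is used up to \<open>T - N\<close> only; the last
      \<open>N\<close> steps are charged at the uniform bound for a stage.\<close>
    have "(\<Sum>t<T. expected_stage k t) = (\<Sum>t<(T - N) + N. expected_stage k t)" using N by simp
    also have "\<dots> = (\<Sum>t<T - N. expected_stage k t) + (\<Sum>i<N. expected_stage k (T - N + i))" by (rule sum_lessThan_add)
    finally have "expected_cost k T = (\<Sum>t<T - N. expected_stage k t) + (\<Sum>i<N. expected_stage k (T - N + i)) + (\<integral>\<omega>. X k T \<omega> \<bullet> (Qf *v X k T \<omega>) \<partial>M)"
      by (simp add: expected_cost_eq)
    moreover have "(\<Sum>i<N. expected_stage k (T - N + i)) \<le> real N * cG"
      using sum_bounded_above[of "{..<N}" "\<lambda>i. expected_stage k (T - N + i)" cG] G by simp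
    moreover have "real N * cG \<le> real N * c" using c by (intro mult_left_mono) auto
    moreover have "(\<Sum>t<T - N. expected_stage k t) = expected_initial T + (\<Sum>t<T - N. expected_deviation k T t + expected_offset T t)
        - (\<integral>\<omega>. X k (T - N) \<omega> \<bullet> (P *v X k (T - N) \<omega>) \<partial>M)
        - 2 * (\<integral>\<omega>. X k (T - N) \<omega> \<bullet> (transpose F *v q T (T - N) \<omega>) \<partial>M)"
      by (rule expected_stage_sum) simp
    ultimately show ?thesis
      using XG[of k T Qf] XG[of k "T - N" P] XF[of k "T - N" "transpose F" T] c(3)
      by (simp add: cX_def algebra_simps abs_le_iff)
  qed
  have 3: "\<bar>expected_cost k T - (expected_initial T + (\<Sum>t<T. expected_offset T t) + (\<Sum>t<T. expected_deviation k T t))\<bar> \<le> c" for k T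
  proof -
    have "(\<Sum>t<T. expected_stage k t) = expected_initial T + (\<Sum>t<T. expected_deviation k T t + expected_offset T t) - (\<integral>\<omega>. X k T \<omega> \<bullet> (P *v X k T \<omega>) \<partial>M)"
      using expected_stage_sum[OF order_refl, of k T] by (simp add: adjoint_state_end)
    then show ?thesis
      using abs_le_D1[OF XG[of k T Qf]] abs_le_D2[OF XG[of k T Qf]] abs_le_D1[OF XG[of k T P]]
        abs_le_D2[OF XG[of k T P]] c(3) nn'[of "transpose F"]
      unfolding expected_cost_eq sum.distrib cX_def by (intro abs_leI) linarith+
  qed
  have 4: "expected_deviation k T t \<le> c" for k T t
  proof -
    have "\<bar>expected_deviation k T t\<bar> \<le> moment_bound + (spectral_norm S)\<^sup>2 * moment_bound"
      unfolding expected_deviation_def by (intro L2_le_bilinear(3) L2_moment_bound)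
    then show ?thesis using nn by (simp add: c_def)
  qed
  have 5: "expected_deviation k T t \<le> c * (spectral_norm (matrix_power F k))\<^sup>2" if "t + k \<le> T" for k T t
  proof -
    let ?b = "(spectral_norm H)\<^sup>2 * (gain * (4 * m)) * (spectral_norm (matrix_power F k))\<^sup>2"
    have "\<bar>expected_deviation k T t\<bar> \<le> ?b + (spectral_norm S)\<^sup>2 * ?b"
      unfolding expected_deviation_def by (intro L2_le_bilinear(3) Z_L2_small that)
    also have "\<dots> = cZ * (spectral_norm (matrix_power F k))\<^sup>2" by (simp add: cZ_def algebra_simps)
    also have "\<dots> \<le> c * (spectral_norm (matrix_power F k))\<^sup>2" using c by (intro mult_right_mono) auto
    finally show ?thesis by simp
  qed
  show ?thesis unfolding cost_bound_def using c(1) 1 2 3 4 5 by (intro exI[of _ c] conjI allI impI)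
qed

text \<open>In the difference the terms in \<open>w\<close> alone cancel, and up to a bounded error
  only deviations remain. The last steps, where these are not small, go into \<open>c'\<close>; it
  may depend on \<open>k\<close> because it will be divided by \<open>T\<close>.\<close>

lemma expected_cost_difference: "\<exists>c>0. \<forall>k. \<exists>c'. \<forall>T\<ge>k + 1.
  \<bar>expected_cost k T - expected_cost (k + 1) T\<bar> \<le> c * real T * (spectral_norm (matrix_power F k))\<^sup>2 + c'"
proof -
  obtain c where "cost_bound c" using cost_bound_exists ..
  note c = cost_boundD[OF this]
  define \<phi> where "\<phi> k = (spectral_norm (matrix_power F k))\<^sup>2" for k
  have \<phi>0: "0 \<le> \<phi> k" for k by (simp add: \<phi>_def)
  \<comment> \<open>Lets the deviations for \<open>k + 1\<close> predictions be bounded through the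
    norm of the \<open>k\<close>-th power as well.\<close>
  have "spectral_norm (matrix_power F (Suc k)) \<le> spectral_norm F * spectral_norm (matrix_power F k)" for k
  proof (rule spectral_norm_bound)
    fix x
    have "norm (matrix_power F (Suc k) *v x) = norm (F *v (matrix_power F k *v x))"
      by (simp add: matrix_vector_mul_assoc)
    also have "\<dots> \<le> spectral_norm F * (spectral_norm (matrix_power F k) * norm x)"
      by (intro order_trans[OF norm_matrix_vector] mult_left_mono norm_matrix_vector spectral_norm_nonneg)
    finally show "norm (matrix_power F (Suc k) *v x) \<le> spectral_norm F * spectral_norm (matrix_power F k) * norm x"
      by (simp add: mult.assoc)
  qed
  then have \<phi>S: "\<phi> (Suc k) \<le> (spectral_norm F)\<^sup>2 * \<phi> k" for k
    unfolding \<phi>_def power_mult_distrib[symmetric] by (intro power_mono spectral_norm_nonneg)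
  have Zsum: "(\<Sum>t<T. expected_deviation k T t) \<le> c * real T * \<phi> k + real k * c" if "k \<le> T" for k T
  proof -
    have "(\<Sum>t<T. expected_deviation k T t) = (\<Sum>t<(T - k) + k. expected_deviation k T t)" using that by simp
    also have "\<dots> = (\<Sum>t<T - k. expected_deviation k T t) + (\<Sum>i<k. expected_deviation k T (T - k + i))" by (rule sum_lessThan_add)
    also have "(\<Sum>t<T - k. expected_deviation k T t) \<le> real (T - k) * (c * \<phi> k)"
      using sum_bounded_above[of "{..<T - k}" "expected_deviation k T" "c * \<phi> k"] c(6)[of _ k T] by (simp add: \<phi>_def)
    also have "\<dots> \<le> real T * (c * \<phi> k)" using c(1) \<phi>0 by (intro mult_right_mono) auto
    also have "(\<Sum>i<k. expected_deviation k T (T - k + i)) \<le> real k * c"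
      using sum_bounded_above[of "{..<k}" "\<lambda>i. expected_deviation k T (T - k + i)" c] c(5) by simp
    finally show ?thesis by (simp add: mult_ac)
  qed
  have "\<bar>expected_cost k T - expected_cost (k + 1) T\<bar> \<le> (c * (1 + (spectral_norm F)\<^sup>2) + 1) * real T * \<phi> k + (2 * c + real (k + 1) * c)"
    if T: "T \<ge> k + 1" for k T
  proof -
    have s1: "0 \<le> (\<Sum>t<T. expected_deviation k T t)" "0 \<le> (\<Sum>t<T. expected_deviation (k + 1) T t)" by (auto intro!: sum_nonneg expected_deviation_nonneg)
    have "(\<Sum>t<T. expected_deviation k T t) \<le> c * real T * \<phi> k + real k * c" using T by (intro Zsum) simp
    moreover have "0 \<le> c * real T * \<phi> k" "0 \<le> c * real T * ((spectral_norm F)\<^sup>2 * \<phi> k)" "0 \<le> real T * \<phi> k"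
      using c(1) \<phi>0[of k] by auto
    moreover have "(\<Sum>t<T. expected_deviation (k + 1) T t) \<le> c * real T * \<phi> (k + 1) + real (k + 1) * c" using T by (intro Zsum) simp
    moreover have "c * real T * \<phi> (k + 1) \<le> c * real T * ((spectral_norm F)\<^sup>2 * \<phi> k)"
      using \<phi>S[of k] c(1) by (intro mult_left_mono) auto
    moreover have "real k * c \<le> real (k + 1) * c" using c(1) by (intro mult_right_mono) auto
    moreover have "(c * (1 + (spectral_norm F)\<^sup>2) + 1) * real T * \<phi> k
        = c * real T * \<phi> k + c * real T * ((spectral_norm F)\<^sup>2 * \<phi> k) + real T * \<phi> k"
      by (simp add: algebra_simps)
    ultimately show ?thesis using c(4)[of k T] c(4)[of "k + 1" T] s1 by linarith
  qed
  moreover have "c * (1 + (spectral_norm F)\<^sup>2) + 1 > 0" using c(1) by (intro add_nonneg_pos) auto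
  ultimately show ?thesis unfolding \<phi>_def by blast
qed

section \<open>The policy as a function of the observed history\<close>

definition future_mean :: "nat \<Rightarrow> nat \<Rightarrow> nat \<Rightarrow> (nat \<Rightarrow> real^'n) \<Rightarrow> real^'n" where
  "future_mean n s j h = (\<integral>x. x j \<partial>future W n s h)"

lemma future_mean_measurable:
  assumes "j < s + n"
  shows "future_mean n s j \<in> borel_measurable (hist_space s)"
  unfolding future_mean_def[abs_def]
  by (rule measurable_compose[OF measurable_prob_algebraD[OF measurable_future] integral_measurable_subprob_algebra])
    (use assms in \<open>auto intro: measurable_component_singleton\<close>)

text \<open>Nested minima are evaluated at single histories, while \<open>cond_mean\<close> is
  determined only almost surely; \<open>future_mean\<close> is a version defined everywhere. The
  length \<open>n\<close> is free as long as it reaches index \<open>j\<close>.\<close>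

lemma cond_mean_eq_future_mean:
  assumes "1 \<le> s" and "j < s + n"
  shows "AE \<omega> in M. cond_mean M w j (s - 1) \<omega> = future_mean n s j (hist w s \<omega>)"
proof -
  have "Suc (s - 1) = s" using assms by simp
  then show ?thesis
    using cond_exp_eq_future_mean[OF assms(2) integrable_L2[OF w_L2]]
    by (auto simp: cond_mean_def future_mean_def elim!: eventually_mono)
qed

text \<open>\<open>Suc i\<close> further disturbances are just enough for index
  \<open>t + k + i\<close> to be drawn. The restriction makes the dependence on the first
  \<open>t + k\<close> entries literal rather than almost sure.\<close>

definition hist_policy :: "nat \<Rightarrow> nat \<Rightarrow> real^'n \<Rightarrow> (nat \<Rightarrow> real^'n) \<Rightarrow> real^'d" where
  "hist_policy k t x h = - (H *v (P *v (A *v x)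
     + (\<Sum>i<k. matrix_power (transpose F) i *v (P *v h (t + i)))
     + (\<Sum>i. matrix_power (transpose F) (k + i)
          *v (P *v future_mean (Suc i) (t + k) (t + (k + i)) (restrict h {..<t + k})))))"

lemma hist_policy_cong:
  assumes "\<And>j. j < t + k \<Longrightarrow> h j = h' j"
  shows "hist_policy k t x h = hist_policy k t x h'"
proof -
  have "restrict h {..<t + k} = restrict h' {..<t + k}" using assms by (intro restrict_ext) auto
  then show ?thesis unfolding hist_policy_def using assms by simp
qed

lemma policy_eq_hist_policy:
  assumes "1 \<le> k"
  shows "AE \<omega> in M. \<forall>t x. policy k t x \<omega> = hist_policy k t x (hist w (t + k) \<omega>)"
proof -
  have "AE \<omega> in M. \<forall>t i. cond_mean M w (t + (k + i)) (t + k - 1) \<omega>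
      = future_mean (Suc i) (t + k) (t + (k + i)) (hist w (t + k) \<omega>)"
    unfolding AE_all_countable using assms by (intro allI cond_mean_eq_future_mean) auto
  then show ?thesis
  proof eventually_elim
    case (elim \<omega>)
    have "restrict (hist w (t + k) \<omega>) {..<t + k} = hist w (t + k) \<omega>" for t by (auto simp: hist_def)
    with elim show ?case by (simp add: policy_def hist_policy_def hist_def)
  qed
qed

definition hist_control :: "nat \<Rightarrow> nat \<Rightarrow> (nat \<Rightarrow> real^'n) \<Rightarrow> real^'d" where
  "hist_control k = feedback_control A B x0 (\<lambda>t h. h t) (hist_policy k)"

lemma hist_control_cong:
  assumes "\<And>j. j < i + k \<Longrightarrow> h j = h' j" and "1 \<le> k"
  shows "hist_control k i h = hist_control k i h'"
  unfolding hist_control_def using assms by (intro feedback_control_cong hist_policy_cong) auto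

lemma hist_policy_measurable:
  assumes "t \<le> T" and [measurable]: "y \<in> borel_measurable (hist_space (T + k))"
  shows "(\<lambda>h. hist_policy k t (y h) h) \<in> borel_measurable (hist_space (T + k))"
proof -
  have [measurable]: "(\<lambda>h. h (t + i)) \<in> borel_measurable (hist_space (T + k) :: (nat \<Rightarrow> real^'n) measure)" if "i < k" for i
    using that assms(1) by (intro measurable_component_singleton) auto
  have [measurable]: "(\<lambda>h. future_mean (Suc i) (t + k) (t + (k + i)) (restrict h {..<t + k}))
      \<in> borel_measurable (hist_space (T + k))" for i
    by (rule measurable_compose[OF measurable_restrict_subset future_mean_measurable]) (use assms(1) in auto)
  show ?thesis unfolding hist_policy_def by measurable (use assms(1) in auto)
qed

lemma hist_state_measurable:
  assumes "t \<le> T"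
  shows "(\<lambda>h. feedback_state A B x0 (\<lambda>t h. h t) (hist_policy k) t h) \<in> borel_measurable (hist_space (T + k))"
  using assms
proof (induction t)
  case (Suc t)
  then have t: "t \<le> T" and [measurable]:
    "(\<lambda>h. feedback_state A B x0 (\<lambda>t h. h t) (hist_policy k) t h) \<in> borel_measurable (hist_space (T + k))"
    by simp_all
  have [measurable]: "(\<lambda>h. h t) \<in> borel_measurable (hist_space (T + k) :: (nat \<Rightarrow> real^'n) measure)"
    using Suc.prems by (intro measurable_component_singleton) auto
  have [measurable]: "(\<lambda>h. hist_policy k t (feedback_state A B x0 (\<lambda>t h. h t) (hist_policy k) t h) h)
      \<in> borel_measurable (hist_space (T + k))"
    by (rule hist_policy_measurable[OF t]) measurable
  have "feedback_state A B x0 (\<lambda>t h. h t) (hist_policy k) (Suc t)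
      = (\<lambda>h. A *v feedback_state A B x0 (\<lambda>t h. h t) (hist_policy k) t h
          + B *v hist_policy k t (feedback_state A B x0 (\<lambda>t h. h t) (hist_policy k) t h) h + h t)"
    by (rule ext) simp
  then show ?case by (simp only:) measurable
next
  case 0
  have "feedback_state A B x0 (\<lambda>t h. h t) (hist_policy k) 0 = (\<lambda>h. x0)" by (rule ext) simp
  then show ?case by simp
qed

lemma hist_cost_measurable: "(\<lambda>h. lqr_cost A B Q R Qf x0 T (\<lambda>i. hist_control k i h) h) \<in> borel_measurable (hist_space (T + k))"
proof -
  have st: "state A B x0 (\<lambda>i. hist_control k i h) h t = feedback_state A B x0 (\<lambda>t h. h t) (hist_policy k) t h" for t h
    unfolding hist_control_def feedback_state_eq ..
  have c: "(\<lambda>h. hist_control k t h) \<in> borel_measurable (hist_space (T + k))" if "t \<le> T" for t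
    using hist_policy_measurable[OF that hist_state_measurable[OF that]]
    unfolding hist_control_def feedback_control_def .
  show ?thesis
    unfolding lqr_cost_def st
    by (intro borel_measurable_add borel_measurable_sum borel_measurable_inner borel_measurable_matrix_vector
        hist_state_measurable c) auto
qed

text \<open>The nested minima do not exceed the cost of a measurable rule that reads the history
  \<open>k\<close> steps ahead. Here the rule is \<open>hist_control\<close>, which agrees with the
  policy almost surely.\<close>

lemma STO_horizon_upper:
  assumes k: "1 \<le> k" and T: "k \<le> T"
  shows "STO_horizon A B Q R Qf x0 W k T \<le> ennreal (expected_cost k T)"
proof -
  let ?J = "lqr_cost A B Q R Qf x0 T"
  have "STO_horizon A B Q R Qf x0 W k T
      \<le> (\<integral>\<^sup>+x. ennreal (?J (\<lambda>i. hist_control k i x) x) \<partial>future W (k + T) 0 (\<lambda>_. undefined))"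
    unfolding STO_horizon_def
  proof (rule draws_upper)
    fix h assume h: "h \<in> space (hist_space k :: (nat \<Rightarrow> real^'n) measure)"
    have "min_exp W k ?J (T - k) 0 (\<lambda>_. 0) h
        \<le> (\<integral>\<^sup>+x. ennreal (?J (\<lambda>i. hist_control k i x) x) \<partial>future W (T - k + k) (0 + k) h)"
    proof (rule min_exp_upper)
      show "(\<lambda>h. ?J (\<lambda>i. hist_control k i h) h) \<in> borel_measurable (hist_space (T + k))"
        by (rule hist_cost_measurable)
      show "hist_control k i h = hist_control k i h'" if "\<And>j. j < i + k \<Longrightarrow> h j = h' j" for i h h'
        using that k by (rule hist_control_cong)
      show "?J u h = ?J u h'" if "\<And>j. j < T \<Longrightarrow> h j = h' j" for u h h'
        using that by (intro lqr_cost_cong) auto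
    qed (use h T in auto)
    then show "min_exp W k ?J (T - k) 0 (\<lambda>_. 0) h
        \<le> (\<integral>\<^sup>+x. ennreal (?J (\<lambda>i. hist_control k i x) x) \<partial>future W T k h)"
      using T by simp
  next
    show "(\<lambda>x. ennreal (?J (\<lambda>i. hist_control k i x) x)) \<in> borel_measurable (hist_space (k + T))"
      using measurable_compose[OF hist_cost_measurable[where k = k and T = T] measurable_ennreal] by (simp only: add.commute)
  qed (auto simp: space_PiM)
  also have "\<dots> = (\<integral>\<^sup>+\<omega>. ennreal (?J (\<lambda>i. hist_control k i (hist w (k + T) \<omega>)) (hist w (k + T) \<omega>)) \<partial>M)"
    unfolding future_from_start
    by (rule nn_integral_distr_codomain[OF measurable_hist])
      (use measurable_compose[OF hist_cost_measurable[where k = k and T = T] measurable_ennreal] in \<open>simp only: add.commute\<close>)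
  also have "\<dots> = (\<integral>\<^sup>+\<omega>. ennreal (?J (\<lambda>t. U k t \<omega>) (\<lambda>t. w t \<omega>)) \<partial>M)"
  proof (rule nn_integral_cong_AE, use policy_eq_hist_policy[OF k] in eventually_elim)
    case (elim \<omega>)
    let ?h = "hist w (k + T) \<omega>"
    have "hist_control k t ?h = U k t \<omega>" if "t < T" for t
      unfolding hist_control_def U_def
    proof (rule feedback_control_cong)
      fix s x assume "s \<le> t"
      then have "hist_policy k s x ?h = hist_policy k s x (hist w (s + k) \<omega>)"
        using that by (intro hist_policy_cong) (auto simp: hist_def)
      then show "hist_policy k s x ?h = policy k s x \<omega>" using elim by simp
    qed (use that in \<open>auto simp: hist_def\<close>)
    then have "?J (\<lambda>i. hist_control k i ?h) ?h = ?J (\<lambda>t. U k t \<omega>) (\<lambda>t. w t \<omega>)"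
      by (intro lqr_cost_cong) (auto simp: hist_def)
    then show ?case by simp
  qed
  also have "\<dots> = ennreal (expected_cost k T)" by (rule nn_integral_cost)
  finally show ?thesis .
qed

end

section \<open>Innovations\<close>

lemma integral_matrix_vector:
  fixes G :: "real^'n^'m"
  assumes "integrable N f"
  shows "integrable N (\<lambda>x. G *v f x)" and "(\<integral>x. G *v f x \<partial>N) = G *v (\<integral>x. f x \<partial>N)"
  using integrable_bounded_linear[OF matrix_vector_mul_bounded_linear assms]
    integral_bounded_linear[OF matrix_vector_mul_bounded_linear assms] by auto

context lqr_disturbances begin

text \<open>The unforeseeable part of \<open>H q\<close> at time \<open>t\<close>, over the finite
  horizon. It is a function of the history, centred with \<open>future\<close>, because its mean has
  to vanish under the very kernels of the nested expectation.\<close>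

definition innovation :: "nat \<Rightarrow> nat \<Rightarrow> nat \<Rightarrow> (nat \<Rightarrow> real^'n) \<Rightarrow> real^'d" where
  "innovation T k t h = H *v (\<Sum>i\<in>{k..<T - t}. matrix_power (transpose F) i
     *v (P *v (h (t + i) - future_mean (T - (t + k)) (t + k) (t + i) (restrict h {..<t + k}))))"

definition Y :: "nat \<Rightarrow> nat \<Rightarrow> nat \<Rightarrow> 'a \<Rightarrow> real^'d" where
  "Y T k t \<omega> = innovation T k t (hist w T \<omega>)"

definition expected_innovation :: "nat \<Rightarrow> nat \<Rightarrow> nat \<Rightarrow> real" where "expected_innovation T k t = (\<integral>\<omega>. Y T k t \<omega> \<bullet> (S *v Y T k t \<omega>) \<partial>M)"

lemma innovation_measurable: "innovation T k t \<in> borel_measurable (hist_space T)"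
proof -
  have 1: "(\<lambda>h. h (t + i)) \<in> borel_measurable (hist_space T :: (nat \<Rightarrow> real^'n) measure)" if "i \<in> {k..<T - t}" for i
    using that by (intro measurable_component_singleton) auto
  have 2: "(\<lambda>h. future_mean (T - (t + k)) (t + k) (t + i) (restrict h {..<t + k})) \<in> borel_measurable (hist_space T)"
    if "i \<in> {k..<T - t}" for i
    by (rule measurable_compose[OF measurable_restrict_subset future_mean_measurable]) (use that in auto)
  show ?thesis
    unfolding innovation_def[abs_def]
    by (intro borel_measurable_matrix_vector borel_measurable_sum borel_measurable_diff 1 2)
qed

lemma Y_measurable[measurable]: "Y T k t \<in> borel_measurable M"
  unfolding Y_def[abs_def] by (rule measurable_compose[OF measurable_hist innovation_measurable])

lemma Y_AE:
  assumes "1 \<le> k" and "t + k \<le> T"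
  shows "AE \<omega> in M. Y T k t \<omega> = H *v (\<Sum>i\<in>{k..<T - t}. matrix_power (transpose F) i
     *v (P *v (w (t + i) \<omega> - cond_mean M w (t + i) (t + k - 1) \<omega>)))"
proof -
  have "AE \<omega> in M. \<forall>i\<in>{k..<T - t}. cond_mean M w (t + i) (t + k - 1) \<omega>
      = future_mean (T - (t + k)) (t + k) (t + i) (hist w (t + k) \<omega>)"
  proof (subst AE_ball_countable)
    show "\<forall>i\<in>{k..<T - t}. AE \<omega> in M. cond_mean M w (t + i) (t + k - 1) \<omega>
        = future_mean (T - (t + k)) (t + k) (t + i) (hist w (t + k) \<omega>)"
      by (intro ballI cond_mean_eq_future_mean) (use assms in auto)
  qed simp
  then show ?thesis
  proof eventually_elim
    case (elim \<omega>)
    have "restrict (hist w T \<omega>) {..<t + k} = hist w (t + k) \<omega>" using assms by (auto simp: hist_def)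
    with elim show ?case by (auto simp: Y_def innovation_def hist_def intro!: arg_cong[where f = "(*v) H"] sum.cong)
  qed
qed

lemma Y_L2:
  assumes "1 \<le> k" and "t + k \<le> T"
  shows "L2_le M (Y T k t) ((spectral_norm H)\<^sup>2 * (gain * (4 * m)))"
proof -
  define G where "G i = matrix_power (transpose F) i ** P" for i
  define v where "v i \<omega> = (if i \<in> {k..<T - t} then w (t + i) \<omega> - cond_mean M w (t + i) (t + k - 1) \<omega> else 0)" for i \<omega>
  have v: "L2_le M (v i) (4 * m)" for i
  proof (cases "i \<in> {k..<T - t}")
    case True
    then have "v i = (\<lambda>\<omega>. w (t + i) \<omega> - cond_mean M w (t + i) (t + k - 1) \<omega>)" by (auto simp: v_def)
    then show ?thesis using L2_le_diff[OF w_L2 cond_mean_L2, of "t + i" "t + i" "t + k - 1"] by simp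
  next
    case False
    then have "v i = (\<lambda>\<omega>. 0)" by (auto simp: v_def)
    then show ?thesis using L2_le_mono[OF L2_le_zero, of "4 * m"] m_nonneg by simp
  qed
  have G: "norm (G i *v x) \<le> weight * decay ^ i * norm x" for i x
    using norm_power_P_le[of i x] by (simp add: G_def matrix_vector_mul_assoc)
  have "(\<Sum>i. G i *v v i \<omega>) = (\<Sum>i\<in>{k..<T - t}. matrix_power (transpose F) i
     *v (P *v (w (t + i) \<omega> - cond_mean M w (t + i) (t + k - 1) \<omega>)))" for \<omega>
    by (subst suminf_finite[of "{k..<T - t}"]) (auto simp: v_def G_def matrix_vector_mul_assoc)
  then have "L2_le M (\<lambda>\<omega>. \<Sum>i\<in>{k..<T - t}. matrix_power (transpose F) i
     *v (P *v (w (t + i) \<omega> - cond_mean M w (t + i) (t + k - 1) \<omega>))) (gain * (4 * m))"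
    using L2_le_suminf(2)[where v = v, OF v G weight_nonneg decay_bounds(1,2)] by (simp add: gain_def)
  from L2_le_cong_AE[OF L2_le_matrix[OF this] Y_measurable Y_AE[OF assms]] show ?thesis .
qed

text \<open>The difference consists of the forecasts for indices from \<open>T\<close> on, which the
  policy takes into account and the finite problem does not. They lie at least \<open>N\<close>
  steps ahead, hence the factor \<open>decay ^ (2 * N)\<close> in mean square.\<close>

lemma Z_minus_Y_L2:
  assumes k: "1 \<le> k" and T: "t + k \<le> T" and N: "N \<le> T - t"
  shows "L2_le M (\<lambda>\<omega>. Z k T t \<omega> - Y T k t \<omega>) ((spectral_norm H)\<^sup>2 * (gain * m * decay ^ (2 * N)))"
proof -
  define v where "v i = cond_mean M w (t + (k + i)) (t + k - 1)" for i
  have v: "L2_le M (v i) m" for i by (simp add: v_def cond_mean_L2)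
  define G where "G i = matrix_power (transpose F) (k + i) ** P" for i
  define G' where "G' i = (if T - t \<le> k + i then G i else 0)" for i
  have dk: "decay ^ (k + i) \<le> decay ^ i" for i using decay_bounds by (intro power_decreasing) auto
  have G: "norm (G i *v x) \<le> weight * decay ^ i * norm x" for i x
  proof -
    have "norm (G i *v x) \<le> weight * decay ^ (k + i) * norm x"
      using norm_power_P_le[of "k + i" x] by (simp add: G_def matrix_vector_mul_assoc)
    also have "\<dots> \<le> weight * decay ^ i * norm x" using dk weight_nonneg by (intro mult_right_mono mult_left_mono) auto
    finally show ?thesis .
  qed
  have wd: "0 \<le> weight * decay ^ N" using weight_nonneg decay_bounds by simp
  have G': "norm (G' i *v x) \<le> (weight * decay ^ N) * decay ^ i * norm x" for i x
  proof (cases "T - t \<le> k + i")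
    case True
    then have "norm (G' i *v x) \<le> weight * decay ^ N * decay ^ (k + i) * norm x"
      using norm_power_P_tail[of N "k + i" x] N by (simp add: G'_def G_def matrix_vector_mul_assoc)
    also have "\<dots> \<le> weight * decay ^ N * decay ^ i * norm x"
      using dk wd by (intro mult_right_mono mult_left_mono) auto
    finally show ?thesis .
  next
    case False
    then show ?thesis using wd decay_bounds by (simp add: G'_def)
  qed
  have main: "AE \<omega> in M. Z k T t \<omega> - Y T k t \<omega> = - (H *v (\<Sum>i. G' i *v v i \<omega>))"
    using Y_AE[OF k T] L2_le_suminf(1)[where v = v, OF v G weight_nonneg decay_bounds(1,2)]
      L2_le_suminf(1)[where v = v, OF v G' wd decay_bounds(1,2)]
  proof eventually_elim
    case (elim \<omega>)
    define n where "n = T - t - k"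
    have n: "T - t = k + n" using T by (simp add: n_def)
    have "(\<Sum>i. G i *v v i \<omega>) - (\<Sum>i. G' i *v v i \<omega>) = (\<Sum>i. G i *v v i \<omega> - G' i *v v i \<omega>)"
      by (rule suminf_diff[OF elim(2,3)])
    also have "\<dots> = (\<Sum>i<n. G i *v v i \<omega> - G' i *v v i \<omega>)"
      by (rule suminf_finite) (auto simp: G'_def n)
    also have "\<dots> = (\<Sum>i<n. G i *v v i \<omega>)" by (intro sum.cong) (auto simp: G'_def n)
    finally have tail: "(\<Sum>i. G i *v v i \<omega>) = (\<Sum>i<n. G i *v v i \<omega>) + (\<Sum>i. G' i *v v i \<omega>)"
      by (simp add: algebra_simps)
    have q: "q T t \<omega> = (\<Sum>i<k. matrix_power (transpose F) i *v (P *v w (t + i) \<omega>)) + (\<Sum>i<n. G i *v w (t + (k + i)) \<omega>)"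
      unfolding adjoint_state_def n sum_lessThan_add by (simp add: G_def matrix_vector_mul_assoc)
    have f: "forecast k t \<omega> = (\<Sum>i<k. matrix_power (transpose F) i *v (P *v w (t + i) \<omega>)) + (\<Sum>i. G i *v v i \<omega>)"
      by (simp add: forecast_def G_def v_def matrix_vector_mul_assoc)
    have Y: "Y T k t \<omega> = H *v (\<Sum>i<n. G i *v (w (t + (k + i)) \<omega> - v i \<omega>))"
    proof -
      have "(\<Sum>i\<in>{k..<T - t}. matrix_power (transpose F) i *v (P *v (w (t + i) \<omega> - cond_mean M w (t + i) (t + k - 1) \<omega>)))
          = (\<Sum>i<n. G i *v (w (t + (k + i)) \<omega> - v i \<omega>))"
        by (rule sum.reindex_bij_witness[where i = "\<lambda>i. k + i" and j = "\<lambda>i. i - k"])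
          (auto simp: n G_def v_def matrix_vector_mul_assoc)
      with elim(1) show ?thesis by simp
    qed
    show ?case
      unfolding Z_eq Y q f tail
      by (simp add: matrix_vector_mult_diff_distrib[symmetric] matrix_vector_mult_minus_right[symmetric] sum_subtractf)
        (simp add: matrix_vector_mult_diff_distrib sum_subtractf algebra_simps)
  qed
  have "L2_le M (\<lambda>\<omega>. \<Sum>i. G' i *v v i \<omega>) ((weight * decay ^ N / (1 - decay))\<^sup>2 * m)"
    by (rule L2_le_suminf(2)[where v = v, OF v G' wd decay_bounds(1,2)])
  also have "(weight * decay ^ N / (1 - decay))\<^sup>2 * m = gain * m * decay ^ (2 * N)"
    by (simp add: gain_def power_mult_distrib power_divide power_mult[symmetric] mult.commute)
  finally have "L2_le M (\<lambda>\<omega>. \<Sum>i. G' i *v v i \<omega>) (gain * m * decay ^ (2 * N))" .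
  from L2_le_cong_AE[OF L2_le_minus[OF L2_le_matrix[OF this, of H]] _ main] show ?thesis
    using L2_le_measurable[OF L2_moment_bound(4), of k T t] by simp
qed

text \<open>Young's inequality for the mixed term, with weight \<open>decay ^ N\<close>: the squared
  difference is of order \<open>decay ^ (2 * N)\<close>, so both resulting terms are of order
  \<open>decay ^ N\<close>.\<close>

lemma expected_deviation_le_expected_innovation: "\<exists>c\<ge>0. \<forall>k T t N. 1 \<le> k \<longrightarrow> t + k \<le> T \<longrightarrow> N \<le> T - t \<longrightarrow> expected_deviation k T t \<le> expected_innovation T k t + c * decay ^ N"
proof -
  define bY where "bY = (spectral_norm H)\<^sup>2 * (gain * (4 * m))"
  define bD where "bD = (spectral_norm H)\<^sup>2 * (gain * m)"
  have b: "0 \<le> bY" "0 \<le> bD" using m_nonneg by (auto simp: bY_def bD_def gain_def)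
  define s where "s = spectral_norm S"
  have s: "0 \<le> s" by (simp add: s_def spectral_norm_nonneg)
  have "expected_deviation k T t \<le> expected_innovation T k t + (s * (bY + 2 * bD)) * decay ^ N" if kTN: "1 \<le> k" "t + k \<le> T" "N \<le> T - t" for k T t N
  proof -
    define \<delta> where "\<delta> = decay ^ N"
    have \<delta>: "0 < \<delta>" "\<delta> \<le> 1" using decay_bounds by (auto simp: \<delta>_def power_le_one)
    define D where "D \<omega> = Z k T t \<omega> - Y T k t \<omega>" for \<omega>
    have YL: "L2_le M (Y T k t) bY" unfolding bY_def by (rule Y_L2[OF kTN(1,2)])
    have DL: "L2_le M D (bD * \<delta>\<^sup>2)"
      using Z_minus_Y_L2[OF kTN] by (simp add: D_def[abs_def] bD_def \<delta>_def power_mult[symmetric] mult_ac)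
    have iY: "integrable M (\<lambda>\<omega>. Y T k t \<omega> \<bullet> (S *v Y T k t \<omega>))" by (rule L2_le_bilinear(1)[OF YL YL])
    have pt: "Z k T t \<omega> \<bullet> (S *v Z k T t \<omega>) \<le> Y T k t \<omega> \<bullet> (S *v Y T k t \<omega>)
        + s * (\<delta> * (norm (Y T k t \<omega>))\<^sup>2 + (1 / \<delta> + 1) * (norm (D \<omega>))\<^sup>2)" for \<omega>
    proof -
      define y where "y = Y T k t \<omega>"
      define d where "d = D \<omega>"
      have z: "Z k T t \<omega> = y + d" by (simp add: y_def d_def D_def)
      have "(y + d) \<bullet> (S *v (y + d)) = y \<bullet> (S *v y) + 2 * (y \<bullet> (S *v d)) + d \<bullet> (S *v d)"
        using S_inner[of d y] by (simp add: matrix_vector_right_distrib inner_add inner_commute)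
      moreover have "y \<bullet> (S *v d) \<le> norm y * (s * norm d)"
        unfolding s_def by (intro order_trans[OF norm_cauchy_schwarz] mult_left_mono norm_matrix_vector) auto
      moreover have "d \<bullet> (S *v d) \<le> norm d * (s * norm d)"
        unfolding s_def by (intro order_trans[OF norm_cauchy_schwarz] mult_left_mono norm_matrix_vector) auto
      moreover have "s * (2 * (norm y * norm d)) \<le> s * (\<delta> * (norm y)\<^sup>2 + 1 / \<delta> * (norm d)\<^sup>2)"
      proof (rule mult_left_mono[OF _ s])
        have "2 * ((sqrt \<delta> * norm y) * (norm d / sqrt \<delta>)) \<le> (sqrt \<delta> * norm y)\<^sup>2 + (norm d / sqrt \<delta>)\<^sup>2"
          by (rule two_mult_le_squares)
        then show "2 * (norm y * norm d) \<le> \<delta> * (norm y)\<^sup>2 + 1 / \<delta> * (norm d)\<^sup>2"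
          using \<delta> by (simp add: power_mult_distrib power_divide)
      qed
      ultimately show ?thesis
        unfolding z y_def[symmetric] d_def[symmetric] by (simp add: algebra_simps power2_eq_square)
    qed
    have int: "integrable M (\<lambda>\<omega>. (norm (Y T k t \<omega>))\<^sup>2)" "integrable M (\<lambda>\<omega>. (norm (D \<omega>))\<^sup>2)"
      using YL DL by (auto simp: L2_le_def)
    have "expected_deviation k T t \<le> (\<integral>\<omega>. Y T k t \<omega> \<bullet> (S *v Y T k t \<omega>)
        + s * (\<delta> * (norm (Y T k t \<omega>))\<^sup>2 + (1 / \<delta> + 1) * (norm (D \<omega>))\<^sup>2) \<partial>M)"
      unfolding expected_deviation_def using int iY by (intro integral_mono bilinear_integrable pt) auto
    also have "\<dots> = expected_innovation T k t + s * (\<delta> * (\<integral>\<omega>. (norm (Y T k t \<omega>))\<^sup>2 \<partial>M) + (1 / \<delta> + 1) * (\<integral>\<omega>. (norm (D \<omega>))\<^sup>2 \<partial>M))"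
      unfolding expected_innovation_def using int iY by simp
    also have "\<dots> \<le> expected_innovation T k t + s * (\<delta> * bY + (1 / \<delta> + 1) * (bD * \<delta>\<^sup>2))"
      using YL DL \<delta> s by (intro add_left_mono mult_left_mono add_mono) (auto simp: L2_le_def)
    also have "(1 / \<delta> + 1) * (bD * \<delta>\<^sup>2) = bD * \<delta> + bD * (\<delta> * \<delta>)"
      using \<delta> by (simp add: field_simps power2_eq_square)
    also have "bD * (\<delta> * \<delta>) \<le> bD * \<delta>" using \<delta> b by (intro mult_left_mono) (auto simp: mult_le_one)
    finally have "expected_deviation k T t \<le> expected_innovation T k t + s * (\<delta> * bY + (bD * \<delta> + bD * \<delta>))"
      using s by (auto simp: mult_left_mono)
    then show ?thesis by (simp add: \<delta>_def algebra_simps)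
  qed
  moreover have "0 \<le> s * (bY + 2 * bD)" using s b by simp
  ultimately show ?thesis by blast
qed

end

section \<open>Lower bound for the optimal cost\<close>

text \<open>Dividing by \<open>N * T\<close> and letting \<open>T\<close> grow leaves
  \<open>(1 + a / N) * l + b * s ^ N + b / N\<close>, which tends to \<open>l\<close> with
  \<open>N\<close>. This bounds \<open>j\<close> from above; the other side is the first
  hypothesis.\<close>

lemma squeeze_limit:
  fixes j \<sigma> :: "nat \<Rightarrow> real"
  assumes le: "\<And>T. k \<le> T \<Longrightarrow> \<sigma> T \<le> j T" and lim: "(\<lambda>T. \<sigma> T / real T) \<longlonglongrightarrow> l"
    and s: "0 < s" "s < 1"
    and ge: "\<And>N T. k \<le> N \<Longrightarrow> 1 \<le> N \<Longrightarrow> N \<le> T \<Longrightarrow>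
      real N * j T \<le> (real N + a) * \<sigma> T + real N * b * (real N + 1 + real T * s ^ N) + b * (real N + real T + 1)"
  shows "(\<lambda>T. j T / real T) \<longlonglongrightarrow> l"
proof (rule order_tendstoI)
  fix y assume "y < l"
  then have "\<forall>\<^sub>F T in sequentially. y < \<sigma> T / real T" using lim by (auto dest: order_tendstoD)
  then show "\<forall>\<^sub>F T in sequentially. y < j T / real T"
    using eventually_ge_at_top[of k]
  proof eventually_elim
    case (elim T)
    have "\<sigma> T / real T \<le> j T / real T" using le[OF elim(2)] by (intro divide_right_mono) auto
    with elim show ?case by linarith
  qed
next
  fix y assume y: "l < y"
  have "(\<lambda>N. (1 + a / real N) * l + b * s ^ N + b / real N) \<longlonglongrightarrow> (1 + 0) * l + b * 0 + 0"
    using s by (intro tendsto_intros lim_const_over_n LIMSEQ_realpow_zero) auto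
  then have "\<forall>\<^sub>F N in sequentially. (1 + a / real N) * l + b * s ^ N + b / real N < y"
    using y by (auto dest: order_tendstoD)
  then obtain N where N: "(1 + a / real N) * l + b * s ^ N + b / real N < y" "k \<le> N" "1 \<le> N"
    using eventually_happens[OF eventually_conj[OF _ eventually_conj[OF eventually_ge_at_top[of k] eventually_ge_at_top[of 1]]]]
    by (metis (no_types, lifting) trivial_limit_sequentially)
  \<comment> \<open>From here on \<open>N\<close> is fixed, and every term with
    \<open>1 / real T\<close> vanishes in the limit.\<close>
  define rhs where "rhs T = (1 + a / real N) * (\<sigma> T / real T) + b * ((real N + 1) / real T + s ^ N)
      + b * (1 / real T + 1 / real N + (1 / real N) / real T)" for T
  have "rhs \<longlonglongrightarrow> (1 + a / real N) * l + b * (0 + s ^ N) + b * (0 + 1 / real N + 0)"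
    unfolding rhs_def by (intro tendsto_intros lim lim_const_over_n)
  then have "\<forall>\<^sub>F T in sequentially. rhs T < y"
    using N(1) by (intro order_tendstoD(2)) auto
  then show "\<forall>\<^sub>F T in sequentially. j T / real T < y"
    using eventually_ge_at_top[of N]
  proof eventually_elim
    case (elim T)
    have pos: "0 < real N" "0 < real T" using N(3) elim(2) by auto
    have "j T / real T = (real N * j T) / (real N * real T)" using pos by simp
    also have "\<dots> \<le> ((real N + a) * \<sigma> T + real N * b * (real N + 1 + real T * s ^ N) + b * (real N + real T + 1))
        / (real N * real T)"
      using ge[OF N(2,3) elim(2)] pos by (intro divide_right_mono) auto
    also have "\<dots> = rhs T" using pos unfolding rhs_def by (simp add: field_simps)
    finally show ?case using elim(1) by linarith
  qed
qed

context lqr_disturbances begin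

lemma adjoint_hist: "adjoint_state T (hist w T \<omega>) t = q T t \<omega>"
  unfolding adjoint_state_def by (intro sum.cong) (auto simp: hist_def)

lemma offset_hist: "t < T \<Longrightarrow> offset T (hist w T \<omega>) t = offset T (\<lambda>t. w t \<omega>) t"
  by (simp add: offset_def adjoint_hist) (simp add: hist_def)

lemma initial_cost_hist: "initial_cost x0 T (hist w T \<omega>) = initial_cost x0 T (\<lambda>t. w t \<omega>)"
  by (simp add: initial_cost_def adjoint_hist)

lemma component_measurable: "j < T \<Longrightarrow> (\<lambda>h. h j) \<in> borel_measurable (hist_space T :: (nat \<Rightarrow> real^'n) measure)"
  by (intro measurable_component_singleton) auto

lemma adjoint_state_measurable: "(\<lambda>h. adjoint_state T h t) \<in> borel_measurable (hist_space T)"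
  unfolding adjoint_state_def
  by (intro borel_measurable_sum borel_measurable_matrix_vector component_measurable) auto

lemma offset_measurable: "t < T \<Longrightarrow> (\<lambda>h. offset T h t) \<in> borel_measurable (hist_space T)"
  unfolding offset_def
  by (intro borel_measurable_add borel_measurable_diff borel_measurable_times borel_measurable_const
      borel_measurable_inner borel_measurable_matrix_vector adjoint_state_measurable component_measurable)

lemma initial_cost_measurable: "(\<lambda>h. initial_cost x0 T h) \<in> borel_measurable (hist_space T)"
  unfolding initial_cost_def
  by (intro borel_measurable_add borel_measurable_times borel_measurable_const
      borel_measurable_inner borel_measurable_matrix_vector adjoint_state_measurable)

text \<open>Given the first \<open>t + k\<close> disturbances, each \<open>future_mean\<close> is a
  constant, namely the mean of the coordinate from which it is subtracted.\<close>

lemma innovation_mean_zero: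
  assumes h: "h \<in> space (hist_space (t + k))" and "t + k \<le> T"
    and int: "\<And>j. j < T \<Longrightarrow> integrable (future W (T - (t + k)) (t + k) h) (\<lambda>x. x j)"
  shows "(\<integral>x. innovation T k t x \<partial>future W (T - (t + k)) (t + k) h) = 0"
proof -
  let ?\<mu> = "future W (T - (t + k)) (t + k) h"
  interpret \<mu>: prob_space ?\<mu> by (rule prob_space_future[OF h])
  define v where "v i = future_mean (T - (t + k)) (t + k) (t + i) h" for i
  define f where "f x = (\<Sum>i\<in>{k..<T - t}. matrix_power (transpose F) i *v (P *v (x (t + i) - v i)))" for x
  have i: "integrable ?\<mu> (\<lambda>x. matrix_power (transpose F) i *v (P *v (x (t + i) - v i)))"
    "(\<integral>x. matrix_power (transpose F) i *v (P *v (x (t + i) - v i)) \<partial>?\<mu>) = 0" if "i \<in> {k..<T - t}" for i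
  proof -
    have 1: "integrable ?\<mu> (\<lambda>x. x (t + i))" using that by (intro int) auto
    then have 2: "integrable ?\<mu> (\<lambda>x. x (t + i) - v i)" by simp
    have 3: "(\<integral>x. x (t + i) - v i \<partial>?\<mu>) = 0" using 1 by (simp add: v_def future_mean_def \<mu>.prob_space)
    note a = integral_matrix_vector[OF 2, of P]
    show "integrable ?\<mu> (\<lambda>x. matrix_power (transpose F) i *v (P *v (x (t + i) - v i)))"
      "(\<integral>x. matrix_power (transpose F) i *v (P *v (x (t + i) - v i)) \<partial>?\<mu>) = 0"
      using integral_matrix_vector[OF a(1), of "matrix_power (transpose F) i"] a(2) 3 by simp_all
  qed
  have f: "integrable ?\<mu> f" "(\<integral>x. f x \<partial>?\<mu>) = 0"
    unfolding f_def using i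
    by (auto intro!: Bochner_Integration.integrable_sum simp: Bochner_Integration.integral_sum[OF i(1)] simp del: atLeastLessThan_iff)
  have AE: "AE x in ?\<mu>. innovation T k t x = H *v f x"
    using future_extends[OF h]
  proof eventually_elim
    case (elim x)
    have "restrict x {..<t + k} = h"
      by (rule hist_space_eqI[OF restrict_hist_space h]) (use elim in auto)
    then show ?case by (simp add: innovation_def f_def v_def)
  qed
  have sets: "sets ?\<mu> = sets (hist_space T)" using sets_future[OF h, of "T - (t + k)"] assms(2) by simp
  have "innovation T k t \<in> borel_measurable ?\<mu>"
    unfolding measurable_cong_sets[OF sets refl] by (rule innovation_measurable)
  then have "(\<integral>x. innovation T k t x \<partial>?\<mu>) = (\<integral>x. H *v f x \<partial>?\<mu>)"
    using integral_matrix_vector(1)[OF f(1), of H] AE by (intro integral_cong_AE) auto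
  also have "\<dots> = 0" using integral_matrix_vector(2)[OF f(1), of H] f(2) by simp
  finally show ?thesis .
qed

text \<open>What is left of the deviation without the innovation: all its ingredients are chosen or
  revealed once \<open>u t\<close> is fixed. It plays the role of \<open>\<nu>\<close> in
  \<open>min_exp_lower\<close>.\<close>

definition known_part :: "nat \<Rightarrow> nat \<Rightarrow> nat \<Rightarrow> (nat \<Rightarrow> real^'d) \<Rightarrow> (nat \<Rightarrow> real^'n) \<Rightarrow> real^'d" where
  "known_part T k t u h = u t + K *v state A B x0 u h t
     + H *v ((\<Sum>i<k. matrix_power (transpose F) i *v (P *v h (t + i)))
       + (\<Sum>i\<in>{k..<T - t}. matrix_power (transpose F) i
            *v (P *v future_mean (T - (t + k)) (t + k) (t + i) (restrict h {..<t + k}))))"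

lemma known_part_cong:
  assumes "1 \<le> k" and "\<And>i. i \<le> t \<Longrightarrow> u i = u' i" and "\<And>i. i < t + k \<Longrightarrow> h i = h' i"
  shows "known_part T k t u h = known_part T k t u' h'"
proof -
  have "restrict h {..<t + k} = restrict h' {..<t + k}" using assms(3) by (intro restrict_ext) auto
  moreover have "state A B x0 u h t = state A B x0 u' h' t" using assms by (intro state_cong) auto
  ultimately show ?thesis unfolding known_part_def using assms by simp
qed

lemma deviation_split:
  assumes "t + k \<le> T"
  shows "deviation x0 T u h t = known_part T k t u h + innovation T k t h"
proof -
  have n: "T - t = k + (T - t - k)" using assms by simp
  have "adjoint_state T h t = (\<Sum>i<k. matrix_power (transpose F) i *v (P *v h (t + i)))
      + (\<Sum>i\<in>{k..<T - t}. matrix_power (transpose F) i *v (P *v h (t + i)))"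
    unfolding adjoint_state_def using assms
    by (subst sum.atLeastLessThan_concat[of 0 k "T - t", symmetric, folded lessThan_atLeast0]) auto
  then show ?thesis
    by (simp add: deviation_def known_part_def innovation_def matrix_vector_right_distrib
        matrix_vector_mult_diff_distrib sum_subtractf)
qed

text \<open>Convexity of the form of \<open>S\<close> at the innovation makes the pathwise bound
  affine in the known part, the shape that \<open>min_exp_lower\<close> asks for. By
  \<open>k \<le> N\<close> every deviation before the window can be split.\<close>

lemma STO_horizon_lower:
  assumes c0: "cost_lower_constant Qf c0"
    and k: "1 \<le> k" and N: "k \<le> N" "N \<le> T"
  shows "ennreal ((real N * (expected_initial T + (\<Sum>t<T - N. expected_innovation T k t + expected_offset T t)
        - (\<Sum>t=T - N..<T. \<integral>\<omega>. \<bar>offset T (\<lambda>t. w t \<omega>) t\<bar> \<partial>M))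
      - (\<Sum>t=T - N..<T. \<integral>\<omega>. (norm (transpose F *v q T t \<omega>))\<^sup>2 \<partial>M)
      - c0 * ((norm x0)\<^sup>2 + (\<Sum>t<T. \<integral>\<omega>. (norm (w t \<omega>))\<^sup>2 \<partial>M))) / (real N + c0))
    \<le> STO_horizon A B Q R Qf x0 W k T"
proof -
  let ?J = "lqr_cost A B Q R Qf x0 T"
  have "0 < c0" using c0 by (simp add: cost_lower_constant_def)
  then have pos: "0 < real N + c0" "0 < N" using k N by auto
  define G where "G h = (real N * (initial_cost x0 T h
        + (\<Sum>t<T - N. innovation T k t h \<bullet> (S *v innovation T k t h) + offset T h t)
        - (\<Sum>t=T - N..<T. \<bar>offset T h t\<bar>))
      - (\<Sum>t=T - N..<T. (norm (transpose F *v adjoint_state T h t))\<^sup>2)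
      - c0 * ((norm x0)\<^sup>2 + (\<Sum>t<T. (norm (h t))\<^sup>2))) / (real N + c0)" for h
  \<comment> \<open>The coefficient of the known part after division by \<open>N + c0\<close>.
    Inside the window the deviations were discarded, so it is 0 there.\<close>
  define c where "c \<tau> h = (if \<tau> < T - N then (2 * real N / (real N + c0)) *\<^sub>R (S *v innovation T k \<tau> h) else 0)" for \<tau> h
  \<comment> \<open>Dominates the minorant, the multipliers and every coordinate, so that
    integrability of \<open>\<Psi>\<close> alone gives that of all of them under each conditional
    law.\<close>
  define \<Psi> where "\<Psi> h = \<bar>G h\<bar> + (\<Sum>\<tau><T - k. norm (c \<tau> h)) + (\<Sum>j<T. norm (h j))" for h
  have Fm: "(\<lambda>h. norm (transpose F *v adjoint_state T h t)) \<in> borel_measurable (hist_space T)" for t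
    by (rule measurable_compose[OF borel_measurable_matrix_vector[OF adjoint_state_measurable] borel_measurable_norm])
  have Gm: "G \<in> borel_measurable (hist_space T)"
    unfolding G_def[abs_def]
    by (intro borel_measurable_divide borel_measurable_add borel_measurable_diff borel_measurable_times
        borel_measurable_const borel_measurable_sum borel_measurable_inner borel_measurable_matrix_vector
        borel_measurable_abs Fm borel_measurable_norm borel_measurable_power
        adjoint_state_measurable component_measurable offset_measurable initial_cost_measurable innovation_measurable)
      auto
  have cm: "c \<tau> \<in> borel_measurable (hist_space T)" for \<tau>
    unfolding c_def[abs_def]
    by (cases "\<tau> < T - N") (auto intro!: borel_measurable_scaleR borel_measurable_matrix_vector innovation_measurable)
  have \<Psi>m: "\<Psi> \<in> borel_measurable (hist_space T)"
    unfolding \<Psi>_def[abs_def]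
    by (intro borel_measurable_add borel_measurable_abs Gm borel_measurable_sum
        measurable_compose[OF cm borel_measurable_norm] measurable_compose[OF component_measurable borel_measurable_norm])
      auto
  have csum: "0 \<le> (\<Sum>\<tau><T - k. norm (c \<tau> h))" "0 \<le> (\<Sum>j<T. norm (h j))" for h by (auto intro!: sum_nonneg)
  have G\<Psi>: "\<bar>G h\<bar> \<le> \<Psi> h" for h using csum[of h] by (simp add: \<Psi>_def)
  have c\<Psi>: "norm (c \<tau> h) \<le> \<Psi> h" if "\<tau> < T - k" for \<tau> h
    using csum(2)[of h] member_le_sum[of \<tau> "{..<T - k}" "\<lambda>\<tau>. norm (c \<tau> h)"] that by (simp add: \<Psi>_def)
  have h\<Psi>: "norm (h j) \<le> \<Psi> h" if "j < T" for j and h :: "nat \<Rightarrow> real^'n"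
    using csum(1)[of h] member_le_sum[of j "{..<T}" "\<lambda>j. norm (h j)"] that by (simp add: \<Psi>_def)
  have J: "G h + (\<Sum>\<tau><T - k. known_part T k \<tau> u h \<bullet> c \<tau> h) \<le> ?J u h" for u h
  proof -
    define a where "a \<tau> = known_part T k \<tau> u h" for \<tau>
    define e where "e \<tau> = innovation T k \<tau> h" for \<tau>
    have "(\<Sum>\<tau><T - k. a \<tau> \<bullet> c \<tau> h) = (\<Sum>\<tau><T - N. a \<tau> \<bullet> c \<tau> h)"
      using N by (intro sum.mono_neutral_right) (auto simp: c_def)
    also have "\<dots> = (\<Sum>\<tau><T - N. 2 * real N / (real N + c0) * (a \<tau> \<bullet> (S *v e \<tau>)))"
      by (intro sum.cong) (auto simp: c_def e_def)
    also have "\<dots> = real N * (\<Sum>\<tau><T - N. 2 * (a \<tau> \<bullet> (S *v e \<tau>))) / (real N + c0)"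
      by (simp add: sum_distrib_left sum_divide_distrib mult.assoc mult.left_commute)
    finally have sum_eq: "(\<Sum>\<tau><T - k. a \<tau> \<bullet> c \<tau> h) = real N * (\<Sum>\<tau><T - N. 2 * (a \<tau> \<bullet> (S *v e \<tau>))) / (real N + c0)" .
    have dev: "e t \<bullet> (S *v e t) + 2 * (a t \<bullet> (S *v e t)) \<le> deviation x0 T u h t \<bullet> (S *v deviation x0 T u h t)"
      if "t < T - N" for t
    proof -
      have "deviation x0 T u h t = a t + e t"
        unfolding a_def e_def using that N by (intro deviation_split) simp
      then have "deviation x0 T u h t \<bullet> (S *v deviation x0 T u h t)
          = a t \<bullet> (S *v a t) + 2 * (a t \<bullet> (S *v e t)) + e t \<bullet> (S *v e t)"
        using S_inner[of "e t" "a t"] by (simp add: matrix_vector_right_distrib inner_add inner_commute)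
      with S_nonneg[of "a t"] show ?thesis by simp
    qed
    define X where "X = initial_cost x0 T h - (\<Sum>t=T - N..<T. \<bar>offset T h t\<bar>)"
    define Y where "Y = (\<Sum>t=T - N..<T. (norm (transpose F *v adjoint_state T h t))\<^sup>2)
        + c0 * ((norm x0)\<^sup>2 + (\<Sum>t<T. (norm (h t))\<^sup>2))"
    have "(\<Sum>t<T - N. e t \<bullet> (S *v e t) + offset T h t) + (\<Sum>t<T - N. 2 * (a t \<bullet> (S *v e t)))
        \<le> (\<Sum>t<T - N. deviation x0 T u h t \<bullet> (S *v deviation x0 T u h t) + offset T h t)"
      unfolding sum.distrib[symmetric] using dev by (intro sum_mono) (auto simp: algebra_simps)
    then have "real N * (X + ((\<Sum>t<T - N. e t \<bullet> (S *v e t) + offset T h t) + (\<Sum>t<T - N. 2 * (a t \<bullet> (S *v e t))))) - Y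
        \<le> real N * (X + (\<Sum>t<T - N. deviation x0 T u h t \<bullet> (S *v deviation x0 T u h t) + offset T h t)) - Y"
      by (intro diff_right_mono mult_left_mono add_left_mono) auto
    also have "\<dots> \<le> (real N + c0) * ?J u h"
      using cost_lower_constantD[OF c0 pos(2) N(2), of x0 h u] by (simp add: X_def Y_def algebra_simps)
    finally have "real N * (X + ((\<Sum>t<T - N. e t \<bullet> (S *v e t) + offset T h t) + (\<Sum>t<T - N. 2 * (a t \<bullet> (S *v e t))))) - Y
        \<le> (real N + c0) * ?J u h" .
    moreover have "G h + (\<Sum>\<tau><T - k. a \<tau> \<bullet> c \<tau> h)
        = (real N * (X + ((\<Sum>t<T - N. e t \<bullet> (S *v e t) + offset T h t) + (\<Sum>t<T - N. 2 * (a t \<bullet> (S *v e t))))) - Y) / (real N + c0)"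
      unfolding sum_eq G_def e_def[symmetric] X_def Y_def add_divide_distrib[symmetric] by (simp add: algebra_simps)
    ultimately show ?thesis
      using pos(1) unfolding a_def by (simp add: pos_divide_le_eq mult.commute)
  qed
  have mean_zero: "(\<integral>x. c \<tau> x \<partial>future W (T - (\<tau> + k)) (\<tau> + k) h) = 0"
    if \<tau>: "\<tau> < T - k" and h: "h \<in> space (hist_space (\<tau> + k))"
      and int: "integrable (future W (T - (\<tau> + k)) (\<tau> + k) h) \<Psi>" for \<tau> h
  proof (cases "\<tau> < T - N")
    case True
    let ?\<mu> = "future W (T - (\<tau> + k)) (\<tau> + k) h"
    have T: "\<tau> + k + (T - (\<tau> + k)) = T" using \<tau> by simp
    have "integrable ?\<mu> (\<lambda>x. x j)" if "j < T" for j
      by (rule integrable_future_bound[OF h T int component_measurable[OF that] h\<Psi>[OF that]])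
    then have z: "(\<integral>x. innovation T k \<tau> x \<partial>?\<mu>) = 0" using \<tau> by (intro innovation_mean_zero[OF h]) auto
    have ci: "integrable ?\<mu> (c \<tau>)" by (rule integrable_future_bound[OF h T int cm c\<Psi>[OF \<tau>]])
    show ?thesis
    \<comment> \<open>Integrability is known for \<open>c \<tau>\<close>. As \<open>S\<close> is
      invertible it passes to the innovation, so the second case is contradictory.\<close>
    proof (cases "integrable ?\<mu> (innovation T k \<tau>)")
      case True
      with z \<open>\<tau> < T - N\<close> show ?thesis
        using integral_matrix_vector[OF True, of S] by (simp add: c_def)
    next
      case False
      have "S *v innovation T k \<tau> x = ((real N + c0) / (2 * real N)) *\<^sub>R c \<tau> x" for x
        using pos \<open>\<tau> < T - N\<close> by (simp add: c_def)
      then have "innovation T k \<tau> = (\<lambda>x. ((real N + c0) / (2 * real N)) *\<^sub>R (matrix_inv S *v c \<tau> x))"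
        by (metis (no_types) matrix_vector_mul_assoc matrix_vector_mul_lid matrix_inv_left[OF pos_definite_invertible[OF pd_S]]
            matrix_vector_mult_scaleR)
      then have "integrable ?\<mu> (innovation T k \<tau>)" using integral_matrix_vector(1)[OF ci, of "matrix_inv S"] by simp
      with False show ?thesis by simp
    qed
  next
    case False
    then show ?thesis by (simp add: c_def)
  qed
  have min: "ennreal (integral\<^sup>L (future W (T - k) k h) G) \<le> min_exp W k ?J (T - k) 0 (\<lambda>_. 0) h"
    if h: "h \<in> space (hist_space k)" and int: "integrable (future W (T - k) k h) \<Psi>" for h
  proof -
    have "ennreal (\<integral>x. G x + (\<Sum>\<tau><0. known_part T k \<tau> (\<lambda>_. 0) h \<bullet> c \<tau> x) \<partial>future W (T - k) (0 + k) h)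
        \<le> min_exp W k ?J (T - k) 0 (\<lambda>_. 0) h"
    proof (rule min_exp_lower[where \<Psi> = \<Psi> and T = T])
      show "known_part T k \<tau> u h = known_part T k \<tau> u' h'"
        if "\<And>i. i \<le> \<tau> \<Longrightarrow> u i = u' i" "\<And>i. i < \<tau> + k \<Longrightarrow> h i = h' i" for \<tau> u u' h h'
        using k that by (rule known_part_cong)
      show "0 + k + (T - k) = T" using N by simp
    qed (use h int J Gm G\<Psi> cm c\<Psi> mean_zero in auto)
    then show ?thesis by simp
  qed
  have hm: "integrable M (\<lambda>\<omega>. G (hist w T \<omega>))"
    "(\<integral>\<omega>. G (hist w T \<omega>) \<partial>M) = (real N * (expected_initial T + (\<Sum>t<T - N. expected_innovation T k t + expected_offset T t)
        - (\<Sum>t=T - N..<T. \<integral>\<omega>. \<bar>offset T (\<lambda>t. w t \<omega>) t\<bar> \<partial>M))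
      - (\<Sum>t=T - N..<T. \<integral>\<omega>. (norm (transpose F *v q T t \<omega>))\<^sup>2 \<partial>M)
      - c0 * ((norm x0)\<^sup>2 + (\<Sum>t<T. \<integral>\<omega>. (norm (w t \<omega>))\<^sup>2 \<partial>M))) / (real N + c0)"
  proof -
    have Gh: "G (hist w T \<omega>) = (real N * (initial_cost x0 T (\<lambda>t. w t \<omega>)
        + (\<Sum>t<T - N. Y T k t \<omega> \<bullet> (S *v Y T k t \<omega>) + offset T (\<lambda>t. w t \<omega>) t)
        - (\<Sum>t=T - N..<T. \<bar>offset T (\<lambda>t. w t \<omega>) t\<bar>))
      - (\<Sum>t=T - N..<T. (norm (transpose F *v q T t \<omega>))\<^sup>2)
      - c0 * ((norm x0)\<^sup>2 + (\<Sum>t<T. (norm (w t \<omega>))\<^sup>2))) / (real N + c0)" for \<omega>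
      unfolding G_def initial_cost_hist adjoint_hist
      by (simp add: offset_hist Y_def) (simp add: hist_def)
    have i1: "integrable M (\<lambda>\<omega>. Y T k t \<omega> \<bullet> (S *v Y T k t \<omega>))" if "t < T - N" for t
      using that N by (intro L2_le_bilinear(1)[OF Y_L2 Y_L2] k) auto
    have i2: "integrable M (\<lambda>\<omega>. (norm (transpose F *v q T t \<omega>))\<^sup>2)" for t
      using L2_le_matrix[OF L2_moment_bound(3), of "transpose F" T t] by (simp add: L2_le_def)
    have i3: "integrable M (\<lambda>\<omega>. (norm (w t \<omega>))\<^sup>2)" for t using w_L2[of t] by (simp add: L2_le_def)
    note i4 = initial_cost_integrable[of T] offset_integrable[of T] integrable_abs[OF offset_integrable[of T]]
    have s1: "integrable M (\<lambda>\<omega>. \<Sum>t<T - N. Y T k t \<omega> \<bullet> (S *v Y T k t \<omega>) + offset T (\<lambda>t. w t \<omega>) t)"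
      by (intro Bochner_Integration.integrable_sum Bochner_Integration.integrable_add i1 i4) auto
    have s2: "integrable M (\<lambda>\<omega>. \<Sum>t=T - N..<T. \<bar>offset T (\<lambda>t. w t \<omega>) t\<bar>)"
      by (intro Bochner_Integration.integrable_sum i4)
    have s3: "integrable M (\<lambda>\<omega>. \<Sum>t=T - N..<T. (norm (transpose F *v q T t \<omega>))\<^sup>2)"
      by (intro Bochner_Integration.integrable_sum i2)
    have s4: "integrable M (\<lambda>\<omega>. \<Sum>t<T. (norm (w t \<omega>))\<^sup>2)"
      by (intro Bochner_Integration.integrable_sum i3)
    show "integrable M (\<lambda>\<omega>. G (hist w T \<omega>))"
      unfolding Gh using s1 s2 s3 s4 i4(1) by simp
    have e1: "(\<integral>\<omega>. (\<Sum>t<T - N. Y T k t \<omega> \<bullet> (S *v Y T k t \<omega>) + offset T (\<lambda>t. w t \<omega>) t) \<partial>M)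
        = (\<Sum>t<T - N. expected_innovation T k t + expected_offset T t)"
      unfolding expected_innovation_def expected_offset_def using i1 i4
      by (subst Bochner_Integration.integral_sum) (auto intro!: sum.cong)
    have e2: "(\<integral>\<omega>. (\<Sum>t=T - N..<T. \<bar>offset T (\<lambda>t. w t \<omega>) t\<bar>) \<partial>M)
        = (\<Sum>t=T - N..<T. \<integral>\<omega>. \<bar>offset T (\<lambda>t. w t \<omega>) t\<bar> \<partial>M)"
      by (intro Bochner_Integration.integral_sum i4)
    have e3: "(\<integral>\<omega>. (\<Sum>t=T - N..<T. (norm (transpose F *v q T t \<omega>))\<^sup>2) \<partial>M)
        = (\<Sum>t=T - N..<T. \<integral>\<omega>. (norm (transpose F *v q T t \<omega>))\<^sup>2 \<partial>M)"
      by (intro Bochner_Integration.integral_sum i2)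
    have e4: "(\<integral>\<omega>. (\<Sum>t<T. (norm (w t \<omega>))\<^sup>2) \<partial>M) = (\<Sum>t<T. \<integral>\<omega>. (norm (w t \<omega>))\<^sup>2 \<partial>M)"
      by (intro Bochner_Integration.integral_sum i3)
    show "(\<integral>\<omega>. G (hist w T \<omega>) \<partial>M) = (real N * (expected_initial T + (\<Sum>t<T - N. expected_innovation T k t + expected_offset T t)
        - (\<Sum>t=T - N..<T. \<integral>\<omega>. \<bar>offset T (\<lambda>t. w t \<omega>) t\<bar> \<partial>M))
      - (\<Sum>t=T - N..<T. \<integral>\<omega>. (norm (transpose F *v q T t \<omega>))\<^sup>2 \<partial>M)
      - c0 * ((norm x0)\<^sup>2 + (\<Sum>t<T. \<integral>\<omega>. (norm (w t \<omega>))\<^sup>2 \<partial>M))) / (real N + c0)"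
      unfolding Gh e1[symmetric] e2[symmetric] e3[symmetric] e4[symmetric] expected_initial_def
      using s1 s2 s3 s4 i4(1) by (simp add: prob_space)
  qed
  have \<Psi>i: "integrable (future W T 0 (\<lambda>_. undefined)) \<Psi>"
  proof -
    have "integrable M (\<lambda>\<omega>. norm (c \<tau> (hist w T \<omega>)))" if "\<tau> < T - k" for \<tau>
    proof (cases "\<tau> < T - N")
      case True
      have "L2_le M (Y T k \<tau>) ((spectral_norm H)\<^sup>2 * (gain * (4 * m)))" using True N k by (intro Y_L2) auto
      from integrable_norm_L2[OF L2_le_matrix[OF this, of S]] True show ?thesis
        by (simp add: c_def Y_def)
    qed (simp add: c_def)
    moreover have "integrable M (\<lambda>\<omega>. norm (hist w T \<omega> j))" if "j < T" for j
      using integrable_norm_L2[OF w_L2[of j]] that by (simp add: hist_def)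
    ultimately have "integrable M (\<lambda>\<omega>. \<Psi> (hist w T \<omega>))"
      unfolding \<Psi>_def using hm(1)
      by (intro Bochner_Integration.integrable_add Bochner_Integration.integrable_sum integrable_abs) auto
    then show ?thesis
      unfolding future_from_start using \<Psi>m by (subst integrable_distr_eq[OF measurable_hist]) auto
  qed
  have "ennreal (integral\<^sup>L (future W (k + (T - k)) 0 (\<lambda>_. undefined)) G)
      \<le> draws W k 0 (min_exp W k ?J (T - k) 0 (\<lambda>_. 0)) (\<lambda>_. undefined)"
  proof (rule draws_lower[OF Gm G\<Psi> min])
    show "integrable (future W (k + (T - k)) 0 (\<lambda>_. undefined)) \<Psi>" using \<Psi>i N by simp
  qed (use N in \<open>auto simp: space_PiM\<close>)
  moreover have "integral\<^sup>L (future W (k + (T - k)) 0 (\<lambda>_. undefined)) G = (\<integral>\<omega>. G (hist w T \<omega>) \<partial>M)"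
    using N unfolding future_from_start by (simp add: integral_distr[OF measurable_hist Gm])
  ultimately show ?thesis unfolding STO_horizon_def hm(2) by simp
qed

text \<open>The policy bounds the optimum from above for \<open>T \<ge> k\<close>, so finite values
  may be treated as reals; \<open>squeeze_limit\<close> then transfers the limit from the optimum to
  the policy.\<close>

lemma optimality:
  assumes k: "1 \<le> k" and conv: "convergent (\<lambda>T. STO_horizon A B Q R Qf x0 W k T / of_nat T)"
  shows "STO A B Q R Qf x0 W k < \<infinity>"
    and "(\<lambda>T. expected_cost k T / real T) \<longlonglongrightarrow> enn2real (STO A B Q R Qf x0 W k)"
    and "(\<lambda>T. ennreal (expected_cost k T) / of_nat T) \<longlonglongrightarrow> STO A B Q R Qf x0 W k"
proof -
  let ?L = "STO A B Q R Qf x0 W k"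
  obtain c where "cost_bound c" using cost_bound_exists ..
  note c = cost_boundD[OF this]
  define \<sigma> where "\<sigma> T = enn2real (STO_horizon A B Q R Qf x0 W k T)" for T
  have STO: "STO_horizon A B Q R Qf x0 W k T = ennreal (\<sigma> T)" and \<sigma>le: "\<sigma> T \<le> expected_cost k T" if "k \<le> T" for T
  proof -
    note up = STO_horizon_upper[OF k that]
    then have "STO_horizon A B Q R Qf x0 W k T < \<top>" by (rule le_less_trans) simp
    then show eq: "STO_horizon A B Q R Qf x0 W k T = ennreal (\<sigma> T)" by (simp add: \<sigma>_def)
    show "\<sigma> T \<le> expected_cost k T" using up unfolding eq by (simp add: expected_cost_nonneg ennreal_le_iff)
  qed
  have \<sigma>0: "0 \<le> \<sigma> T" for T by (simp add: \<sigma>_def)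
  have lim: "(\<lambda>T. STO_horizon A B Q R Qf x0 W k T / of_nat T) \<longlonglongrightarrow> ?L"
    using conv unfolding STO_def by (simp add: convergent_LIMSEQ_iff)
  have ev: "\<forall>\<^sub>F T in sequentially. STO_horizon A B Q R Qf x0 W k T / of_nat T = ennreal (\<sigma> T / real T)"
    using eventually_ge_at_top[of k]
  proof eventually_elim
    case (elim T)
    then show ?case using k \<sigma>0[of T] by (simp add: STO ennreal_of_nat_eq_real_of_nat divide_ennreal)
  qed
  have lim': "(\<lambda>T. ennreal (\<sigma> T / real T)) \<longlonglongrightarrow> ?L"
    using lim ev by (rule Lim_transform_eventually)
  \<comment> \<open>For \<open>T \<ge> 1\<close> the linear bound \<open>c * (real T + 1)\<close> is
    at most \<open>2 * c * real T\<close>. Finiteness of the limit has to be known before passing to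
    \<open>enn2real\<close>.\<close>
  have "?L \<le> ennreal (2 * c)"
  proof (rule tendsto_upperbound[OF lim'])
    show "\<forall>\<^sub>F T in sequentially. ennreal (\<sigma> T / real T) \<le> ennreal (2 * c)"
      using eventually_ge_at_top[of k]
    proof eventually_elim
      case (elim T)
      have "\<sigma> T \<le> c * (real T + 1)" using \<sigma>le[OF elim] c(2)[of k T] by simp
      also have "\<dots> \<le> c * (2 * real T)" using elim k c(1) by (intro mult_left_mono) auto
      finally have "\<sigma> T / real T \<le> 2 * c" using elim k by (simp add: pos_divide_le_eq mult_ac)
      then show ?case by (rule ennreal_leI)
    qed
  qed simp
  then show fin: "?L < \<infinity>" by (rule le_less_trans) simp
  define l where "l = enn2real ?L"
  have L: "?L = ennreal l" using fin by (simp add: l_def)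
  have "(\<lambda>T. enn2real (ennreal (\<sigma> T / real T))) \<longlonglongrightarrow> l"
    using lim' unfolding L by (rule tendsto_enn2real) (simp add: l_def)
  then have \<sigma>lim: "(\<lambda>T. \<sigma> T / real T) \<longlonglongrightarrow> l" using \<sigma>0 by simp
  obtain c0 where c0: "cost_lower_constant Qf c0" using cost_lower_bound[OF psd_Qf] ..
  then have c0_pos: "0 < c0" by (simp add: cost_lower_constant_def)
  obtain cO where cO: "0 \<le> cO" "\<And>T t. (\<integral>\<omega>. \<bar>offset T (\<lambda>t. w t \<omega>) t\<bar> \<partial>M) \<le> cO"
    using offset_bound by metis
  obtain cD where cD: "0 \<le> cD" "\<And>t T N. t + k \<le> T \<Longrightarrow> N \<le> T - t \<Longrightarrow> expected_deviation k T t \<le> expected_innovation T k t + cD * decay ^ N"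
    using expected_deviation_le_expected_innovation k by metis
  define cF where "cF = (spectral_norm (transpose F))\<^sup>2 * moment_bound"
  have cF: "0 \<le> cF" "(\<integral>\<omega>. (norm (transpose F *v q T t \<omega>))\<^sup>2 \<partial>M) \<le> cF" for T t
    using moment_bound_nonneg L2_le_matrix[OF L2_moment_bound(3), of "transpose F" T t] by (auto simp: cF_def L2_le_def)
  \<comment> \<open>The sum of all constants occurring below, so that each of them is at most
    \<open>b\<close>.\<close>
  define b where "b = cO + c + cD + cF + c0 * (norm x0)\<^sup>2 + c0 * m"
  have jlim: "(\<lambda>T. expected_cost k T / real T) \<longlonglongrightarrow> l"
  proof (rule squeeze_limit[OF \<sigma>le \<sigma>lim decay_bounds(1,2)])
    fix N T assume N: "k \<le> N" "1 \<le> N" "N \<le> T"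
    define E where "E = expected_initial T + (\<Sum>t<T - N. expected_innovation T k t + expected_offset T t)"
    define W1 where "W1 = (\<Sum>t=T - N..<T. \<integral>\<omega>. \<bar>offset T (\<lambda>t. w t \<omega>) t\<bar> \<partial>M)"
    define W2 where "W2 = (\<Sum>t=T - N..<T. \<integral>\<omega>. (norm (transpose F *v q T t \<omega>))\<^sup>2 \<partial>M)"
    define W3 where "W3 = (\<Sum>t<T. \<integral>\<omega>. (norm (w t \<omega>))\<^sup>2 \<partial>M)"
    have "ennreal ((real N * (E - W1) - W2 - c0 * ((norm x0)\<^sup>2 + W3)) / (real N + c0)) \<le> ennreal (\<sigma> T)"
      unfolding E_def W1_def W2_def W3_def
      using STO_horizon_lower[OF c0 k N(1,3)] STO[of T] N by (simp add: algebra_simps)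
    then have "(real N * (E - W1) - W2 - c0 * ((norm x0)\<^sup>2 + W3)) / (real N + c0) \<le> \<sigma> T"
      using \<sigma>0 by (simp add: ennreal_le_iff)
    then have low: "real N * (E - W1) - W2 - c0 * ((norm x0)\<^sup>2 + W3) \<le> (real N + c0) * \<sigma> T"
      using c0_pos by (simp add: pos_divide_le_eq mult.commute add_nonneg_pos)
    have W1: "W1 \<le> real N * cO"
      unfolding W1_def using N sum_bounded_above[of "{T - N..<T}" "\<lambda>t. \<integral>\<omega>. \<bar>offset T (\<lambda>t. w t \<omega>) t\<bar> \<partial>M" cO] cO(2)
      by simp
    have W2: "W2 \<le> real N * cF"
      unfolding W2_def using N sum_bounded_above[of "{T - N..<T}" "\<lambda>t. \<integral>\<omega>. (norm (transpose F *v q T t \<omega>))\<^sup>2 \<partial>M" cF] cF(2)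
      by simp
    have W3: "W3 \<le> real T * m"
      unfolding W3_def using w_L2 sum_bounded_above[of "{..<T}" "\<lambda>t. \<integral>\<omega>. (norm (w t \<omega>))\<^sup>2 \<partial>M" m]
      by (simp add: L2_le_def)
    have "(\<Sum>t<T - N. expected_deviation k T t + expected_offset T t) \<le> (\<Sum>t<T - N. (expected_innovation T k t + expected_offset T t) + cD * decay ^ N)"
    proof (rule sum_mono)
      fix t assume "t \<in> {..<T - N}"
      then have "t + k \<le> T" "N \<le> T - t" using N by auto
      from cD(2)[OF this] show "expected_deviation k T t + expected_offset T t \<le> (expected_innovation T k t + expected_offset T t) + cD * decay ^ N" by simp
    qed
    also have "\<dots> = (\<Sum>t<T - N. expected_innovation T k t + expected_offset T t) + real (T - N) * (cD * decay ^ N)"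
      by (simp add: sum.distrib)
    also have "real (T - N) * (cD * decay ^ N) \<le> real T * (cD * decay ^ N)"
      using cD(1) decay_bounds by (intro mult_right_mono) auto
    finally have J: "expected_cost k T \<le> E + cD * (real T * decay ^ N) + c * (real N + 1)"
      using c(3)[OF N(3), of k] by (simp add: E_def algebra_simps)
    have nn: "0 \<le> real T * decay ^ N" "0 \<le> c0 * (norm x0)\<^sup>2" "0 \<le> c0 * m"
      using decay_bounds c0_pos m_nonneg by auto
    have "expected_cost k T - E + W1 \<le> b * (real N + 1 + real T * decay ^ N)"
    proof -
      have "expected_cost k T - E + W1 \<le> cD * (real T * decay ^ N) + (c + cO) * (real N + 1)"
        using J W1 cO(1) by (simp add: algebra_simps)
      also have "\<dots> \<le> b * (real T * decay ^ N) + b * (real N + 1)"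
        using nn c(1) cO(1) cD(1) cF(1) by (intro add_mono mult_right_mono) (auto simp: b_def)
      finally show ?thesis by (simp add: algebra_simps)
    qed
    then have 1: "real N * (expected_cost k T - E + W1) \<le> real N * (b * (real N + 1 + real T * decay ^ N))"
      by (intro mult_left_mono) auto
    have 2: "W2 + c0 * ((norm x0)\<^sup>2 + W3) \<le> b * (real N + real T + 1)"
    proof -
      have "c0 * W3 \<le> c0 * (real T * m)" using W3 c0_pos by (intro mult_left_mono) auto
      then have "W2 + c0 * ((norm x0)\<^sup>2 + W3) \<le> cF * real N + (c0 * m) * real T + (c0 * (norm x0)\<^sup>2) * 1"
        using W2 by (simp add: algebra_simps)
      also have "\<dots> \<le> b * real N + b * real T + b * 1"
        using nn c(1) cO(1) cD(1) cF(1) by (intro add_mono mult_right_mono) (auto simp: b_def)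
      finally show ?thesis by (simp add: algebra_simps)
    qed
    from low 1 2 show "real N * expected_cost k T \<le> (real N + c0) * \<sigma> T
        + real N * b * (real N + 1 + real T * decay ^ N) + b * (real N + real T + 1)"
      by (simp add: algebra_simps)
  qed
  then show "(\<lambda>T. expected_cost k T / real T) \<longlonglongrightarrow> enn2real ?L" by (simp add: l_def)
  have "(\<lambda>T. ennreal (expected_cost k T / real T)) \<longlonglongrightarrow> ?L" unfolding L by (intro tendsto_ennrealI jlim)
  moreover have "\<forall>\<^sub>F T in sequentially. ennreal (expected_cost k T / real T) = ennreal (expected_cost k T) / of_nat T"
    using eventually_gt_at_top[of 0]
    by eventually_elim (simp add: expected_cost_nonneg ennreal_of_nat_eq_real_of_nat divide_ennreal)
  ultimately show "(\<lambda>T. ennreal (expected_cost k T) / of_nat T) \<longlonglongrightarrow> ?L"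
    by (rule Lim_transform_eventually)
qed

text \<open>Both values are limits of averaged policy costs, and the constant depending on
  \<open>k\<close> in \<open>expected_cost_difference\<close> disappears after division by
  \<open>T\<close>.\<close>

lemma STO_difference:
  assumes conv: "\<And>k. 1 \<le> k \<Longrightarrow> convergent (\<lambda>T. STO_horizon A B Q R Qf x0 W k T / of_nat T)"
  shows "is_bigO (\<lambda>k. enn2real (STO A B Q R Qf x0 W k) - enn2real (STO A B Q R Qf x0 W (k + 1)))
    (\<lambda>k. (spectral_norm (matrix_power F k))\<^sup>2)"
proof -
  obtain c where c: "0 < c" "\<And>k. \<exists>c'. \<forall>T\<ge>k + 1.
      \<bar>expected_cost k T - expected_cost (k + 1) T\<bar> \<le> c * real T * (spectral_norm (matrix_power F k))\<^sup>2 + c'"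
    using expected_cost_difference by blast
  have "\<bar>enn2real (STO A B Q R Qf x0 W k) - enn2real (STO A B Q R Qf x0 W (k + 1))\<bar>
      \<le> c * (spectral_norm (matrix_power F k))\<^sup>2" if k: "1 \<le> k" for k
  proof -
    define \<phi> where "\<phi> = (spectral_norm (matrix_power F k))\<^sup>2"
    obtain c' where c': "\<And>T. k + 1 \<le> T \<Longrightarrow> \<bar>expected_cost k T - expected_cost (k + 1) T\<bar> \<le> c * real T * \<phi> + c'"
      using c(2)[of k] unfolding \<phi>_def by blast
    have k1: "1 \<le> k + 1" by simp
    have "(\<lambda>T. \<bar>expected_cost k T / real T - expected_cost (k + 1) T / real T\<bar>) \<longlonglongrightarrow>
        \<bar>enn2real (STO A B Q R Qf x0 W k) - enn2real (STO A B Q R Qf x0 W (k + 1))\<bar>"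
      using optimality(2)[OF k conv[OF k]] optimality(2)[OF k1 conv[OF k1]] by (intro tendsto_rabs tendsto_diff)
    moreover have "(\<lambda>T. c * \<phi> + c' / real T) \<longlonglongrightarrow> c * \<phi> + 0"
      by (intro tendsto_intros lim_const_over_n)
    moreover have "\<forall>\<^sub>F T in sequentially. \<bar>expected_cost k T / real T - expected_cost (k + 1) T / real T\<bar> \<le> c * \<phi> + c' / real T"
      using eventually_ge_at_top[of "k + 1"]
    proof eventually_elim
      case (elim T)
      then have T: "0 < real T" by simp
      have "\<bar>expected_cost k T / real T - expected_cost (k + 1) T / real T\<bar> = \<bar>expected_cost k T - expected_cost (k + 1) T\<bar> / real T"
        using T by (simp add: diff_divide_distrib[symmetric])
      also have "\<dots> \<le> (c * real T * \<phi> + c') / real T" using c'[OF elim] T by (intro divide_right_mono) auto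
      also have "\<dots> = c * \<phi> + c' / real T" using T by (simp add: field_simps)
      finally show ?case .
    qed
    ultimately have "\<bar>enn2real (STO A B Q R Qf x0 W k) - enn2real (STO A B Q R Qf x0 W (k + 1))\<bar> \<le> c * \<phi> + 0"
      by (intro tendsto_le[OF trivial_limit_sequentially])
    then show ?thesis by (simp add: \<phi>_def)
  qed
  then show ?thesis using c(1) by (auto simp: is_bigO_def)
qed

text \<open>\<open>predictive_policy\<close> demands measurability for the sigma-algebra of the
  first \<open>t + k\<close> disturbances, a finer claim than measurability in \<open>M\<close>. The
  state collects forecasts made earlier, whence the auxiliary claims for every later index
  \<open>s\<close>.\<close>

lemma policy_measurable_past:
  assumes k: "1 \<le> k"
  shows "U k t \<in> borel_measurable (past_algebra M w (t + k))"
proof -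
  have wm: "w i \<in> borel_measurable (past_algebra M w s)" if "i < s" for i s
  proof -
    have "(\<lambda>\<omega>. hist w s \<omega> i) \<in> borel_measurable (past_algebra M w s)"
      by (rule measurable_compose[OF measurable_hist_past component_measurable[OF that]])
    then show ?thesis using that by (simp add: hist_def)
  qed
  have cm: "cond_mean M w j (t + k - 1) \<in> borel_measurable (past_algebra M w s)" if "t + k \<le> s" for j t s
  proof -
    have sub: "sets (past_algebra M w (t + k)) \<subseteq> sets (past_algebra M w s)"
    proof
      fix Z assume "Z \<in> sets (past_algebra M w (t + k))"
      then obtain E where E: "E \<in> sets (hist_space (t + k))" "Z = hist w (t + k) -` E \<inter> space M"
        unfolding past_algebra_def by (auto simp: sets_vimage_algebra2 hist_in_space)
      have "(\<lambda>\<omega>. restrict (hist w s \<omega>) {..<t + k}) \<in> measurable (past_algebra M w s) (hist_space (t + k))"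
        by (rule measurable_compose[OF measurable_hist_past measurable_restrict_subset]) (use that in auto)
      moreover have "(\<lambda>\<omega>. restrict (hist w s \<omega>) {..<t + k}) = hist w (t + k)"
        using that by (auto simp: hist_def fun_eq_iff)
      ultimately have "hist w (t + k) -` E \<inter> space (past_algebra M w s) \<in> sets (past_algebra M w s)"
        using E(1) by (auto intro: measurable_sets)
      then show "Z \<in> sets (past_algebra M w s)" using E(2) by (simp add: past_algebra_def)
    qed
    have "Suc (t + k - 1) = t + k" using k by simp
    then have "cond_mean M w j (t + k - 1) \<in> borel_measurable (past_algebra M w (t + k))"
      unfolding cond_mean_def[abs_def] by (simp only:) (intro borel_measurable_vec_lambda borel_measurable_cond_exp)
    moreover have "subalgebra (past_algebra M w s) (past_algebra M w (t + k))"
      using sub by (simp add: subalgebra_def past_algebra_def)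
    ultimately show ?thesis by (rule measurable_from_subalg[rotated])
  qed
  have fm: "forecast k t \<in> borel_measurable (past_algebra M w s)" if "t + k \<le> s" for t s
    unfolding forecast_def[abs_def]
    by (intro borel_measurable_add borel_measurable_sum borel_measurable_suminf borel_measurable_matrix_vector wm cm)
      (use that in auto)
  have xm: "X k t \<in> borel_measurable (past_algebra M w s)" if "t + k \<le> s" for t s
    using that
  proof (induction t)
    case 0
    have "X k 0 = (\<lambda>\<omega>. x0)" by (auto simp: X_0)
    then show ?case by simp
  next
    case (Suc t)
    show ?case
      unfolding X_Suc[abs_def]
      by (intro borel_measurable_add borel_measurable_diff borel_measurable_matrix_vector wm fm Suc.IH)
        (use Suc.prems k in auto)
  qed
  show ?thesis
    unfolding U_eq[abs_def]
    by (intro borel_measurable_diff borel_measurable_uminus borel_measurable_matrix_vector xm fm) auto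
qed

lemma policy_optimal:
  assumes k: "1 \<le> k" and conv: "convergent (\<lambda>T. STO_horizon A B Q R Qf x0 W k T / of_nat T)"
  shows "optimal_policy A B Q R Qf x0 M w W k (U k)"
  unfolding optimal_policy_def predictive_policy_def nn_integral_cost
  using policy_measurable_past[OF k] optimality(3)[OF assms] by blast

end

section \<open>Optimality of the policy and benefit of predictions\<close>

theorem theorem4p1:
  fixes A Q Qf P F :: "real^'n^'n" and B :: "real^'d^'n" and R :: "real^'d^'d"
    and x0 :: "real^'n" and m lam :: real
    and M :: "'a measure" and w :: "nat \<Rightarrow> 'a \<Rightarrow> real^'n"
    and W :: "nat \<Rightarrow> (nat \<Rightarrow> real^'n) \<Rightarrow> (real^'n) measure"
  assumes "pos_semidef Q" and "pos_semidef Qf" and "pos_definite R"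
    and "stabilizable A B" and "detectable A Q"
    and "pos_semidef P" and "riccati_solution A B Q R P"
    and F: "F = A - B ** lqr_gain A B R P"
    and lam: "lam = (1 + spec_radius F) / 2"
    and "prob_space M" and "\<And>t. w t \<in> borel_measurable M"
    and "conditional_distributions M w W"
    and "m > 0"
    and "\<And>t t'. integrable M (\<lambda>\<omega>. w t \<omega> \<bullet> w t' \<omega>)"
    and "\<And>t t'. (\<integral>\<omega>. w t \<omega> \<bullet> w t' \<omega> \<partial>M) \<le> m"
    and limits_exist: "\<And>k. k \<ge> 1 \<Longrightarrow>
      convergent (\<lambda>T. STO_horizon A B Q R Qf x0 W k T / of_nat T)"
  shows "(\<forall>k\<ge>1. optimal_policy A B Q R Qf x0 M w W k
      (feedback_control A B x0 w (\<lambda>t x \<omega>.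
        - ((matrix_inv (R + transpose B ** P ** B) ** transpose B) *v
            (P *v (A *v x)
             + (\<Sum>i<k. matrix_power (transpose F) i *v (P *v w (t + i) \<omega>))
             + (\<Sum>i. matrix_power (transpose F) (k + i) *v
                    (P *v cond_mean M w (t + (k + i)) (t + k - 1) \<omega>)))))))
    \<and> (\<forall>k\<ge>1. STO A B Q R Qf x0 W k < \<infinity>)
    \<and> is_bigO (\<lambda>k. enn2real (STO A B Q R Qf x0 W k) - enn2real (STO A B Q R Qf x0 W (k + 1)))
        (\<lambda>k. (spectral_norm (matrix_power F k))\<^sup>2)
    \<and> is_bigO (\<lambda>k. (spectral_norm (matrix_power F k))\<^sup>2) (\<lambda>k. lam ^ (2 * k))
    \<and> is_bigO (\<lambda>k. enn2real (STO A B Q R Qf x0 W k) - enn2real (STO A B Q R Qf x0 W (k + 1)))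
        (\<lambda>k. lam ^ (2 * k))"
proof -
  have lqr: "lqr A Q P B R" using assms by unfold_locales
  interpret prob_space M by fact
  have dist: "disturbances M W w"
    using \<open>conditional_distributions M w W\<close> \<open>\<And>t. w t \<in> borel_measurable M\<close>
    by unfold_locales (auto simp: conditional_distributions_def)
  \<comment> \<open>The case \<open>t' = t\<close> of the moment bounds, as the inner product of
    \<open>w t\<close> with itself is its squared norm.\<close>
  have L2: "L2_le M (w t) m" for t
    using assms by (simp add: L2_le_def power2_norm_eq_inner)
  interpret L: lqr_disturbances A Q P B R M W w x0 Qf m
    using lqr dist L2 \<open>pos_semidef Qf\<close> by (intro lqr_disturbances.intro lqr_disturbances_axioms.intro)
  have F_eq: "F = L.F" by (simp add: F L.F_def L.K_def)
  have lam_eq: "lam = L.rate" by (simp add: lam L.rate_def F_eq)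
  let ?diff = "\<lambda>k. enn2real (STO A B Q R Qf x0 W k) - enn2real (STO A B Q R Qf x0 W (k + 1))"
  have policy: "feedback_control A B x0 w (\<lambda>t x \<omega>.
        - ((matrix_inv (R + transpose B ** P ** B) ** transpose B) *v
            (P *v (A *v x)
             + (\<Sum>i<k. matrix_power (transpose F) i *v (P *v w (t + i) \<omega>))
             + (\<Sum>i. matrix_power (transpose F) (k + i) *v
                    (P *v cond_mean M w (t + (k + i)) (t + k - 1) \<omega>))))) = L.U k" for k
    unfolding L.U_def F_eq by (intro arg_cong[where f = "feedback_control A B x0 w"] ext)
      (simp add: L.policy_def L.H_def L.S_def)
  have diff: "is_bigO ?diff (\<lambda>k. (spectral_norm (matrix_power F k))\<^sup>2)"
    unfolding F_eq by (rule L.STO_difference[OF limits_exist])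
  have power: "(spectral_norm (matrix_power F k))\<^sup>2 \<le> L.growth\<^sup>2 * lam ^ (2 * k)" for k
  proof -
    have "(spectral_norm (matrix_power F k))\<^sup>2 \<le> (L.growth * lam ^ k)\<^sup>2"
      unfolding F_eq lam_eq by (intro power_mono L.spectral_norm_power_F spectral_norm_nonneg)
    then show ?thesis by (simp add: power_mult_distrib power_mult[symmetric] mult.commute)
  qed
  have power_bigO: "is_bigO (\<lambda>k. (spectral_norm (matrix_power F k))\<^sup>2) (\<lambda>k. lam ^ (2 * k))"
    unfolding is_bigO_def using power L.growth(1) by (intro exI[of _ "L.growth\<^sup>2"]) simp
  obtain C where C: "C > 0" "\<And>k. 1 \<le> k \<Longrightarrow> \<bar>?diff k\<bar> \<le> C * (spectral_norm (matrix_power F k))\<^sup>2"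
    using diff by (auto simp: is_bigO_def)
  have "\<bar>?diff k\<bar> \<le> (C * L.growth\<^sup>2) * lam ^ (2 * k)" if "1 \<le> k" for k
  proof -
    have "C * (spectral_norm (matrix_power F k))\<^sup>2 \<le> C * (L.growth\<^sup>2 * lam ^ (2 * k))"
      using C(1) by (intro mult_left_mono power) auto
    with C(2)[OF that] show ?thesis by (simp add: mult.assoc)
  qed
  then have diff_bigO: "is_bigO ?diff (\<lambda>k. lam ^ (2 * k))"
    unfolding is_bigO_def using C(1) L.growth(1) by (intro exI[of _ "C * L.growth\<^sup>2"]) simp
  show ?thesis
    unfolding policy using diff power_bigO diff_bigO L.policy_optimal[OF _ limits_exist] L.optimality(1)[OF _ limits_exist]
    by (intro conjI allI impI)
qed

end
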